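(* Consider $\min_{x\in\mathcal{X}}f(x)$, $f(x)=\mathbb{E}[f(x;\xi)]$, with $\mathcal{X}\subset\mathbb{R}^d$ open and convex, and let $\{x^k\}_k$ be generated by the stochastic mirror descent method $$x^{k+1}=\operatorname*{argmin}_{y\in\overline{\mathcal{X}}}\Big\{\langle\nabla f(x^k;\xi^k),y-x^k\rangle+\alpha_k^{-1}D_h(y,x^k)\Big\},\qquad k\ge0,$$ from $x^0\in\mathcal{X}$. Suppose that the mirror geometry and relative smoothness assumption (with constant $\mathsf{L}>0$) and the sample loss assumption (with exponent $q>2$) stated in the context hold, and that the step-sizes satisfy $$\alpha_k\in(0,1/\mathsf{L}),\qquad\sum_{k=0}^\infty\alpha_k=\infty,\qquad\sum_{k=0}^\infty r_{k+1}^{q/2}<\infty\quad\text{with}\quad r_k:=\sum_{i=k}^\infty\alpha_i^2 .$$ If $z^0=\nabla h(x^0)$ is drawn from any distribution with a density (with respect to Lebesgue measure), then $$\mathbb{P}\Big(\lim_{k\to\infty}x^k\in\mathcal{X}^*\Big)=0,\qquad \mathcal{X}^*:=\{x\in\mathcal{X}:\nabla f(x)=0,\ \lambda_{\min}(\nabla^2f(x))<0\}.$$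
   Context: $D_h(y,x):=h(y)-h(x)-\langle\nabla h(x),y-x\rangle$ is the Bregman divergence of the kernel $h$, and $h^*$ is the convex conjugate of $h$. The initial point is independent of the samples $\{\xi^k\}_k$. The event in the conclusion is that $\{x^k\}_k$ converges with limit in $\mathcal{X}^*$. The map $(x,\xi)\mapsto\nabla f(x;\xi)$ and its derivative $(x,\xi)\mapsto\nabla^2f(x;\xi)$ are jointly measurable. Mirror geometry and relative smoothness assumption. (i) The kernel $h:\mathbb{R}^d\to(-\infty,+\infty]$ is a proper, closed, convex function that is essentially smooth (whenever $x^j\in\mathcal{X}$ converges to a boundary point of $\operatorname{dom}h$, $\|\nabla h(x^j)\|\to\infty$), with $\mathcal{X}=\operatorname{int}(\operatorname{dom}h)$ and $\operatorname{dom}h^*=\mathbb{R}^d$; on $\mathcal{X}$, $h$ is $\mathcal{C}^2$ and $\nabla^2h(x)\succ0$ for all $x\in\mathcal{X}$. (ii) There is $\mathsf{L}>0$ with $|f(y;\xi)-f(x;\xi)-\langle\nabla f(x;\xi),y-x\rangle|\le\mathsf{L}D_h(y,x)$ for all $x,y\in\mathcal{X}$ and $\xi\in\Xi$. Sample loss assumption. $(\Xi,\mathcal{A},\mathbb{P}_\Xi)$ is a probability space and $\{\xi^k\}_{k\in\mathbb{N}}$ are i.i.d. with law $\mathbb{P}_\Xi$. For each $\xi\in\Xi$, $f(\cdot;\xi):\mathcal{X}\to\mathbb{R}$ is $\mathcal{C}^2$, and $f(x)=\mathbb{E}[f(x;\xi)]$ for $x\in\mathcal{X}$ ($f$ is understood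 to be twice differentiable). Moreover: (local Hessian Lipschitzness) for every compact $\mathcal{Q}\subset\mathcal{X}$ there is $L_{\mathcal{Q}}<\infty$ with $\|\nabla^2f(x;\xi)-\nabla^2f(y;\xi)\|\le L_{\mathcal{Q}}\|x-y\|$ for all $x,y\in\mathcal{Q}$, $\xi\in\Xi$; (unbiased derivatives) for every fixed $\bar x\in\mathcal{X}$ and $k$, $\mathbb{E}[\nabla f(\bar x;\xi^k)]=\nabla f(\bar x)$ and $\mathbb{E}[\nabla^2f(\bar x;\xi^k)]=\nabla^2f(\bar x)$; (finite moments) there is $q>2$ such that for every fixed $\bar x\in\mathcal{X}$ and $k$, $\mathbb{E}[\|\nabla f(\bar x;\xi^k)-\nabla f(\bar x)\|^2]<\infty$ and $\mathbb{E}[\|\nabla^2f(\bar x;\xi^k)-\nabla^2f(\bar x)\|^q]<\infty$. *)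

theory Defs
  imports "HOL-Probability.Probability"
begin

definition gradient :: "(real ^ 'n \<Rightarrow> real) \<Rightarrow> real ^ 'n \<Rightarrow> real ^ 'n" where
  "gradient g x = (THE D. GDERIV g x :> D)"

definition hessian :: "(real ^ 'n \<Rightarrow> real) \<Rightarrow> real ^ 'n \<Rightarrow> real ^ 'n ^ 'n" where
  "hessian g x = jacobian (gradient g) (at x)"

definition twice_differentiable_on :: "(real ^ 'n \<Rightarrow> real) \<Rightarrow> (real ^ 'n) set \<Rightarrow> bool" where
  "twice_differentiable_on g S \<longleftrightarrow>
     (\<forall>x\<in>S. g differentiable at x \<and> gradient g differentiable at x)"

text \<open>Derivatives are taken at \<open>x\<close> in the whole space, so this is only meant for open \<open>S\<close>.\<close>

definition C2_on :: "(real ^ 'n \<Rightarrow> real) \<Rightarrow> (real ^ 'n) set \<Rightarrow> bool" where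
  "C2_on g S \<longleftrightarrow> twice_differentiable_on g S \<and> continuous_on S (hessian g)"

text \<open>The norm of the type \<open>real ^ 'n ^ 'n\<close> is the Frobenius norm; matrices are measured here
  in the spectral norm.\<close>

definition opnorm :: "real ^ 'n ^ 'n \<Rightarrow> real" where
  "opnorm A = onorm (\<lambda>v. A *v v)"

definition pos_def :: "real ^ 'n ^ 'n \<Rightarrow> bool" where
  "pos_def A \<longleftrightarrow> transpose A = A \<and> (\<forall>v. v \<noteq> 0 \<longrightarrow> 0 < v \<bullet> (A *v v))"

text \<open>Only used for symmetric matrices, whose set of real eigenvalues is finite and nonempty.\<close>

definition lambda_min :: "real ^ 'n ^ 'n \<Rightarrow> real" where
  "lambda_min A = Min {c. \<exists>v. v \<noteq> 0 \<and> A *v v = c *\<^sub>R v}"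

definition effective_domain :: "(real ^ 'n \<Rightarrow> ereal) \<Rightarrow> (real ^ 'n) set" where
  "effective_domain h = {x. h x < \<infinity>}"

definition ereal_epigraph :: "(real ^ 'n \<Rightarrow> ereal) \<Rightarrow> ((real ^ 'n) \<times> real) set" where
  "ereal_epigraph h = {(x, t). h x \<le> ereal t}"

definition convex_conjugate :: "(real ^ 'n \<Rightarrow> ereal) \<Rightarrow> real ^ 'n \<Rightarrow> ereal" where
  "convex_conjugate h z = (SUP x. ereal (z \<bullet> x) - h x)"

definition mirror_domain :: "(real ^ 'n \<Rightarrow> ereal) \<Rightarrow> (real ^ 'n) set" where
  "mirror_domain h = interior (effective_domain h)"

text \<open>The truncation \<open>real_of_ereal\<close> is harmless: on the interior of its domain \<open>h\<close> is finite.\<close>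

abbreviation kernel_grad :: "(real ^ 'n \<Rightarrow> ereal) \<Rightarrow> real ^ 'n \<Rightarrow> real ^ 'n" where
  "kernel_grad h \<equiv> gradient (\<lambda>y. real_of_ereal (h y))"

text \<open>For \<open>x\<close> in the mirror domain; the value is \<open>\<infinity>\<close> exactly when \<open>y\<close> is outside the effective
  domain of \<open>h\<close>.\<close>

definition bregman :: "(real ^ 'n \<Rightarrow> ereal) \<Rightarrow> real ^ 'n \<Rightarrow> real ^ 'n \<Rightarrow> ereal" where
  "bregman h y x = h y - h x - ereal (kernel_grad h x \<bullet> (y - x))"

definition essentially_smooth :: "(real ^ 'n \<Rightarrow> ereal) \<Rightarrow> bool" where
  "essentially_smooth h \<longleftrightarrow>
     (\<forall>u b. (\<forall>j::nat. u j \<in> mirror_domain h) \<and> u \<longlonglongrightarrow> b \<and> b \<in> frontier (effective_domain h)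
        \<longrightarrow> filterlim (\<lambda>j. norm (kernel_grad h (u j))) at_top sequentially)"

definition mirror_kernel :: "(real ^ 'n \<Rightarrow> ereal) \<Rightarrow> bool" where
  "mirror_kernel h \<longleftrightarrow>
     (\<forall>x. h x \<noteq> -\<infinity>) \<and> effective_domain h \<noteq> {} \<and>
     closed (ereal_epigraph h) \<and> convex (ereal_epigraph h) \<and>
     essentially_smooth h \<and>
     effective_domain (convex_conjugate h) = UNIV \<and>
     C2_on (\<lambda>y. real_of_ereal (h y)) (mirror_domain h) \<and>
     (\<forall>x\<in>mirror_domain h. pos_def (hessian (\<lambda>y. real_of_ereal (h y)) x))"

text \<open>The probability space \<open>S\<close> plays the role of \<open>(\<Xi>, \<A>, P\<^sub>\<Xi>)\<close>, and \<open>f x s\<close> is the loss at \<open>x\<close>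
  for the sample \<open>s\<close>.\<close>

abbreviation loss_grad :: "(real ^ 'n \<Rightarrow> 's \<Rightarrow> real) \<Rightarrow> real ^ 'n \<Rightarrow> 's \<Rightarrow> real ^ 'n" where
  "loss_grad f x s \<equiv> gradient (\<lambda>y. f y s) x"

abbreviation loss_hess :: "(real ^ 'n \<Rightarrow> 's \<Rightarrow> real) \<Rightarrow> real ^ 'n \<Rightarrow> 's \<Rightarrow> real ^ 'n ^ 'n" where
  "loss_hess f x s \<equiv> hessian (\<lambda>y. f y s) x"

definition relatively_smooth ::
  "'s measure \<Rightarrow> (real ^ 'n \<Rightarrow> ereal) \<Rightarrow> (real ^ 'n \<Rightarrow> 's \<Rightarrow> real) \<Rightarrow> real \<Rightarrow> bool" where
  "relatively_smooth S h f L \<longleftrightarrow>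
     (\<forall>x\<in>mirror_domain h. \<forall>y\<in>mirror_domain h. \<forall>s\<in>space S.
        ereal \<bar>f y s - f x s - loss_grad f x s \<bullet> (y - x)\<bar> \<le> ereal L * bregman h y x)"

definition iid_samples :: "'w measure \<Rightarrow> 's measure \<Rightarrow> (nat \<Rightarrow> 'w \<Rightarrow> 's) \<Rightarrow> bool" where
  "iid_samples M S \<xi> \<longleftrightarrow>
     prob_space.indep_vars M (\<lambda>_. S) \<xi> UNIV \<and>
     (\<forall>k. \<xi> k \<in> measurable M S \<and> distr M S (\<xi> k) = S)"

definition expected_loss :: "'s measure \<Rightarrow> (real ^ 'n \<Rightarrow> 's \<Rightarrow> real) \<Rightarrow> real ^ 'n \<Rightarrow> real" where
  "expected_loss S f x = (\<integral>s. f x s \<partial>S)"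

definition sample_loss ::
  "'w measure \<Rightarrow> 's measure \<Rightarrow> (nat \<Rightarrow> 'w \<Rightarrow> 's) \<Rightarrow> (real ^ 'n) set \<Rightarrow>
   (real ^ 'n \<Rightarrow> 's \<Rightarrow> real) \<Rightarrow> real \<Rightarrow> bool" where
  "sample_loss M S \<xi> X f q \<longleftrightarrow>
     prob_space S \<and> iid_samples M S \<xi> \<and>
     (\<forall>s\<in>space S. C2_on (\<lambda>x. f x s) X) \<and>
     (\<forall>x\<in>X. integrable S (f x)) \<and>
     twice_differentiable_on (expected_loss S f) X \<and>
     (\<lambda>(x, s). loss_grad f x s) \<in> borel_measurable (restrict_space borel X \<Otimes>\<^sub>M S) \<and>
     (\<lambda>(x, s). loss_hess f x s) \<in> borel_measurable (restrict_space borel X \<Otimes>\<^sub>M S) \<and>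
     (\<forall>Q. compact Q \<and> Q \<subseteq> X \<longrightarrow>
        (\<exists>LQ. \<forall>x\<in>Q. \<forall>y\<in>Q. \<forall>s\<in>space S.
           opnorm (loss_hess f x s - loss_hess f y s) \<le> LQ * norm (x - y))) \<and>
     (\<forall>x\<in>X. \<forall>k.
        has_bochner_integral M (\<lambda>\<omega>. loss_grad f x (\<xi> k \<omega>)) (gradient (expected_loss S f) x) \<and>
        has_bochner_integral M (\<lambda>\<omega>. loss_hess f x (\<xi> k \<omega>)) (hessian (expected_loss S f) x)) \<and>
     (\<forall>x\<in>X. \<forall>k.
        integrable M
          (\<lambda>\<omega>. (norm (loss_grad f x (\<xi> k \<omega>) - gradient (expected_loss S f) x))\<^sup>2) \<and>
        integrable M
          (\<lambda>\<omega>. opnorm (loss_hess f x (\<xi> k \<omega>) - hessian (expected_loss S f) x) powr q))"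

text \<open>\<open>x'\<close> is the mirror descent update from \<open>x\<close> with step-size \<open>a\<close> and gradient estimate \<open>g\<close>;
  being a minimiser suffices, as the minimiser is unique under the assumptions on \<open>h\<close>.\<close>

definition smd_step ::
  "(real ^ 'n \<Rightarrow> ereal) \<Rightarrow> real \<Rightarrow> real ^ 'n \<Rightarrow> real ^ 'n \<Rightarrow> real ^ 'n \<Rightarrow> bool" where
  "smd_step h a g x x' \<longleftrightarrow>
     is_arg_min (\<lambda>y. ereal (g \<bullet> (y - x)) + ereal (inverse a) * bregman h y x)
       (\<lambda>y. y \<in> closure (mirror_domain h)) x'"

text \<open>\<open>indep_var\<close> requires both variables to have the same target type, so independence of the initial
  point and the whole sample sequence is stated through the events they generate.\<close>

definition init_indep ::
  "'w measure \<Rightarrow> 's measure \<Rightarrow> (nat \<Rightarrow> 'w \<Rightarrow> 's) \<Rightarrow> ('w \<Rightarrow> real ^ 'n) \<Rightarrow> bool" where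
  "init_indep M S \<xi> x0 \<longleftrightarrow>
     prob_space.indep_set M
       {x0 -` A \<inter> space M | A. A \<in> sets borel}
       {(\<lambda>\<omega> k. \<xi> k \<omega>) -` B \<inter> space M | B. B \<in> sets (Pi\<^sub>M (UNIV :: nat set) (\<lambda>_. S))}"

definition strict_saddles :: "(real ^ 'n) set \<Rightarrow> (real ^ 'n \<Rightarrow> real) \<Rightarrow> (real ^ 'n) set" where
  "strict_saddles X F = {x \<in> X. gradient F x = 0 \<and> lambda_min (hessian F x) < 0}"

end

theory Submission
  imports Defs
begin

text \<open>In the dual variable \<open>z = \<nabla>h(x)\<close>, mirror descent reads
  \<open>z' = z - \<alpha> \<nabla>f(x; \<xi>)\<close>. Since \<open>\<alpha> L < 1\<close>, relative smoothness makes every step injective with a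
  pointwise Lipschitz inverse, so preimages of Lebesgue null sets are null, and it bounds
  \<open>\<nabla>\<^sup>2f(\<cdot>; \<xi>)\<close> uniformly in \<open>\<xi>\<close>. Fix a saddle \<open>c\<close> and a sample sequence for which the noise series
  \<open>\<Sum> \<alpha>\<^sub>k (\<nabla>\<^sup>2f(c; \<xi>\<^sub>k) - \<nabla>\<^sup>2f(c))\<close> converges. The difference of two orbits that stay near \<open>c\<close> obeys,
  after a change of variables by the tails of this series, a small perturbation of
  \<open>w' = w - \<alpha> \<nabla>\<^sup>2f(c) \<nabla>\<^sup>2h(c)\<^sup>-\<^sup>1 w\<close>. A quadratic form expands along this recursion inside an open cone, so,
  as \<open>\<Sum> \<alpha>\<^sub>k = \<infinity>\<close>, a bounded difference lies outside that cone. A set without differences in an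
  open cone is null. Countably many saddles suffice by Lindelof, and Fubini concludes, because
  the initial point is independent of the samples.\<close>

section \<open>Derivatives and matrices\<close>

text \<open>The Hessian noise does not become small; only its series weighted by the step sizes is
  known to converge. It cannot be treated as a small perturbation and has to be summed by parts,
  which is what the tails of the series achieve. The remaining linear part \<open>F ** P\<close> is
  a product of a symmetric and a positive definite matrix: in general it is not symmetric, and it
  may have a kernel. Rather than building a stable manifold for it, a symmetric form is adapted to
  it after a small shift of \<open>F\<close> that removes the kernel and keeps one direction of
  negative curvature. Two uniformities in the sample shape the rest. The radius around each saddle
  is fixed before the sample sequence, so that one countable family of balls serves almost all
  sequences. The Hessian noise is bounded, so that Hoeffding's inequality applies; its bounds,
  exponential in \<open>1 / r\<close> for the tail \<open>r\<close> of the squared step sizes, are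
  traded for the power \<open>r powr (q / 2)\<close> that the step-size condition sums.\<close>

lemma twice_differentiable_onD:
  fixes g :: "real ^ 'n \<Rightarrow> real"
  assumes "twice_differentiable_on g U" "x \<in> U"
  shows gderiv_gradient: "GDERIV g x :> gradient g x"
    and gradient_has_derivative: "(gradient g has_derivative (*v) (hessian g x)) (at x)"
proof -
  have "g differentiable at x" "gradient g differentiable at x"
    using assms unfolding twice_differentiable_on_def by auto
  then obtain g' where g': "(g has_derivative g') (at x)"
    unfolding differentiable_def by blast
  then have lin: "linear g'"
    using has_derivative_linear by blast
  define D where "D = (\<Sum>b\<in>Basis. g' b *\<^sub>R b)"
  have "g' v = v \<bullet> D" for v
  proof -
    have "g' v = g' (\<Sum>b\<in>Basis. (v \<bullet> b) *\<^sub>R b)"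
      by (simp add: euclidean_representation)
    also have "\<dots> = (\<Sum>b\<in>Basis. (v \<bullet> b) * g' b)"
      by (simp add: linear_sum[OF lin] linear_cmul[OF lin])
    also have "\<dots> = v \<bullet> D"
      by (simp add: D_def inner_sum_right mult.commute)
    finally show ?thesis .
  qed
  then have "GDERIV g x :> D"
    using g' unfolding gderiv_def by presburger
  moreover have "E = D" if "GDERIV g x :> E" for E
  proof -
    have "(\<lambda>h. h \<bullet> E) = (\<lambda>h. h \<bullet> D)"
      using that \<open>GDERIV g x :> D\<close> unfolding gderiv_def by (rule has_derivative_unique)
    then have "(E - D) \<bullet> E = (E - D) \<bullet> D" by metis
    then have "(E - D) \<bullet> (E - D) = 0" by (simp add: inner_diff_right)
    then show ?thesis by simp
  qed
  ultimately show "GDERIV g x :> gradient g x"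
    unfolding gradient_def by (metis (no_types, lifting) theI)
  show "(gradient g has_derivative (*v) (hessian g x)) (at x)"
    using \<open>gradient g differentiable at x\<close> unfolding hessian_def by (simp only: jacobian_works)
qed

lemma GDERIV_along_line:
  fixes g :: "'a :: real_inner \<Rightarrow> real"
  assumes "GDERIV g (x + t *\<^sub>R v) :> D"
  shows "((\<lambda>t. g (x + t *\<^sub>R v)) has_real_derivative D \<bullet> v) (at t within T)"
proof -
  have "((\<lambda>t. g (x + t *\<^sub>R v)) has_derivative (\<lambda>s. (s *\<^sub>R v) \<bullet> D)) (at t within T)"
  proof (rule has_derivative_compose[where f = "\<lambda>t. x + t *\<^sub>R v"])
    show "((\<lambda>t. x + t *\<^sub>R v) has_derivative (\<lambda>s. s *\<^sub>R v)) (at t within T)"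
      by (auto intro!: derivative_eq_intros)
  qed (use assms gderiv_def in blast)
  moreover have "(\<lambda>s. (s *\<^sub>R v) \<bullet> D) = (*) (D \<bullet> v)"
    by (auto simp: inner_commute)
  ultimately show ?thesis
    by (simp add: has_field_derivative_def)
qed

lemma norm_matrix_vector_le: "norm (A *v x) \<le> norm A * norm x"
  for A :: "real ^ 'n ^ 'm"
proof -
  have "norm (A *v x) = L2_set (\<lambda>i. \<bar>A $ i \<bullet> x\<bar>) UNIV"
    by (simp add: norm_vec_def matrix_vector_mult_def inner_vec_def)
  also have "\<dots> \<le> L2_set (\<lambda>i. norm (A $ i) * norm x) UNIV"
    by (intro L2_set_mono) (auto simp: Cauchy_Schwarz_ineq2)
  also have "\<dots> = norm A * norm x"
    by (simp add: norm_vec_def L2_set_left_distrib)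
  finally show ?thesis .
qed

lemma norm_matrix_vector_le_opnorm: "norm (A *v x) \<le> opnorm A * norm x"
  unfolding opnorm_def using onorm[OF matrix_vector_mul_bounded_linear] by blast

text \<open>Schwarz' theorem, from the second difference of \<open>g\<close> along \<open>t u\<close> and \<open>t v\<close>.\<close>

lemma hessian_symmetric:
  fixes g :: "real ^ 'n \<Rightarrow> real"
  assumes g: "twice_differentiable_on g U" and U: "open U" "x \<in> U"
  shows "u \<bullet> (hessian g x *v v) = v \<bullet> (hessian g x *v u)"
proof -
  define \<phi> where "\<phi> t = g (x + t *\<^sub>R u + t *\<^sub>R v) - g (x + t *\<^sub>R u) - g (x + t *\<^sub>R v) + g x" for t
  have key: "\<exists>d>0. \<forall>t. 0 < t \<and> t < d \<longrightarrow>
      \<bar>g (x + t *\<^sub>R u + t *\<^sub>R v) - g (x + t *\<^sub>R u) - g (x + t *\<^sub>R v) + g x - t\<^sup>2 * (u \<bullet> (hessian g x *v v))\<bar> \<le> e * t\<^sup>2"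
    if "e > 0" for e and u v :: "real ^ 'n"
  proof -
    define H where "H = hessian g x"
    define c where "c = norm u + norm v + 1"
    have c: "c > 0" unfolding c_def by (smt (verit) norm_ge_zero)
    \<comment> \<open>Two expansion errors \<open>e' * (t * c)\<close>, a factor \<open>c\<close>
      from the pairing with \<open>u\<close> and a factor \<open>t\<close> from the mean value
      theorem multiply up to \<open>e * t\<^sup>2\<close>.\<close>
    define e' where "e' = e / (2 * c * c)"
    have e': "e' > 0" using c \<open>e > 0\<close> by (simp add: e'_def)
    obtain d1 where d1: "d1 > 0"
      "\<And>y. norm (y - x) < d1 \<Longrightarrow> norm (gradient g y - gradient g x - H *v (y - x)) \<le> e' * norm (y - x)"
      using gradient_has_derivative[OF g U(2)] e' unfolding has_derivative_at_alt H_def by metis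
    obtain d2 where d2: "d2 > 0" "ball x d2 \<subseteq> U"
      using U open_contains_ball by blast
    define d where "d = min d1 d2 / c"
    have "d > 0" using d1 d2 c by (simp add: d_def)
    moreover have "\<bar>g (x + t *\<^sub>R u + t *\<^sub>R v) - g (x + t *\<^sub>R u) - g (x + t *\<^sub>R v) + g x - t\<^sup>2 * (u \<bullet> (H *v v))\<bar> \<le> e * t\<^sup>2"
      if t: "0 < t" "t < d" for t
    proof -
      have tc: "t * c < d1" "t * c < d2" using t c by (auto simp: d_def field_simps)
      have small: "norm (s *\<^sub>R u + r *\<^sub>R v) \<le> t * c" if "0 \<le> s" "s \<le> t" "0 \<le> r" "r \<le> t" for s r
      proof -
        have "norm (s *\<^sub>R u + r *\<^sub>R v) \<le> s * norm u + r * norm v"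
          using that norm_triangle_ineq[of "s *\<^sub>R u" "r *\<^sub>R v"] by simp
        also have "\<dots> \<le> t * norm u + t * norm v"
          using that by (intro add_mono mult_right_mono) auto
        also have "\<dots> \<le> t * c" using t by (simp add: c_def algebra_simps)
        finally show ?thesis .
      qed
      have inU: "x + s *\<^sub>R u + r *\<^sub>R v \<in> U" if "0 \<le> s" "s \<le> t" "0 \<le> r" "r \<le> t" for s r
        using small[OF that] tc d2(2) by (auto simp: dist_norm subset_eq norm_minus_commute algebra_simps)
      have gd: "GDERIV g (x + s *\<^sub>R u + r *\<^sub>R v) :> gradient g (x + s *\<^sub>R u + r *\<^sub>R v)"
        if "0 \<le> s" "s \<le> t" "0 \<le> r" "r \<le> t" for s r
        using gderiv_gradient[OF g inU[OF that]] .
      have ap: "norm (gradient g (x + s *\<^sub>R u + r *\<^sub>R v) - gradient g x - H *v (s *\<^sub>R u + r *\<^sub>R v)) \<le> e' * (t * c)"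
        if "0 \<le> s" "s \<le> t" "0 \<le> r" "r \<le> t" for s r
      proof -
        have "norm (gradient g (x + s *\<^sub>R u + r *\<^sub>R v) - gradient g x - H *v (s *\<^sub>R u + r *\<^sub>R v)) \<le>
           e' * norm (s *\<^sub>R u + r *\<^sub>R v)"
          using d1(2)[of "x + s *\<^sub>R u + r *\<^sub>R v"] small[OF that] tc by (simp add: add.assoc)
        also have "\<dots> \<le> e' * (t * c)"
          using small[OF that] e' by simp
        finally show ?thesis .
      qed
      \<comment> \<open>The second difference is the increment of \<open>\<psi>\<close> on
        \<open>[0, t]\<close>. The mean value theorem reduces it to gradients, whose change is then
        read off from the derivative of the gradient at \<open>x\<close>.\<close>
      define \<psi> where "\<psi> s = g (x + t *\<^sub>R v + s *\<^sub>R u) - g (x + s *\<^sub>R u)" for s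
      have "(\<psi> has_real_derivative
          gradient g (x + s *\<^sub>R u + t *\<^sub>R v) \<bullet> u - gradient g (x + s *\<^sub>R u + 0 *\<^sub>R v) \<bullet> u) (at s)"
        if "0 \<le> s" "s \<le> t" for s
        unfolding \<psi>_def using gd[of s t] gd[of s 0] t that
        by (intro DERIV_diff GDERIV_along_line) (simp_all add: algebra_simps)
      from MVT2[OF t(1), of \<psi>, OF this] obtain s where s: "0 < s" "s < t"
        and eq: "\<psi> t - \<psi> 0 = (t - 0) *
           (gradient g (x + s *\<^sub>R u + t *\<^sub>R v) \<bullet> u - gradient g (x + s *\<^sub>R u + 0 *\<^sub>R v) \<bullet> u)" by blast
      define R where "R = gradient g (x + s *\<^sub>R u + t *\<^sub>R v) - gradient g (x + s *\<^sub>R u + 0 *\<^sub>R v) - H *v (t *\<^sub>R v)"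
      have "R = (gradient g (x + s *\<^sub>R u + t *\<^sub>R v) - gradient g x - H *v (s *\<^sub>R u + t *\<^sub>R v))
         - (gradient g (x + s *\<^sub>R u + 0 *\<^sub>R v) - gradient g x - H *v (s *\<^sub>R u + 0 *\<^sub>R v))"
        by (simp add: R_def matrix_vector_right_distrib)
      then have "norm R \<le> e' * (t * c) + e' * (t * c)"
        using ap[of s t] ap[of s 0] s t by (metis add_mono less_imp_le norm_triangle_le_diff order_refl)
      moreover have "g (x + t *\<^sub>R u + t *\<^sub>R v) - g (x + t *\<^sub>R u) - g (x + t *\<^sub>R v) + g x - t\<^sup>2 * (u \<bullet> (H *v v)) = t * (R \<bullet> u)"
        using eq by (simp add: R_def \<psi>_def inner_diff_left algebra_simps power2_eq_square
            matrix_vector_mult_scaleR inner_commute)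
      moreover have "\<bar>R \<bullet> u\<bar> \<le> norm R * c"
        using Cauchy_Schwarz_ineq2[of R u] by (smt (verit) c_def mult_left_mono norm_ge_zero)
      ultimately have "\<bar>g (x + t *\<^sub>R u + t *\<^sub>R v) - g (x + t *\<^sub>R u) - g (x + t *\<^sub>R v) + g x - t\<^sup>2 * (u \<bullet> (H *v v))\<bar>
         = t * \<bar>R \<bullet> u\<bar>" "\<bar>R \<bullet> u\<bar> \<le> (e' * (t * c) + e' * (t * c)) * c"
        using t c by (auto simp: abs_mult intro: order_trans[OF _ mult_right_mono])
      then have "\<bar>g (x + t *\<^sub>R u + t *\<^sub>R v) - g (x + t *\<^sub>R u) - g (x + t *\<^sub>R v) + g x - t\<^sup>2 * (u \<bullet> (H *v v))\<bar>
         \<le> t * ((e' * (t * c) + e' * (t * c)) * c)"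
        using t by (metis mult_left_mono less_imp_le)
      also have "\<dots> = e * t\<^sup>2" using c by (simp add: e'_def power2_eq_square field_simps)
      finally show ?thesis .
    qed
    ultimately show ?thesis unfolding H_def by blast
  qed
  have "\<bar>u \<bullet> (hessian g x *v v) - v \<bullet> (hessian g x *v u)\<bar> \<le> 0 + e" if "e > 0" for e
  proof -
    have e2: "e / 2 > 0" using that by simp
    obtain d1 where d1: "d1 > 0" "\<And>t. 0 < t \<and> t < d1 \<Longrightarrow>
      \<bar>g (x + t *\<^sub>R u + t *\<^sub>R v) - g (x + t *\<^sub>R u) - g (x + t *\<^sub>R v) + g x - t\<^sup>2 * (u \<bullet> (hessian g x *v v))\<bar> \<le> e/2 * t\<^sup>2"
      using key[OF e2, of u v] by blast
    obtain d2 where d2: "d2 > 0" "\<And>t. 0 < t \<and> t < d2 \<Longrightarrow>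
      \<bar>g (x + t *\<^sub>R v + t *\<^sub>R u) - g (x + t *\<^sub>R v) - g (x + t *\<^sub>R u) + g x - t\<^sup>2 * (v \<bullet> (hessian g x *v u))\<bar> \<le> e/2 * t\<^sup>2"
      using key[OF e2, of v u] by blast
    define t where "t = min d1 d2 / 2"
    have t: "0 < t" "t < d1" "t < d2" using d1 d2 by (auto simp: t_def)
    have "\<bar>t\<^sup>2 * (u \<bullet> (hessian g x *v v)) - t\<^sup>2 * (v \<bullet> (hessian g x *v u))\<bar> \<le> e * t\<^sup>2"
    proof -
      \<comment> \<open>The second difference is symmetric in \<open>u\<close> and \<open>v\<close>,
        so both bilinear expressions approximate the same number.\<close>
      have swap: "x + t *\<^sub>R v + t *\<^sub>R u = x + t *\<^sub>R u + t *\<^sub>R v" by simp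
      have arith: "\<bar>P - Q\<bar> \<le> 2 * k"
        if "\<bar>a - b - c + d - P\<bar> \<le> k" "\<bar>a - c - b + d - Q\<bar> \<le> k" for a b c d k P Q :: real
        using that by linarith
      show ?thesis
        using arith[OF d1(2)[of t] d2(2)[of t, unfolded swap]] t by simp
    qed
    then have "\<bar>u \<bullet> (hessian g x *v v) - v \<bullet> (hessian g x *v u)\<bar> * t\<^sup>2 \<le> e * t\<^sup>2"
      by (simp add: abs_mult mult.commute flip: right_diff_distrib)
    then show ?thesis using t by simp
  qed
  then have "\<bar>u \<bullet> (hessian g x *v v) - v \<bullet> (hessian g x *v u)\<bar> \<le> 0"
    by (rule field_le_epsilon)
  then show ?thesis by simp
qed

section \<open>Symmetric forms and unstable cones\<close>

lemma pos_def_symmetric: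
  assumes "pos_def H"
  shows "u \<bullet> (H *v v) = v \<bullet> (H *v u)"
  using assms unfolding pos_def_def by (metis dot_lmul_matrix inner_commute transpose_matrix_vector)

text \<open>Eigenvectors to distinct generalized eigenvalues are \<open>H\<close>-orthogonal, hence
  independent. With \<open>H\<close> the identity this makes the minimum in
  \<open>lambda_min\<close> meaningful; with \<open>H\<close> the kernel Hessian it leaves room for
  a shift that makes \<open>F + \<delta> H\<close> invertible.\<close>

lemma finite_generalized_eigenvalues:
  fixes F H :: "real ^ 'n ^ 'n"
  assumes F: "\<And>u v. u \<bullet> (F *v v) = v \<bullet> (F *v u)" and H: "pos_def H"
  shows "finite {c. \<exists>v. v \<noteq> 0 \<and> F *v v = c *\<^sub>R (H *v v)}" (is "finite ?D")
proof -
  have Hsym: "u \<bullet> (H *v v) = v \<bullet> (H *v u)" for u v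
    using H by (rule pos_def_symmetric)
  have Hpos: "v \<bullet> (H *v v) > 0" if "v \<noteq> 0" for v
    using H that unfolding pos_def_def by blast
  obtain p where p: "\<And>c. c \<in> ?D \<Longrightarrow> p c \<noteq> 0 \<and> F *v p c = c *\<^sub>R (H *v p c)"
    using that[of "\<lambda>c. SOME v. v \<noteq> 0 \<and> F *v v = c *\<^sub>R (H *v v)"] by (smt (verit) mem_Collect_eq someI_ex)
  have orth: "p c \<bullet> (H *v p d) = 0" if "c \<in> ?D" "d \<in> ?D" "c \<noteq> d" for c d
  proof -
    have "d * (p c \<bullet> (H *v p d)) = p c \<bullet> (F *v p d)" using p[OF that(2)] by simp
    also have "\<dots> = p d \<bullet> (F *v p c)" by (rule F)
    also have "\<dots> = c * (p c \<bullet> (H *v p d))" using p[OF that(1)] Hsym by simp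
    finally show ?thesis using that(3) by simp
  qed
  have inj: "inj_on p ?D"
  proof (rule inj_onI, rule ccontr)
    fix c d assume *: "c \<in> ?D" "d \<in> ?D" "p c = p d" "c \<noteq> d"
    then show False using orth[OF *(1,2,4)] Hpos[of "p d"] p[OF *(2)] by simp
  qed
  have "independent (p ` ?D)"
    unfolding independent_explicit_finite_subsets
  proof (intro allI impI ballI)
    fix A u v assume A: "A \<subseteq> p ` ?D" "finite A" and s: "(\<Sum>v\<in>A. u v *\<^sub>R v) = 0" and v: "v \<in> A"
    have *: "w \<bullet> (H *v v) = 0" if "w \<in> A - {v}" for w
      using that v A orth by blast
    have "0 = (\<Sum>w\<in>A. u w *\<^sub>R w) \<bullet> (H *v v)" using s by simp
    also have "\<dots> = (\<Sum>w\<in>A. u w * (w \<bullet> (H *v v)))" by (simp add: inner_sum_left)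
    also have "\<dots> = u v * (v \<bullet> (H *v v))"
      using v A(2) * by (subst sum.remove[of A v]) auto
    finally have "u v * (v \<bullet> (H *v v)) = 0" by simp
    moreover obtain c where "c \<in> ?D" "v = p c" using v A(1) by blast
    then have "v \<noteq> 0" using p by simp
    ultimately show "u v = 0" using Hpos[of v] by simp
  qed
  then have "finite (p ` ?D)" by (rule independent_imp_finite)
  then show ?thesis using inj by (rule finite_imageD)
qed

text \<open>The minimum of the quadratic form over the unit sphere is attained at an eigenvector, so
  a direction of negative curvature forces a negative eigenvalue.\<close>

lemma lambda_min_neg_iff:
  fixes A :: "real ^ 'n ^ 'n"
  assumes A: "\<And>u v. u \<bullet> (A *v v) = v \<bullet> (A *v u)"
  shows "lambda_min A < 0 \<longleftrightarrow> (\<exists>v. v \<bullet> (A *v v) < 0)"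
proof -
  let ?E = "{c. \<exists>v. v \<noteq> 0 \<and> A *v v = c *\<^sub>R v}"
  have "pos_def (mat 1 :: real ^ 'n ^ 'n)"
    unfolding pos_def_def by simp
  from finite_generalized_eigenvalues[OF A this] have fin: "finite ?E" by simp
  have "continuous_on (sphere 0 1) (\<lambda>v. v \<bullet> (A *v v))"
    by (intro continuous_intros)
  moreover have "sphere (0 :: real ^ 'n) 1 \<noteq> {}" by simp
  ultimately obtain v0 :: "real ^ 'n" where v0: "v0 \<in> sphere 0 1"
    "\<And>v. v \<in> sphere 0 1 \<Longrightarrow> v0 \<bullet> (A *v v0) \<le> v \<bullet> (A *v v)"
    using continuous_attains_inf[OF compact_sphere, of "0 :: real ^ 'n" 1 "\<lambda>v. v \<bullet> (A *v v)"] by blast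
  define c0 where "c0 = v0 \<bullet> (A *v v0)"
  define B where "B v = A *v v - c0 *\<^sub>R v" for v
  have n0: "norm v0 = 1" using v0 by simp
  have Ray: "c0 * (v \<bullet> v) \<le> v \<bullet> (A *v v)" for v
  proof (cases "v = 0")
    case False
    have "c0 \<le> (v /\<^sub>R norm v) \<bullet> (A *v (v /\<^sub>R norm v))"
      unfolding c0_def by (rule v0) (use False in auto)
    also have "\<dots> = v \<bullet> (A *v v) / (norm v)\<^sup>2"
      by (simp add: matrix_vector_mult_scaleR power2_eq_square field_simps)
    finally show ?thesis using False by (simp add: field_simps power2_norm_eq_inner)
  qed simp
  have Bsym: "u \<bullet> B v = v \<bullet> B u" for u v
    by (simp add: B_def inner_diff_right A[of u v] inner_commute)
  have Bpos: "0 \<le> v \<bullet> B v" for v using Ray[of v] by (simp add: B_def inner_diff_right)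
  have Bz: "v0 \<bullet> B v0 = 0"
    using n0 by (simp add: B_def inner_diff_right c0_def flip: power2_norm_eq_inner)
  have "norm (B v0) = 0"
  proof -
    \<comment> \<open>\<open>B\<close> is nonnegative and vanishes at \<open>v0\<close>; moving from
      \<open>v0\<close> along \<open>- B v0\<close> would make it negative to first order unless
      \<open>B v0 = 0\<close>.\<close>
    define w where "w = B v0"
    have "0 \<le> t * (2 * (w \<bullet> w) + t * (w \<bullet> B w))" for t
    proof -
      have "v0 \<bullet> B w = w \<bullet> w"
        using Bsym[of v0 w] by (simp add: w_def)
      moreover have "B (v0 + t *\<^sub>R w) = B v0 + t *\<^sub>R B w"
        by (simp add: B_def matrix_vector_right_distrib matrix_vector_mult_scaleR algebra_simps)
      ultimately have "(v0 + t *\<^sub>R w) \<bullet> B (v0 + t *\<^sub>R w) = t * (2 * (w \<bullet> w) + t * (w \<bullet> B w))"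
        using Bz by (simp add: inner_add_left inner_add_right w_def[symmetric] algebra_simps)
      then show ?thesis using Bpos by metis
    qed
    then have *: "0 \<le> t * (2 * (w \<bullet> w) + t * (w \<bullet> B w))" for t .
    show ?thesis
    proof (rule ccontr)
      assume "\<not> ?thesis"
      then have ww: "w \<bullet> w > 0" by (simp add: w_def)
      \<comment> \<open>The summand 1 keeps \<open>k\<close> positive and above
        \<open>w \<bullet> B w\<close>, so that for \<open>t = - (w \<bullet> w) / k\<close> the
        quadratic term cannot outweigh the linear one.\<close>
      define k where "k = 1 + w \<bullet> B w"
      have k: "k \<ge> 1" "w \<bullet> B w < k" using Bpos[of w] by (auto simp: k_def)
      define t where "t = - (w \<bullet> w) / k"
      have "t < 0" using ww k by (simp add: t_def)
      then have "2 * (w \<bullet> w) + t * (w \<bullet> B w) \<le> 0"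
        using *[of t] by (simp add: zero_le_mult_iff)
      moreover have "- t * (w \<bullet> B w) \<le> w \<bullet> w"
        using k ww Bpos[of w] by (simp add: t_def field_simps)
      ultimately show False using ww by simp
    qed
  qed
  then have c0: "c0 \<in> ?E" using n0 by (auto simp: B_def intro!: exI[of _ v0])
  show ?thesis
  proof
    assume "lambda_min A < 0"
    moreover have "lambda_min A \<in> ?E"
      unfolding lambda_min_def using fin c0 by (intro Min_in) auto
    ultimately obtain v where "v \<noteq> 0" "A *v v = lambda_min A *\<^sub>R v" by blast
    then have "v \<bullet> (A *v v) < 0"
      using \<open>lambda_min A < 0\<close> by (simp add: mult_neg_pos)
    then show "\<exists>v. v \<bullet> (A *v v) < 0" by blast
  next
    assume "\<exists>v. v \<bullet> (A *v v) < 0"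
    then have "c0 < 0" using Ray by (metis inner_ge_zero mult_nonneg_nonneg not_le order_trans)
    then show "lambda_min A < 0"
      unfolding lambda_min_def using Min_le[OF fin c0] by simp
  qed
qed

text \<open>Translates of the set along \<open>v\<close> are pairwise disjoint: a common point of
  two of them would yield a difference \<open>t *\<^sub>R v\<close> with
  \<open>t \<noteq> 0\<close>, where \<open>q\<close> is positive. Infinitely many disjoint sets of
  equal measure fit into one ball only if that measure is zero.\<close>

lemma negligible_no_differences_in_cone:
  fixes Z :: "'a :: euclidean_space set"
  assumes Z: "bounded Z" and q: "continuous_on UNIV q"
    and le: "\<And>z z'. z \<in> Z \<Longrightarrow> z' \<in> Z \<Longrightarrow> q (z - z') \<le> (0::real)"
    and v: "\<And>t. t \<noteq> 0 \<Longrightarrow> q (t *\<^sub>R v) > 0"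
  shows "negligible Z"
proof -
  \<comment> \<open>Passing to the closure provides measurability; the inequality survives because
    \<open>q\<close> is continuous.\<close>
  define C where "C = closure Z"
  have C: "compact C" unfolding C_def using Z by simp
  have "q (z - z') \<le> 0" if zz: "z \<in> C" "z' \<in> C" for z z'
  proof -
    obtain a where a: "\<And>n. a n \<in> Z" "a \<longlonglongrightarrow> z"
      using zz(1) unfolding C_def closure_sequential by blast
    obtain b where b: "\<And>n. b n \<in> Z" "b \<longlonglongrightarrow> z'"
      using zz(2) unfolding C_def closure_sequential by blast
    have "(\<lambda>n. q (a n - b n)) \<longlonglongrightarrow> q (z - z')"
      by (rule continuous_on_tendsto_compose[OF q]) (auto intro: tendsto_diff a b)
    then show ?thesis using le[OF a(1) b(1)] by (intro LIMSEQ_le_const2) auto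
  qed
  then have disj: "((+) (s *\<^sub>R v) ` C) \<inter> ((+) (t *\<^sub>R v) ` C) = {}" if "s \<noteq> t" for s t
  proof -
    have False if "z \<in> C" "z' \<in> C" "s *\<^sub>R v + z = t *\<^sub>R v + z'" for z z'
    proof -
      have "z - z' = (t - s) *\<^sub>R v" using that by (simp add: algebra_simps)
      then show False
        using \<open>\<And>z z'. z \<in> C \<Longrightarrow> z' \<in> C \<Longrightarrow> q (z - z') \<le> 0\<close>[OF that(1,2)] v[of "t - s"] \<open>s \<noteq> t\<close> by auto
    qed
    then show ?thesis by auto
  qed
  obtain R where R: "C \<subseteq> cball 0 R"
    using compact_imp_bounded[OF C] by (auto simp: bounded_iff subset_eq)
  \<comment> \<open>The shifts \<open>1 / (n + 1)\<close> are distinct and at most 1, which keeps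
    all translates in one ball.\<close>
  define D where "D n = (+) ((1 / real (Suc n)) *\<^sub>R v) ` C" for n
  have lm: "C \<in> lmeasurable" "D n \<in> lmeasurable" for n
    unfolding D_def using C by (auto intro!: lmeasurable_compact compact_translation)
  have sub: "D n \<subseteq> cball 0 (R + norm v)" for n
  proof
    fix y assume "y \<in> D n"
    then obtain z where z: "z \<in> C" "y = (1 / real (Suc n)) *\<^sub>R v + z" by (auto simp: D_def)
    have "norm y \<le> norm v / real (Suc n) + norm z"
      unfolding z(2) using norm_triangle_ineq[of "(1 / real (Suc n)) *\<^sub>R v" z] by simp
    also have "norm v / real (Suc n) \<le> norm v" by (simp add: field_simps)
    finally show "y \<in> cball 0 (R + norm v)" using z R by auto
  qed
  have "real n * measure lebesgue C \<le> measure lebesgue (cball (0::'a) (R + norm v))" for n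
  proof -
    have "real n * measure lebesgue C = (\<Sum>i<n. measure lebesgue (D i))"
      by (simp add: D_def measure_translation)
    also have "\<dots> = measure lebesgue (\<Union>i<n. D i)"
    proof (rule measure_finite_Union[symmetric])
      show "D ` {..<n} \<subseteq> sets lebesgue" using fmeasurableD[OF lm(2)] by blast
      show "disjoint_family_on D {..<n}" unfolding disjoint_family_on_def D_def by (auto intro!: disj)
      show "emeasure lebesgue (D i) \<noteq> \<infinity>" if "i \<in> {..<n}" for i
        using fmeasurableD2[OF lm(2)] by simp
    qed simp
    also have "\<dots> \<le> measure lebesgue (cball (0::'a) (R + norm v))"
      using sub lm by (intro measure_mono_fmeasurable) auto
    finally show ?thesis .
  qed
  then have "measure lebesgue C \<le> 0"
    by (meson linorder_not_le reals_Archimedean3)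
  then have "negligible C"
    using lm(1) by (simp add: negligible_iff_measure measure_le_0_iff)
  then show ?thesis
    unfolding C_def using closure_subset negligible_subset by blast
qed

section \<open>A quadratic form that grows along the linearised dual recursion\<close>

lemma quadratic_form_lower_bound:
  fixes B :: "real ^ 'n \<Rightarrow> real"
  assumes cont: "continuous_on UNIV B" and hom: "\<And>t v. B (t *\<^sub>R v) = t\<^sup>2 * B v"
    and pos: "\<And>v. v \<noteq> 0 \<Longrightarrow> B v > 0"
  obtains m where "m > 0" "\<And>v. m * (norm v)\<^sup>2 \<le> B v"
proof -
  have "continuous_on (sphere 0 1) B"
    using cont continuous_on_subset by blast
  then obtain v0 where v0: "v0 \<in> sphere 0 1" "\<And>v. v \<in> sphere 0 1 \<Longrightarrow> B v0 \<le> B v"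
    using continuous_attains_inf[OF compact_sphere, of "0 :: real ^ 'n" 1 B] by auto
  show ?thesis
  proof
    show "B v0 > 0" using v0(1) by (intro pos) auto
    show "B v0 * (norm v)\<^sup>2 \<le> B v" for v
    proof (cases "v = 0")
      case True
      then show ?thesis using hom[of 0 v] by simp
    next
      case False
      then have "B v0 \<le> B (inverse (norm v) *\<^sub>R v)" by (intro v0) simp
      then show ?thesis using False by (simp add: hom field_simps)
    qed
  qed
qed

lemma pos_def_inverse:
  fixes H :: "real ^ 'n ^ 'n"
  assumes H: "pos_def H"
  obtains P where "\<And>v. P *v (H *v v) = v" "\<And>v. H *v (P *v v) = v"
    "\<And>u v. u \<bullet> (P *v v) = v \<bullet> (P *v u)" "\<And>v. v \<noteq> 0 \<Longrightarrow> 0 < v \<bullet> (P *v v)"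
proof -
  have "H *v v = 0 \<Longrightarrow> v = 0" for v
    using H unfolding pos_def_def by (metis inner_zero_right less_irrefl)
  then have "\<exists>P. P ** H = mat 1"
    unfolding matrix_left_invertible_ker by blast
  then obtain P where P: "P ** H = mat 1" by blast
  then have P': "H ** P = mat 1" by (simp add: matrix_left_right_inverse)
  have PH: "P *v (H *v v) = v" and HP: "H *v (P *v v) = v" for v
    using P P' by (simp_all add: matrix_vector_mul_assoc)
  show ?thesis
  proof
    show "u \<bullet> (P *v v) = v \<bullet> (P *v u)" for u v
      using pos_def_symmetric[OF H, of "P *v v" "P *v u"] by (simp add: HP inner_commute)
    show "0 < v \<bullet> (P *v v)" if "v \<noteq> 0" for v
    proof -
      have "P *v v \<noteq> 0" using HP[of v] that by auto
      then have "0 < (P *v v) \<bullet> (H *v (P *v v))" using H unfolding pos_def_def by blast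
      then show ?thesis by (simp add: HP inner_commute)
    qed
  qed (fact PH HP)+
qed

text \<open>The witness is \<open>C = P (F + \<delta> H) P\<close>, where \<open>P\<close> is the inverse of \<open>H\<close> and \<open>\<delta>\<close> is small and avoids the
  finitely many values at which \<open>F + \<delta> H\<close> is singular. The last inequality makes \<open>- u \<bullet> C u\<close> grow
  along \<open>u \<mapsto> u - a F P u\<close> wherever it is positive.\<close>

lemma unstable_quadratic_form:
  fixes F H P :: "real ^ 'n ^ 'n"
  assumes F: "\<And>u v. u \<bullet> (F *v v) = v \<bullet> (F *v u)" and H: "pos_def H"
    and PH: "\<And>v. P *v (H *v v) = v" and HP: "\<And>v. H *v (P *v v) = v"
    and Psym: "\<And>u v. u \<bullet> (P *v v) = v \<bullet> (P *v u)"
    and Ppos: "\<And>v. v \<noteq> 0 \<Longrightarrow> 0 < v \<bullet> (P *v v)"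
    and neg: "p0 \<bullet> (F *v p0) < 0"
  obtains C \<delta> m v0 where "\<And>u v. u \<bullet> (C *v v) = v \<bullet> (C *v u)" "\<delta> > 0" "m > 0"
    "v0 \<bullet> (C *v v0) < 0"
    "\<And>u. m * (norm u)\<^sup>2 \<le> (C *v u) \<bullet> ((F ** P) *v u) + \<delta> * (u \<bullet> (C *v u))"
proof -
  have Hsym: "u \<bullet> (H *v v) = v \<bullet> (H *v u)" for u v using H by (rule pos_def_symmetric)
  let ?D = "{c. \<exists>v. v \<noteq> 0 \<and> F *v v = c *\<^sub>R (H *v v)}"
  \<comment> \<open>Below \<open>\<delta>0\<close> the shift leaves \<open>p0\<close> a direction of
    negative curvature of \<open>F + \<delta> H\<close>; the summand 1 in the denominator makes the
    inequality strict.\<close>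
  define \<delta>0 where "\<delta>0 = - (p0 \<bullet> (F *v p0)) / (p0 \<bullet> (H *v p0) + 1)"
  have "p0 \<noteq> 0" using neg by auto
  then have Hp0: "p0 \<bullet> (H *v p0) > 0" using H unfolding pos_def_def by blast
  have \<delta>0: "\<delta>0 > 0" unfolding \<delta>0_def by (rule divide_pos_pos) (use neg Hp0 in auto)
  have "finite (uminus ` ?D)" using finite_generalized_eigenvalues[OF F H] by simp
  moreover have "infinite {0<..<\<delta>0}" using \<delta>0 by simp
  ultimately have "\<not> {0<..<\<delta>0} \<subseteq> uminus ` ?D" using finite_subset by blast
  then obtain \<delta> where "\<delta> \<in> {0<..<\<delta>0}" "\<delta> \<notin> uminus ` ?D" by blast
  then have \<delta>: "0 < \<delta>" "\<delta> < \<delta>0" "\<delta> \<notin> uminus ` ?D" by auto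
  define G where "G = F + \<delta> *\<^sub>R H"
  have Gv: "G *v v = F *v v + \<delta> *\<^sub>R (H *v v)" for v
    by (simp add: G_def matrix_vector_mult_add_rdistrib scaleR_matrix_vector_assoc)
  have Gsym: "u \<bullet> (G *v v) = v \<bullet> (G *v u)" for u v
    using F[of u v] Hsym[of u v] by (simp add: Gv inner_add_right)
  have Ginj: "G *v v \<noteq> 0" if "v \<noteq> 0" for v
  proof
    assume "G *v v = 0"
    then have "F *v v = (- \<delta>) *\<^sub>R (H *v v)"
      by (simp add: Gv eq_neg_iff_add_eq_0)
    then have "- \<delta> \<in> ?D" using that by blast
    then have "- (- \<delta>) \<in> uminus ` ?D" by (rule imageI)
    then show False using \<delta>(3) by (simp only: minus_minus)
  qed
  have Gneg: "p0 \<bullet> (G *v p0) < 0"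
  proof -
    have "\<delta> * (p0 \<bullet> (H *v p0)) \<le> \<delta>0 * (p0 \<bullet> (H *v p0))"
      using \<delta> Hp0 by (intro mult_right_mono) auto
    also have "\<dots> < \<delta>0 * (p0 \<bullet> (H *v p0) + 1)" using \<delta>0 by (simp add: algebra_simps)
    also have "\<dots> = - (p0 \<bullet> (F *v p0))" using Hp0 by (simp add: \<delta>0_def)
    finally show ?thesis by (simp add: Gv inner_add_right)
  qed
  define C where "C = P ** G ** P"
  have Cv: "C *v v = P *v (G *v (P *v v))" for v
    by (simp add: C_def flip: matrix_vector_mul_assoc)
  \<comment> \<open>The squared length of \<open>G P u\<close> in the inner product of
    \<open>P\<close>; invertibility of \<open>G\<close> makes it definite.\<close>
  define B where "B u = (G *v (P *v u)) \<bullet> (P *v (G *v (P *v u)))" for u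
  obtain m where m: "m > 0" "\<And>v. m * (norm v)\<^sup>2 \<le> B v"
  proof (rule quadratic_form_lower_bound)
    show "continuous_on UNIV B" unfolding B_def matrix_vector_mul_assoc by (intro continuous_intros)
    show "B (t *\<^sub>R v) = t\<^sup>2 * B v" for t v
      by (simp add: B_def matrix_vector_mult_scaleR power2_eq_square)
    show "B v > 0" if "v \<noteq> 0" for v
      unfolding B_def
    proof (intro Ppos Ginj)
      show "P *v v \<noteq> 0" using HP[of v] that by auto
    qed
  qed blast
  show ?thesis
  proof (rule that[of C \<delta> m "H *v p0"])
    show "u \<bullet> (C *v v) = v \<bullet> (C *v u)" for u v
    proof -
      have "u \<bullet> (C *v v) = (P *v u) \<bullet> (G *v (P *v v))"
        using Psym[of u "G *v (P *v v)"] by (simp add: Cv inner_commute)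
      also have "\<dots> = (P *v v) \<bullet> (G *v (P *v u))" by (rule Gsym)
      also have "\<dots> = v \<bullet> (C *v u)"
        using Psym[of v "G *v (P *v u)"] by (simp add: Cv inner_commute)
      finally show ?thesis .
    qed
    \<comment> \<open>\<open>P\<close> undoes \<open>H\<close>, so at \<open>H *v p0\<close> the
      form takes the value \<open>p0 \<bullet> (G *v p0)\<close>.\<close>
    show "(H *v p0) \<bullet> (C *v (H *v p0)) < 0"
    proof -
      have "(H *v p0) \<bullet> (C *v (H *v p0)) = p0 \<bullet> (H *v (P *v (G *v p0)))"
        using Hsym[of "P *v (G *v p0)" p0] by (simp add: Cv PH inner_commute)
      then show ?thesis using Gneg by (simp add: HP)
    qed
    \<comment> \<open>Since \<open>F P u = G P u - \<delta> u\<close>, the right-hand side is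
      exactly \<open>B u\<close>; the shift thus reappears as the growth rate
      \<open>\<delta>\<close>.\<close>
    show "m * (norm u)\<^sup>2 \<le> (C *v u) \<bullet> ((F ** P) *v u) + \<delta> * (u \<bullet> (C *v u))" for u
    proof -
      have "F *v (P *v u) = G *v (P *v u) - \<delta> *\<^sub>R u" by (simp add: Gv HP)
      then have "(C *v u) \<bullet> ((F ** P) *v u) + \<delta> * (u \<bullet> (C *v u)) = B u"
        by (simp add: Cv B_def inner_diff_right inner_commute flip: matrix_vector_mul_assoc)
      then show ?thesis using m(2)[of u] by simp
    qed
  qed (use \<delta> m in auto)
qed

text \<open>\<open>T k\<close> is a tail of the noise series, so its increments are the noise terms \<open>a k *\<^sub>R M k\<close>; they
  cancel to first order in the variable \<open>u k = w k - T k *v w k\<close>.\<close>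

lemma unstable_form_nonpos_of_bounded:
  fixes A C :: "real ^ 'n ^ 'n"
  assumes C: "\<And>u v. u \<bullet> (C *v v) = v \<bullet> (C *v u)" and "\<delta> > 0" "m > 0" "b \<ge> 0"
    and key: "\<And>u. m * (norm u)\<^sup>2 \<le> (C *v u) \<bullet> (A *v u) + \<delta> * (u \<bullet> (C *v u))"
  obtains \<epsilon> where "\<epsilon> > 0" "\<epsilon> \<le> 1/2"
    "\<And>a w M T e R. \<lbrakk>\<And>k. 0 < a k \<and> a k \<le> \<epsilon>; filterlim (\<lambda>n. \<Sum>k<n. a k) at_top sequentially;
      \<And>k. T k - T (Suc k) = a k *\<^sub>R M k; \<And>k v. norm (T k *v v) \<le> \<epsilon> * norm v; \<And>k v. norm (M k *v v) \<le> b * norm v;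
      \<And>k. norm (e k) \<le> \<epsilon> * norm (w k);
      \<And>k. w (Suc k) = w k - a k *\<^sub>R (A *v w k + M k *v w k + e k);
      \<And>k. norm (w k) \<le> R\<rbrakk>
      \<Longrightarrow> 0 \<le> (w (0::nat) - T 0 *v w 0) \<bullet> (C *v (w 0 - T 0 *v w 0))"
proof -
  \<comment> \<open>\<open>K\<close> combines the factor \<open>2 * a0 + b + 2\<close> of the error
    in terms of \<open>w\<close> with the factor 2 from passing to \<open>u\<close>.\<close>
  define a0 c0 K where "a0 = norm A" and "c0 = norm C + 1" and "K = 2 * (2 * a0 + b + 2)"
  have pos: "a0 \<ge> 0" "c0 > 0" "K > 0" using \<open>b \<ge> 0\<close>
    by (auto simp: a0_def c0_def K_def add_nonneg_pos)
  \<comment> \<open>The bound 1/2 gives \<open>norm w \<le> 2 * norm u\<close>. Of the gain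
    \<open>2 * a * m * n\<close> per step, where \<open>n\<close> is the square of
    \<open>norm u\<close>, the second bound reserves one half for the first-order error and the
    third bound one half for the second-order term.\<close>
  define \<epsilon> where "\<epsilon> = min (1/2) (min (m / (2 * c0 * K)) (m / (c0 * (a0 + K)\<^sup>2)))"
  have a0K: "c0 * (a0 + K)\<^sup>2 > 0" using pos by simp
  have \<epsilon>: "\<epsilon> > 0" "\<epsilon> \<le> 1/2"
    unfolding \<epsilon>_def using pos \<open>m > 0\<close> a0K by (simp_all only: min_less_iff_conj divide_pos_pos) auto
  have \<epsilon>1: "2 * c0 * K * \<epsilon> \<le> m"
  proof -
    have "\<epsilon> \<le> m / (2 * c0 * K)" by (simp add: \<epsilon>_def)
    then show ?thesis using pos by (simp add: pos_le_divide_eq mult.commute)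
  qed
  have \<epsilon>2: "c0 * (a0 + K)\<^sup>2 * \<epsilon> \<le> m"
  proof -
    have "\<epsilon> \<le> m / (c0 * (a0 + K)\<^sup>2)" by (simp add: \<epsilon>_def)
    then show ?thesis using a0K by (simp add: pos_le_divide_eq mult.commute)
  qed
  have Cb: "norm (C *v v) \<le> c0 * norm v" for v
    by (rule order_trans[OF norm_matrix_vector_le mult_right_mono]) (auto simp: c0_def)
  have Ab: "norm (A *v v) \<le> a0 * norm v" for v
    using norm_matrix_vector_le[of A v] by (simp add: a0_def)
  show ?thesis
  proof (rule that[OF \<epsilon>])
    fix a :: "nat \<Rightarrow> real" and w e :: "nat \<Rightarrow> real ^ 'n" and M T :: "nat \<Rightarrow> real ^ 'n ^ 'n" and R
    assume a: "\<And>k. 0 < a k \<and> a k \<le> \<epsilon>" and div: "filterlim (\<lambda>n. \<Sum>k<n. a k) at_top sequentially"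
      and T: "\<And>k. T k - T (Suc k) = a k *\<^sub>R M k" and Tw: "\<And>k v. norm (T k *v v) \<le> \<epsilon> * norm v"
      and Mb: "\<And>k v. norm (M k *v v) \<le> b * norm v" and e: "\<And>k. norm (e k) \<le> \<epsilon> * norm (w k)"
      and w: "\<And>k. w (Suc k) = w k - a k *\<^sub>R (A *v w k + M k *v w k + e k)"
      and R: "\<And>k. norm (w k) \<le> R"
    define u where "u k = w k - T k *v w k" for k
    define g where "g k = A *v w k + M k *v w k + e k" for k
    \<comment> \<open>What remains of the perturbation in the variable \<open>u\<close>: each term
      contains a small factor, namely a tail \<open>T\<close> or the error \<open>e\<close>.\<close>
    define e' where "e' k = T (Suc k) *v g k - A *v (T k *v w k) - e k" for k
    define d where "d k = e' k - A *v u k" for k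
    define q where "q k = - (u k \<bullet> (C *v u k))" for k
    \<comment> \<open>\<open>T (Suc k) *v w k\<close> differs from \<open>T k *v w k\<close> by
      \<open>a k *\<^sub>R (M k *v w k)\<close>, which cancels the noise term of the
      recursion.\<close>
    have u': "u (Suc k) = u k + a k *\<^sub>R d k" for k
    proof -
      have T': "T (Suc k) = T k - a k *\<^sub>R M k" using T[of k] by (simp add: algebra_simps)
      have "T (Suc k) *v w k = T k *v w k - a k *\<^sub>R (M k *v w k)"
        unfolding T' by (simp add: matrix_vector_mult_diff_rdistrib scaleR_matrix_vector_assoc)
      moreover have "T (Suc k) *v w (Suc k) = T (Suc k) *v w k - a k *\<^sub>R (T (Suc k) *v g k)"
        unfolding w[of k] g_def[symmetric]
        by (simp add: matrix_vector_mult_diff_distrib matrix_vector_mult_scaleR)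
      ultimately have "u (Suc k) = u k - a k *\<^sub>R (g k - M k *v w k - T (Suc k) *v g k)"
        unfolding u_def w[of k] g_def[symmetric] by (simp add: scaleR_diff_right algebra_simps)
      also have "g k - M k *v w k - T (Suc k) *v g k = - d k"
        by (simp add: d_def e'_def u_def g_def matrix_vector_mult_diff_distrib)
      finally show ?thesis by simp
    qed
    have wu: "norm (w k) \<le> 2 * norm (u k)" for k
    proof -
      have "norm (w k) \<le> norm (u k) + norm (T k *v w k)"
        using norm_triangle_ineq[of "u k" "T k *v w k"] by (simp add: u_def)
      moreover have "norm (T k *v w k) \<le> 1/2 * norm (w k)"
        using Tw[of k "w k"] \<epsilon> by (meson mult_right_mono norm_ge_zero order_trans)
      ultimately show ?thesis by linarith
    qed
    have eb: "norm (e' k) \<le> \<epsilon> * K * norm (u k)" for k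
    proof -
      have "norm (g k) \<le> norm (A *v w k) + norm (M k *v w k) + norm (e k)"
        unfolding g_def by (meson add_mono norm_triangle_ineq order_refl order_trans)
      also have "\<dots> \<le> a0 * norm (w k) + b * norm (w k) + 1 * norm (w k)"
      proof (intro add_mono)
        show "norm (M k *v w k) \<le> b * norm (w k)"
          by (rule Mb)
        show "norm (e k) \<le> 1 * norm (w k)"
          by (rule order_trans[OF e mult_right_mono]) (use \<epsilon> in auto)
      qed (rule Ab)
      finally have gb: "norm (g k) \<le> (a0 + b + 1) * norm (w k)" by (simp add: algebra_simps)
      have "norm (e' k) \<le> norm (T (Suc k) *v g k) + norm (A *v (T k *v w k)) + norm (e k)"
        unfolding e'_def by (meson add_mono norm_triangle_ineq4 order_refl order_trans)
      also have "\<dots> \<le> \<epsilon> * ((a0 + b + 1) * norm (w k)) + a0 * (\<epsilon> * norm (w k)) + \<epsilon> * norm (w k)"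
      proof (intro add_mono e)
        show "norm (T (Suc k) *v g k) \<le> \<epsilon> * ((a0 + b + 1) * norm (w k))"
          by (rule order_trans[OF Tw mult_left_mono[OF gb]]) (use \<epsilon> in auto)
        show "norm (A *v (T k *v w k)) \<le> a0 * (\<epsilon> * norm (w k))"
          by (rule order_trans[OF Ab mult_left_mono[OF Tw]]) (use pos in auto)
      qed
      also have "\<dots> = \<epsilon> * (2 * a0 + b + 2) * norm (w k)" by (simp add: algebra_simps)
      also have "\<dots> \<le> \<epsilon> * (2 * a0 + b + 2) * (2 * norm (u k))"
        using wu[of k] \<epsilon> pos \<open>b \<ge> 0\<close> by (intro mult_left_mono) auto
      finally show ?thesis by (simp add: K_def algebra_simps)
    qed
    have db: "norm (d k) \<le> (a0 + K) * norm (u k)" for k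
    proof -
      have "norm (d k) \<le> norm (e' k) + norm (A *v u k)"
        unfolding d_def by (rule norm_triangle_ineq4)
      also have "\<dots> \<le> 1 * K * norm (u k) + a0 * norm (u k)"
      proof (intro add_mono Ab)
        show "norm (e' k) \<le> 1 * K * norm (u k)"
          by (rule order_trans[OF eb mult_right_mono[OF mult_right_mono]]) (use \<epsilon> pos in auto)
      qed
      finally show ?thesis by (simp add: algebra_simps)
    qed
    have step: "q (Suc k) \<ge> (1 + 2 * \<delta> * a k) * q k" for k
    proof -
      define n where "n = (norm (u k))\<^sup>2"
      have n: "n \<ge> 0" by (simp add: n_def)
      have 1: "(C *v u k) \<bullet> e' k \<le> c0 * K * \<epsilon> * n"
      proof -
        have "(C *v u k) \<bullet> e' k \<le> norm (C *v u k) * norm (e' k)" by (rule norm_cauchy_schwarz)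
        also have "\<dots> \<le> (c0 * norm (u k)) * (\<epsilon> * K * norm (u k))"
          by (intro mult_mono Cb eb) (use pos in auto)
        finally show ?thesis by (simp add: n_def power2_eq_square algebra_simps)
      qed
      have 2: "d k \<bullet> (C *v d k) \<le> c0 * (a0 + K)\<^sup>2 * n"
      proof -
        have "d k \<bullet> (C *v d k) \<le> norm (d k) * norm (C *v d k)" by (rule norm_cauchy_schwarz)
        also have "\<dots> \<le> norm (d k) * (c0 * norm (d k))"
          by (intro mult_left_mono Cb) auto
        also have "\<dots> = c0 * (norm (d k))\<^sup>2" by (simp add: power2_eq_square)
        also have "\<dots> \<le> c0 * ((a0 + K) * norm (u k))\<^sup>2"
          by (intro mult_left_mono power_mono db) (use pos in auto)
        finally show ?thesis by (simp add: n_def power_mult_distrib mult.assoc)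
      qed
      have "u (Suc k) \<bullet> (C *v u (Suc k)) =
          u k \<bullet> (C *v u k) + 2 * a k * ((C *v u k) \<bullet> d k) + (a k)\<^sup>2 * (d k \<bullet> (C *v d k))"
        using C[of "u k" "d k"] unfolding u'
        by (simp add: matrix_vector_right_distrib matrix_vector_mult_scaleR inner_add_left
            inner_add_right power2_eq_square inner_commute algebra_simps)
      moreover have "(C *v u k) \<bullet> d k \<le> c0 * K * \<epsilon> * n - m * n + \<delta> * (u k \<bullet> (C *v u k))"
        using 1 key[of "u k"] by (simp add: d_def n_def inner_diff_right)
      then have "2 * a k * ((C *v u k) \<bullet> d k) \<le> 2 * a k * (c0 * K * \<epsilon> * n - m * n + \<delta> * (u k \<bullet> (C *v u k)))"
        using a[of k] by (intro mult_left_mono) auto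
      moreover have "(a k)\<^sup>2 * (d k \<bullet> (C *v d k)) \<le> a k * (m * n)"
      proof -
        have "(a k)\<^sup>2 * (d k \<bullet> (C *v d k)) \<le> (a k)\<^sup>2 * (c0 * (a0 + K)\<^sup>2 * n)"
          using 2 by (intro mult_left_mono) auto
        also have "\<dots> = a k * (c0 * (a0 + K)\<^sup>2 * a k * n)" by (simp add: power2_eq_square)
        also have "\<dots> \<le> a k * (c0 * (a0 + K)\<^sup>2 * \<epsilon> * n)"
          using a[of k] n pos by (intro mult_left_mono mult_right_mono) auto
        also have "\<dots> \<le> a k * (m * n)"
          using \<epsilon>2 a[of k] n by (intro mult_left_mono mult_right_mono) auto
        finally show ?thesis .
      qed
      moreover have "2 * a k * (c0 * K * \<epsilon> * n) \<le> a k * (m * n)"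
        using mult_right_mono[OF \<epsilon>1, of "a k * n"] a[of k] n by (simp add: algebra_simps)
      ultimately have "u (Suc k) \<bullet> (C *v u (Suc k)) \<le> u k \<bullet> (C *v u k) + 2 * \<delta> * a k * (u k \<bullet> (C *v u k))"
        by (simp add: algebra_simps)
      then show ?thesis by (simp add: q_def algebra_simps)
    qed
    have "q 0 \<le> 0"
    proof (rule ccontr)
      assume "\<not> q 0 \<le> 0"
      then have q0: "q 0 > 0" by simp
      \<comment> \<open>Linear growth in the sum of the step sizes suffices, since that sum
        diverges; positivity of \<open>q 0\<close> keeps \<open>q n \<ge> q 0\<close> along the
        induction.\<close>
      have grow: "q n \<ge> q 0 * (1 + 2 * \<delta> * (\<Sum>k<n. a k))" for n
      proof (induction n)
        case (Suc n)
        have "(\<Sum>k<n. a k) \<ge> 0" using a by (intro sum_nonneg) (auto intro: less_imp_le)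
        then have "q 0 \<le> q 0 * (1 + 2 * \<delta> * (\<Sum>k<n. a k))" using q0 \<open>\<delta> > 0\<close> by simp
        then have "q 0 \<le> q n" using Suc by simp
        then have "2 * \<delta> * a n * q 0 \<le> 2 * \<delta> * a n * q n"
          using a[of n] \<open>\<delta> > 0\<close> by (intro mult_left_mono) auto
        then show ?case using step[of n] Suc by (simp add: algebra_simps)
      qed simp
      have ub: "q n \<le> c0 * (2 * R)\<^sup>2" for n
      proof -
        have "norm (u n) \<le> norm (w n) + norm (T n *v w n)"
          unfolding u_def by (rule norm_triangle_ineq4)
        also have "\<dots> \<le> norm (w n) + 1 * norm (w n)"
          by (intro add_left_mono order_trans[OF Tw mult_right_mono]) (use \<epsilon> in auto)
        finally have un: "norm (u n) \<le> 2 * R" using R[of n] by simp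
        have "q n \<le> norm (u n) * norm (C *v u n)"
          using norm_cauchy_schwarz[of "- u n" "C *v u n"] by (simp add: q_def)
        also have "\<dots> \<le> norm (u n) * (c0 * norm (u n))"
          by (intro mult_left_mono Cb) auto
        also have "\<dots> = c0 * (norm (u n))\<^sup>2" by (simp add: power2_eq_square)
        also have "\<dots> \<le> c0 * (2 * R)\<^sup>2"
          using un pos by (intro mult_left_mono power_mono) auto
        finally show ?thesis .
      qed
      have "eventually (\<lambda>n. (\<Sum>k<n. a k) > c0 * (2 * R)\<^sup>2 / (2 * \<delta> * q 0)) sequentially"
        using div unfolding filterlim_at_top_dense by blast
      then obtain n where "(\<Sum>k<n. a k) > c0 * (2 * R)\<^sup>2 / (2 * \<delta> * q 0)"
        unfolding eventually_sequentially by blast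
      then have "c0 * (2 * R)\<^sup>2 < 2 * \<delta> * q 0 * (\<Sum>k<n. a k)"
        using q0 \<open>\<delta> > 0\<close> by (simp add: field_simps)
      then show False using grow[of n] ub[of n] q0 by (simp add: algebra_simps)
    qed
    then show "0 \<le> (w 0 - T 0 *v w 0) \<bullet> (C *v (w 0 - T 0 *v w 0))"
      by (simp add: q_def u_def)
  qed
qed

section \<open>Mirror kernels\<close>

text \<open>The mean value inequality for \<open>G - A0\<close>. The error is proportional to
  \<open>norm (y - x)\<close> for every pair of points, not to the distance from a centre: two
  orbits near a saddle may be much closer to each other than to it.\<close>

lemma has_derivative_local_linear:
  fixes G :: "real ^ 'n \<Rightarrow> real ^ 'm" and A :: "real ^ 'n \<Rightarrow> real ^ 'n ^ 'm"
  assumes "convex B" and G: "\<And>z. z \<in> B \<Longrightarrow> (G has_derivative (*v) (A z)) (at z)"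
    and A: "\<And>z v. z \<in> B \<Longrightarrow> norm ((A z - A0) *v v) \<le> \<epsilon> * norm v"
    and "x \<in> B" "y \<in> B"
  shows "norm (G y - G x - A0 *v (y - x)) \<le> \<epsilon> * norm (y - x)"
proof -
  have "norm ((G y - A0 *v y) - (G x - A0 *v x)) \<le> \<epsilon> * norm (y - x)"
  proof (rule differentiable_bound[of B "\<lambda>z. G z - A0 *v z" "\<lambda>z v. A z *v v - A0 *v v"])
    fix z assume z: "z \<in> B"
    have "(G has_derivative (*v) (A z)) (at z within B)"
      using G[OF z] by (rule has_derivative_at_withinI)
    then show "((\<lambda>z. G z - A0 *v z) has_derivative (\<lambda>v. A z *v v - A0 *v v)) (at z within B)"
      by (intro has_derivative_diff bounded_linear_imp_has_derivative matrix_vector_mul_bounded_linear)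
    show "onorm (\<lambda>v. A z *v v - A0 *v v) \<le> \<epsilon>"
      using A[OF z] by (intro onorm_le) (simp add: matrix_vector_mult_diff_rdistrib)
  qed (use assms in auto)
  then show ?thesis by (simp add: matrix_vector_mult_diff_distrib algebra_simps)
qed

text \<open>A proper kernel may have an effective domain without interior; the initial point is what
  provides \<open>nonempty\<close>.\<close>

locale mirror =
  fixes h :: "real ^ 'n \<Rightarrow> ereal"
  assumes kernel: "mirror_kernel h" and nonempty: "mirror_domain h \<noteq> {}"
begin

abbreviation "X \<equiv> mirror_domain h"
abbreviation "hr \<equiv> \<lambda>y. real_of_ereal (h y)"
abbreviation "dh \<equiv> kernel_grad h"
abbreviation "Hh \<equiv> hessian hr"

lemma h_not_minus_infinity: "h x \<noteq> -\<infinity>"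
  using kernel unfolding mirror_kernel_def by blast

lemma h_real: "x \<in> X \<Longrightarrow> h x = ereal (hr x)"
  using h_not_minus_infinity[of x] interior_subset[of "effective_domain h"]
  by (cases "h x") (auto simp: mirror_domain_def effective_domain_def)

lemma open_X: "open X"
  by (simp add: mirror_domain_def)

lemma h_convex:
  assumes "h x = ereal a" "h y = ereal b" "0 \<le> t" "t \<le> 1"
  shows "h (x + t *\<^sub>R (y - x)) \<le> ereal (a + t * (b - a))"
proof -
  have "convex (ereal_epigraph h)" using kernel unfolding mirror_kernel_def by blast
  moreover have "(x, a) \<in> ereal_epigraph h" "(y, b) \<in> ereal_epigraph h"
    using assms by (auto simp: ereal_epigraph_def)
  ultimately have "(1 - t) *\<^sub>R (x, a) + t *\<^sub>R (y, b) \<in> ereal_epigraph h"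
    using assms(3,4) by (intro convexD) auto
  then show ?thesis by (simp add: ereal_epigraph_def algebra_simps)
qed

lemma convex_X: "convex X"
proof -
  have "effective_domain h = fst ` ereal_epigraph h"
  proof
    show "effective_domain h \<subseteq> fst ` ereal_epigraph h"
    proof
      fix x assume "x \<in> effective_domain h"
      then obtain r where "h x = ereal r"
        using h_not_minus_infinity[of x] by (cases "h x") (auto simp: effective_domain_def)
      then show "x \<in> fst ` ereal_epigraph h"
        by (intro image_eqI[of _ _ "(x, r)"]) (auto simp: ereal_epigraph_def)
    qed
    show "fst ` ereal_epigraph h \<subseteq> effective_domain h"
      by (auto simp: ereal_epigraph_def effective_domain_def dest: le_less_trans)
  qed
  moreover have "convex (ereal_epigraph h)" using kernel unfolding mirror_kernel_def by blast
  ultimately show ?thesis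
    unfolding mirror_domain_def
    by (metis convex_interior convex_linear_image linear_fst)
qed

lemma segment_in_X:
  assumes "x \<in> X" "y \<in> X" "0 \<le> t" "t \<le> 1"
  shows "x + t *\<^sub>R (y - x) \<in> X"
proof -
  have "(1 - t) *\<^sub>R x + t *\<^sub>R y \<in> X" using convex_X assms by (intro convexD) auto
  then show ?thesis by (simp add: algebra_simps)
qed

lemma h_twice_differentiable: "twice_differentiable_on hr X"
  and Hh_continuous: "continuous_on X Hh"
  using kernel unfolding mirror_kernel_def C2_on_def by blast+

lemma Hh_pos_def: "x \<in> X \<Longrightarrow> pos_def (Hh x)"
  using kernel unfolding mirror_kernel_def by blast

lemmas hr_gderiv = gderiv_gradient[OF h_twice_differentiable]
lemmas dh_derivative = gradient_has_derivative[OF h_twice_differentiable]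

lemma dh_continuous: "continuous_on X dh"
  by (intro continuous_at_imp_continuous_on ballI has_derivative_continuous[OF dh_derivative])

text \<open>Along a segment with direction \<open>v\<close>, the derivative of
  \<open>dh \<bullet> v\<close> is the Hessian form at \<open>v\<close>. It is positive, so the
  directional derivative of the kernel increases strictly.\<close>

lemma dh_strict:
  assumes x: "x \<in> X" and y: "y \<in> X" and "x \<noteq> y"
  shows gradient_inequality_strict: "dh x \<bullet> (y - x) < hr y - hr x"
    and dh_strict_monotone: "0 < (dh y - dh x) \<bullet> (y - x)"
proof -
  define v where "v = y - x"
  have v: "v \<noteq> 0" using assms by (simp add: v_def)
  have seg: "x + t *\<^sub>R v \<in> X" if "0 \<le> t" "t \<le> 1" for t
    using segment_in_X[OF x y that] by (simp add: v_def)
  have d1: "((\<lambda>t. hr (x + t *\<^sub>R v)) has_real_derivative dh (x + t *\<^sub>R v) \<bullet> v) (at t)"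
    if "0 \<le> t" "t \<le> 1" for t
    by (rule GDERIV_along_line[OF hr_gderiv[OF seg[OF that]]])
  have d2: "((\<lambda>t. dh (x + t *\<^sub>R v) \<bullet> v) has_real_derivative v \<bullet> (Hh (x + t *\<^sub>R v) *v v)) (at t)"
    if "0 \<le> t" "t \<le> 1" for t
  proof -
    have 1: "((\<lambda>t. x + t *\<^sub>R v) has_derivative (\<lambda>s. s *\<^sub>R v)) (at t)"
      by (auto intro!: derivative_eq_intros)
    have "((\<lambda>t. dh (x + t *\<^sub>R v) \<bullet> v) has_derivative (\<lambda>s. (Hh (x + t *\<^sub>R v) *v (s *\<^sub>R v)) \<bullet> v)) (at t)"
      by (intro has_derivative_inner_left has_derivative_compose[OF 1 dh_derivative[OF seg[OF that]]])
    then show ?thesis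
      by (simp add: has_field_derivative_def matrix_vector_mult_scaleR inner_commute mult.commute[of _ "v \<bullet> _"])
  qed
  have inc: "dh (x + s *\<^sub>R v) \<bullet> v < dh (x + t *\<^sub>R v) \<bullet> v" if "0 \<le> s" "s < t" "t \<le> 1" for s t
  proof (rule DERIV_pos_imp_increasing[OF \<open>s < t\<close>])
    fix r assume "s \<le> r" "r \<le> t"
    then have r: "0 \<le> r" "r \<le> 1" using that by auto
    have "v \<bullet> (Hh (x + r *\<^sub>R v) *v v) > 0"
      using Hh_pos_def[OF seg[OF r]] v unfolding pos_def_def by blast
    then show "\<exists>y. ((\<lambda>t. dh (x + t *\<^sub>R v) \<bullet> v) has_real_derivative y) (at r) \<and> 0 < y"
      using d2[OF r] by blast
  qed
  obtain s where s: "0 < s" "s < 1" "hr (x + 1 *\<^sub>R v) - hr (x + 0 *\<^sub>R v) = (1 - 0) * (dh (x + s *\<^sub>R v) \<bullet> v)"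
    using MVT2[OF zero_less_one, of "\<lambda>t. hr (x + t *\<^sub>R v)" "\<lambda>t. dh (x + t *\<^sub>R v) \<bullet> v"] d1 by blast
  then show "dh x \<bullet> (y - x) < hr y - hr x"
    using inc[of 0 s] by (simp add: v_def)
  show "0 < (dh y - dh x) \<bullet> (y - x)"
    using inc[of 0 1] by (simp add: v_def inner_diff_left)
qed

section \<open>The dual map as a homeomorphism onto the dual space\<close>

lemma dh_inj: "inj_on dh X"
  using dh_strict_monotone by (auto simp: inj_on_def) (metis cancel_comm_monoid_add_class.diff_cancel inner_zero_left less_irrefl)

lemma dual_bound: "\<exists>c. \<forall>x\<in>X. z \<bullet> x - hr x \<le> c"
proof -
  have "convex_conjugate h z < \<infinity>"
    using kernel unfolding mirror_kernel_def effective_domain_def by blast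
  moreover have le: "ereal (z \<bullet> x - hr x) \<le> convex_conjugate h z" if "x \<in> X" for x
  proof -
    have "ereal (z \<bullet> x) - h x \<le> convex_conjugate h z"
      unfolding convex_conjugate_def by (rule SUP_upper) simp
    then show ?thesis using h_real[OF that] by (metis ereal_minus(1))
  qed
  ultimately show ?thesis
    by (cases "convex_conjugate h z") fastforce+
qed

text \<open>Testing the conjugate at \<open>\<zeta> \<pm> e\<^sub>i\<close> gives linear growth of \<open>h - \<zeta>\<close>.\<close>

lemma bounded_dh_preimage:
  obtains \<eta> R where "\<eta> > 0" "\<And>x. x \<in> X \<Longrightarrow> norm (dh x - \<zeta>) \<le> \<eta> \<Longrightarrow> norm x \<le> R"
proof -
  obtain b where b: "\<And>z x. x \<in> X \<Longrightarrow> z \<bullet> x - hr x \<le> b z"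
    using dual_bound by metis
  define c c' where "c i = b (\<zeta> + axis i 1)" and "c' i = b (\<zeta> - axis i 1)" for i
  obtain x0 where x0: "x0 \<in> X" using nonempty by blast
  define d where "d = real CARD('n)"
  have d: "d > 0" by (simp add: d_def)
  define K where "K = (\<Sum>i\<in>UNIV. \<bar>c i\<bar> + \<bar>c' i\<bar>)"
  \<comment> \<open>Summed over the \<open>d\<close> coordinates, the error
    \<open>\<eta> * norm x\<close> becomes \<open>norm x / 2\<close> and can be absorbed.\<close>
  define \<eta> where "\<eta> = 1 / (2 * d)"
  define N where "N = \<bar>hr x0\<bar> + (norm \<zeta> + \<eta>) * norm x0"
  show ?thesis
  proof (rule that[of \<eta> "2 * (K + d * N)"])
    show "\<eta> > 0" using d by (simp add: \<eta>_def)
    fix x assume x: "x \<in> X" and near: "norm (dh x - \<zeta>) \<le> \<eta>"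
    \<comment> \<open>The gradient inequality from \<open>x\<close> towards the fixed point
      \<open>x0\<close> bounds \<open>hr x - dh x \<bullet> x\<close> from above; replacing
      \<open>dh x\<close> by the nearby \<open>\<zeta>\<close> costs
      \<open>\<eta> * norm x\<close>.\<close>
    have "hr x - dh x \<bullet> x \<le> hr x0 - dh x \<bullet> x0"
      using gradient_inequality_strict[OF x x0] by (cases "x = x0") (auto simp: inner_diff_right)
    moreover have "(dh x - \<zeta>) \<bullet> x \<le> \<eta> * norm x"
      using norm_cauchy_schwarz[of "dh x - \<zeta>" x] near by (meson mult_right_mono norm_ge_zero order_trans)
    moreover have "- (dh x \<bullet> x0) \<le> (norm \<zeta> + \<eta>) * norm x0"
    proof -
      have "norm (dh x) \<le> norm \<zeta> + \<eta>"
        using norm_triangle_ineq[of \<zeta> "dh x - \<zeta>"] near by simp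
      then have "norm (dh x) * norm x0 \<le> (norm \<zeta> + \<eta>) * norm x0" by (intro mult_right_mono) auto
      then show ?thesis using Cauchy_Schwarz_ineq2[of "dh x" x0] by linarith
    qed
    ultimately have 1: "hr x - \<zeta> \<bullet> x \<le> \<eta> * norm x + N"
      unfolding N_def inner_diff_left by linarith
    have "\<bar>x $ i\<bar> \<le> \<bar>c i\<bar> + \<bar>c' i\<bar> + (hr x - \<zeta> \<bullet> x)" for i
      using b[OF x, of "\<zeta> + axis i 1"] b[OF x, of "\<zeta> - axis i 1"]
      by (simp add: inner_add_left inner_diff_left inner_axis' abs_le_iff c_def c'_def) argo
    then have "(\<Sum>i\<in>UNIV. \<bar>x $ i\<bar>) \<le> (\<Sum>i\<in>UNIV. \<bar>c i\<bar> + \<bar>c' i\<bar> + (hr x - \<zeta> \<bullet> x))"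
      by (intro sum_mono) auto
    also have "\<dots> = K + d * (hr x - \<zeta> \<bullet> x)"
      by (simp add: sum.distrib K_def d_def)
    also have "\<dots> \<le> K + d * (\<eta> * norm x + N)"
      using 1 d by simp
    also have "\<dots> = K + d * N + norm x / 2"
      using d by (simp add: \<eta>_def field_simps)
    finally have "norm x \<le> K + d * N + norm x / 2"
      using norm_le_l1_cart[of x] by (rule order_trans[rotated])
    then show "norm x \<le> 2 * (K + d * N)" by simp
  qed
qed

text \<open>The image is open by invariance of domain and closed by essential smoothness.\<close>

lemma dh_image: "dh ` X = UNIV"
proof -
  have "open (dh ` X)"
    by (rule invariance_of_domain[OF dh_continuous open_X dh_inj])
  moreover have "closed (dh ` X)"
    unfolding closed_sequential_limits
  proof (intro allI impI, elim conjE)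
    fix y \<zeta> assume y: "\<forall>n. y n \<in> dh ` X" and lim: "y \<longlonglongrightarrow> \<zeta>"
    then obtain x where x: "\<And>n. x n \<in> X" "\<And>n. y n = dh (x n)"
      unfolding image_iff by metis
    obtain \<eta> R where R: "\<eta> > 0" "\<And>x. x \<in> X \<Longrightarrow> norm (dh x - \<zeta>) \<le> \<eta> \<Longrightarrow> norm x \<le> R"
      using bounded_dh_preimage[where \<zeta> = \<zeta>] by blast
    obtain n0 where n0: "\<And>n. n \<ge> n0 \<Longrightarrow> norm (dh (x n) - \<zeta>) < \<eta>"
      using lim R(1) unfolding LIMSEQ_iff x(2) by blast
    have "norm (x (n + n0)) \<le> R" for n
      using R(2)[OF x(1)] n0[of "n + n0"] by (simp add: less_imp_le)
    then have "bounded (range (\<lambda>n. x (n + n0)))"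
      unfolding bounded_iff by blast
    then obtain l r where r: "strict_mono r" "((\<lambda>n. x (n + n0)) \<circ> r) \<longlonglongrightarrow> l"
      using bounded_imp_convergent_subsequence by blast
    define u where "u n = x (r n + n0)" for n
    have u: "u \<longlonglongrightarrow> l" "\<And>n. u n \<in> X"
      using r x(1) by (auto simp: u_def[abs_def] o_def)
    have dhu: "(\<lambda>n. dh (u n)) \<longlonglongrightarrow> \<zeta>"
    proof -
      have "(\<lambda>n. y (n + n0)) \<longlonglongrightarrow> \<zeta>" using lim by (rule LIMSEQ_ignore_initial_segment)
      from LIMSEQ_subseq_LIMSEQ[OF this r(1)] show ?thesis
        by (simp add: o_def u_def x(2))
    qed
    show "\<zeta> \<in> dh ` X"
    proof (cases "l \<in> X")
      case True
      then have "(\<lambda>n. dh (u n)) \<longlonglongrightarrow> dh l"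
        using continuous_on_tendsto_compose[OF dh_continuous u(1)] u(2) by auto
      then have "dh l = \<zeta>" using dhu LIMSEQ_unique by blast
      then show ?thesis using True by blast
    next
      case False
      \<comment> \<open>A limit outside \<open>X\<close> lies on the frontier of the effective
        domain, where the gradients would blow up although they converge to
        \<open>\<zeta>\<close>.\<close>
      have "u n \<in> effective_domain h" for n
        using u(2)[of n] interior_subset unfolding mirror_domain_def by blast
      then have "l \<in> closure (effective_domain h)"
        using u(1) unfolding closure_sequential by blast
      then have "l \<in> frontier (effective_domain h)"
        using False unfolding frontier_def mirror_domain_def by blast
      moreover have "essentially_smooth h" using kernel unfolding mirror_kernel_def by blast
      ultimately have "filterlim (\<lambda>n. norm (dh (u n))) at_top sequentially"
        using u unfolding essentially_smooth_def by blast
      then have "filterlim (\<lambda>n. dh (u n)) at_infinity sequentially"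
        by (rule filterlim_norm_at_top_imp_at_infinity)
      then show ?thesis
        using not_tendsto_and_filterlim_at_infinity[OF _ dhu] by simp
    qed
  qed
  ultimately show ?thesis
    using clopen[of "dh ` X"] nonempty by blast
qed

text \<open>This is the gradient of the convex conjugate of \<open>h\<close>, obtained as an inverse
  function instead of by differentiating the conjugate.\<close>

definition dh_inv :: "real ^ 'n \<Rightarrow> real ^ 'n" where
  "dh_inv = inv_into X dh"

lemma dh_inv_in_X [simp]: "dh_inv z \<in> X"
  unfolding dh_inv_def using dh_image by (intro inv_into_into) blast

lemma dh_dh_inv [simp]: "dh (dh_inv z) = z"
  unfolding dh_inv_def using dh_image by (intro f_inv_into_f) blast

lemma dh_inv_dh [simp]: "x \<in> X \<Longrightarrow> dh_inv (dh x) = x"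
  unfolding dh_inv_def using dh_inj by simp

text \<open>Invariance of domain once more. Continuity of the inverse makes the orbits measurable in
  the initial point and the samples.\<close>

lemma dh_inv_continuous: "continuous_on UNIV dh_inv"
proof -
  obtain g where g: "homeomorphism X (dh ` X) dh g"
    using invariance_of_domain_homeomorphism[OF open_X dh_continuous order_refl dh_inj] by blast
  have "g z = dh_inv z" for z
    using homeomorphism_apply1[OF g, of "dh_inv z"] by simp
  moreover have "continuous_on UNIV g" using g dh_image by (simp add: homeomorphism_def)
  ultimately show ?thesis by (simp add: continuous_on_def)
qed

lemma bregman_real:
  assumes "x \<in> X" "h y = ereal b"
  shows "bregman h y x = ereal (b - hr x - dh x \<bullet> (y - x))"
  using assms(2) h_real[OF assms(1)] unfolding bregman_def by (metis ereal_minus(1))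

text \<open>A minimiser over the closure might lie on the boundary, where no derivative of
  \<open>h\<close> is available. It is therefore tested against the candidate \<open>p\<close>,
  whose dual image is \<open>\<zeta>\<close>, at a point of the connecting segment that is still
  inside \<open>X\<close>.\<close>

lemma smd_step_eq:
  assumes step: "smd_step h a g x x'" and x: "x \<in> X" and "a > 0"
  shows "x' = dh_inv (dh x - a *\<^sub>R g)"
proof (rule ccontr)
  define \<zeta> p where "\<zeta> = dh x - a *\<^sub>R g" and "p = dh_inv \<zeta>"
  assume "x' \<noteq> dh_inv (dh x - a *\<^sub>R g)"
  then have ne: "x' \<noteq> p" by (simp add: p_def \<zeta>_def)
  have p: "p \<in> X" "dh p = \<zeta>" by (simp_all add: p_def)
  define \<phi> where "\<phi> y = ereal (g \<bullet> (y - x)) + ereal (inverse a) * bregman h y x" for y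
  have "p \<in> closure X" using p closure_subset by blast
  then have "\<not> \<phi> p < \<phi> x'"
    using step unfolding smd_step_def is_arg_min_def \<phi>_def by blast
  then have le: "\<phi> x' \<le> \<phi> p" by simp
  have \<phi>: "\<phi> y = ereal (g \<bullet> (y - x) + inverse a * (b - hr x - dh x \<bullet> (y - x)))" if "h y = ereal b" for y b
    unfolding \<phi>_def bregman_real[OF x that] by simp
  \<comment> \<open>Outside the effective domain the objective is infinite, whereas it is finite at
    \<open>p\<close>.\<close>
  obtain b where b: "h x' = ereal b"
  proof (cases "h x'")
    case PInf
    moreover obtain k where "h x = ereal k" using h_real[OF x] by blast
    ultimately have "bregman h x' x = \<infinity>" unfolding bregman_def by simp
    then have "\<phi> x' = \<infinity>" using \<open>a > 0\<close> by (simp add: \<phi>_def)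
    then show ?thesis using le \<phi>[OF h_real[OF p(1)]] by simp
  qed (use h_not_minus_infinity in auto)
  have "g \<bullet> (x' - x) + inverse a * (b - hr x - dh x \<bullet> (x' - x)) \<le>
     g \<bullet> (p - x) + inverse a * (hr p - hr x - dh x \<bullet> (p - x))"
    using le unfolding \<phi>[OF b] \<phi>[OF h_real[OF p(1)]] by simp
  then have scaled: "a * (g \<bullet> (x' - x) + inverse a * (b - hr x - dh x \<bullet> (x' - x))) \<le>
     a * (g \<bullet> (p - x) + inverse a * (hr p - hr x - dh x \<bullet> (p - x)))"
    using \<open>a > 0\<close> by (intro mult_left_mono) auto
  have opt: "b - hr p \<le> \<zeta> \<bullet> (x' - p)"
  proof -
    have cancel: "a * (inverse a * z) = z" for z using \<open>a > 0\<close> by simp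
    then show ?thesis
      using scaled unfolding \<zeta>_def inner_diff_left inner_diff_right inner_scaleR_left distrib_left right_diff_distrib cancel
      by linarith
  qed
  obtain r where r: "r > 0" "cball p r \<subseteq> X" using open_X p(1) open_contains_cball by blast
  \<comment> \<open>Short enough for \<open>y\<close> to stay in the ball around \<open>p\<close>;
    there the strict gradient inequality at \<open>p\<close> and convexity of \<open>h\<close>
    contradict \<open>opt\<close>.\<close>
  define t where "t = min 1 (r / norm (x' - p))"
  have t: "0 < t" "t \<le> 1" using r ne by (auto simp: t_def)
  define y where "y = p + t *\<^sub>R (x' - p)"
  have "t * norm (x' - p) \<le> r"
  proof -
    have "t \<le> r / norm (x' - p)" by (simp add: t_def)
    then show ?thesis using ne by (simp add: pos_le_divide_eq)
  qed
  then have y: "y \<in> X" using r(2) t by (auto simp: y_def dist_norm subset_eq)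
  have "y \<noteq> p" using t ne by (simp add: y_def)
  then have "\<zeta> \<bullet> (y - p) < hr y - hr p"
    using gradient_inequality_strict[OF p(1) y] p(2) by simp
  moreover have "hr y \<le> hr p + t * (b - hr p)"
  proof -
    obtain k where "h y = ereal k" using h_real[OF y] by blast
    then show ?thesis
      using h_convex[OF h_real[OF p(1)] b, of t] t unfolding y_def[symmetric] by simp
  qed
  ultimately have "t * (\<zeta> \<bullet> (x' - p)) < t * (b - hr p)" by (simp add: y_def)
  then show False using opt t by simp
qed

lemma dh_local_linear:
  assumes c: "c \<in> X" and "\<epsilon> > 0"
  obtains r where "r > 0" "cball c r \<subseteq> X"
    "\<And>x y. x \<in> cball c r \<Longrightarrow> y \<in> cball c r \<Longrightarrow> norm (dh y - dh x - Hh c *v (y - x)) \<le> \<epsilon> * norm (y - x)"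
proof -
  obtain d where d: "d > 0" "\<And>z. z \<in> X \<Longrightarrow> dist z c < d \<Longrightarrow> dist (Hh z) (Hh c) < \<epsilon>"
    using Hh_continuous c \<open>\<epsilon> > 0\<close> unfolding continuous_on_iff by blast
  obtain r0 where r0: "r0 > 0" "cball c r0 \<subseteq> X" using open_X c open_contains_cball by blast
  define r where "r = min r0 (d / 2)"
  have r: "r > 0" "cball c r \<subseteq> X" "\<And>z. z \<in> cball c r \<Longrightarrow> dist z c < d"
    using r0 d(1) by (auto simp: r_def dist_commute)
  show ?thesis
  proof (rule that[OF r(1,2)], rule has_derivative_local_linear[of "cball c r"])
    fix z v assume z: "z \<in> cball c r"
    then show "(dh has_derivative (*v) (Hh z)) (at z)" using r(2) by (intro dh_derivative) blast
    have "norm (Hh z - Hh c) \<le> \<epsilon>" using d(2)[of z] r z by (auto simp: dist_norm less_imp_le)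
    then show "norm ((Hh z - Hh c) *v v) \<le> \<epsilon> * norm v"
      using norm_matrix_vector_le by (meson mult_right_mono norm_ge_zero order_trans)
  qed auto
qed

end

section \<open>Relatively smooth losses\<close>

text \<open>Polarization with a \<open>u\<close> as long as \<open>v\<close> in the direction of
  \<open>F *v v\<close>, followed by the parallelogram law: for a symmetric matrix, a bound on the
  quadratic form bounds the matrix with the same constant.\<close>

lemma norm_symmetric_matrix_le:
  fixes F :: "real ^ 'n ^ 'n"
  assumes sym: "\<And>u v. u \<bullet> (F *v v) = v \<bullet> (F *v u)" and B: "\<And>v. \<bar>v \<bullet> (F *v v)\<bar> \<le> B * (norm v)\<^sup>2"
  shows "norm (F *v v) \<le> B * norm v"
proof (cases "F *v v = 0")
  case True
  have "0 \<le> B * (norm v)\<^sup>2" using B[of v] by linarith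
  then show ?thesis using True by (cases "v = 0") (auto simp: zero_le_mult_iff)
next
  case False
  then have v: "v \<noteq> 0" by auto
  define u where "u = (norm v / norm (F *v v)) *\<^sub>R (F *v v)"
  have nu: "norm u = norm v" using False by (simp add: u_def)
  have "u \<bullet> (F *v v) = norm v * norm (F *v v)"
    using False by (simp add: u_def power2_norm_eq_inner[symmetric] power2_eq_square)
  moreover have "4 * (u \<bullet> (F *v v)) = (u + v) \<bullet> (F *v (u + v)) - (u - v) \<bullet> (F *v (u - v))"
    using sym[of u v] by (simp add: matrix_vector_right_distrib matrix_vector_mult_diff_distrib
        inner_add_left inner_add_right inner_diff_left inner_diff_right)
  moreover have "\<dots> \<le> B * (norm (u + v))\<^sup>2 + B * (norm (u - v))\<^sup>2"
    using B[of "u + v"] B[of "u - v"] by linarith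
  moreover have "\<dots> = 4 * (B * (norm v * norm v))"
  proof -
    have "(norm (u + v))\<^sup>2 + (norm (u - v))\<^sup>2 = 2 * (norm u)\<^sup>2 + 2 * (norm v)\<^sup>2"
      by (simp add: power2_norm_eq_inner inner_add_left inner_add_right inner_diff_left inner_diff_right inner_commute)
    then show ?thesis by (simp add: nu power2_eq_square flip: distrib_left)
  qed
  ultimately have "norm v * norm (F *v v) \<le> norm v * (B * norm v)" by (simp add: mult_ac)
  then show ?thesis using v by simp
qed

locale mirror_loss = mirror h
  for h :: "real ^ 'n \<Rightarrow> ereal" +
  fixes S :: "'s measure" and f :: "real ^ 'n \<Rightarrow> 's \<Rightarrow> real" and L :: real
  assumes L_pos: "L > 0" and smooth: "relatively_smooth S h f L"
    and C2: "\<And>s. s \<in> space S \<Longrightarrow> C2_on (\<lambda>x. f x s) (mirror_domain h)"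
    and hess_Lipschitz: "\<And>Q. compact Q \<Longrightarrow> Q \<subseteq> mirror_domain h \<Longrightarrow>
      \<exists>LQ. \<forall>x\<in>Q. \<forall>y\<in>Q. \<forall>s\<in>space S. opnorm (loss_hess f x s - loss_hess f y s) \<le> LQ * norm (x - y)"
begin

abbreviation "lg \<equiv> loss_grad f"
abbreviation "lh \<equiv> loss_hess f"

lemma loss_twice_differentiable: "s \<in> space S \<Longrightarrow> twice_differentiable_on (\<lambda>x. f x s) X"
  using C2 unfolding C2_on_def by blast

lemmas lg_derivative = gradient_has_derivative[OF loss_twice_differentiable]
lemmas lh_symmetric = hessian_symmetric[OF loss_twice_differentiable open_X]

text \<open>Relative smoothness from \<open>x\<close> to \<open>y\<close> is added to the one from
  \<open>y\<close> to \<open>x\<close>: the function values cancel, and the two Bregman divergences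
  sum to the monotonicity term of \<open>dh\<close>.\<close>

lemma lg_relative_bound:
  assumes x: "x \<in> X" and y: "y \<in> X" and s: "s \<in> space S"
  shows "\<bar>(lg y s - lg x s) \<bullet> (y - x)\<bar> \<le> L * ((dh y - dh x) \<bullet> (y - x))"
proof -
  have *: "\<bar>f y s - f x s - lg x s \<bullet> (y - x)\<bar> \<le> L * (hr y - hr x - dh x \<bullet> (y - x))"
    if "x \<in> X" "y \<in> X" for x y
  proof -
    have "ereal \<bar>f y s - f x s - lg x s \<bullet> (y - x)\<bar> \<le> ereal L * bregman h y x"
      using smooth that s unfolding relatively_smooth_def by blast
    then show ?thesis unfolding bregman_real[OF that(1) h_real[OF that(2)]] by simp
  qed
  have "(lg y s - lg x s) \<bullet> (y - x) = (f y s - f x s - lg x s \<bullet> (y - x)) + (f x s - f y s - lg y s \<bullet> (x - y))"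
    by (simp add: inner_diff_left inner_diff_right)
  then have "\<bar>(lg y s - lg x s) \<bullet> (y - x)\<bar> \<le>
     \<bar>f y s - f x s - lg x s \<bullet> (y - x)\<bar> + \<bar>f x s - f y s - lg y s \<bullet> (x - y)\<bar>"
    by (metis abs_triangle_ineq)
  also have "\<dots> \<le> L * (hr y - hr x - dh x \<bullet> (y - x)) + L * (hr x - hr y - dh y \<bullet> (x - y))"
    by (intro add_mono * x y)
  also have "\<dots> = L * ((dh y - dh x) \<bullet> (y - x))"
    by (simp add: inner_diff_left inner_diff_right algebra_simps)
  finally show ?thesis .
qed

lemma step_strongly_monotone:
  assumes "x \<in> X" "y \<in> X" "s \<in> space S" "0 \<le> a"
  shows "(1 - a * L) * ((dh y - dh x) \<bullet> (y - x)) \<le>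
    ((dh y - a *\<^sub>R lg y s) - (dh x - a *\<^sub>R lg x s)) \<bullet> (y - x)"
proof -
  have "a * ((lg y s - lg x s) \<bullet> (y - x)) \<le> a * (L * ((dh y - dh x) \<bullet> (y - x)))"
    using lg_relative_bound[OF assms(1-3)] assms(4) by (intro mult_left_mono) auto
  then show ?thesis by (simp add: inner_diff_left inner_diff_right algebra_simps)
qed

text \<open>The bound for points far from \<open>x0\<close> complements the local quadratic one:
  together they let a small dual displacement force a small primal one, which controls the inverse
  of a step near \<open>x0\<close>.\<close>

lemma dh_locally_strongly_monotone:
  assumes x0: "x0 \<in> X"
  obtains r c where "r > 0" "c > 0"
    "\<And>x. x \<in> X \<Longrightarrow> norm (x - x0) \<le> r \<Longrightarrow> c * (norm (x - x0))\<^sup>2 \<le> (dh x - dh x0) \<bullet> (x - x0)"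
    "\<And>x. x \<in> X \<Longrightarrow> r < norm (x - x0) \<Longrightarrow> c * r * norm (x - x0) \<le> (dh x - dh x0) \<bullet> (x - x0)"
proof -
  define H where "H = Hh x0"
  obtain m where m: "m > 0" "\<And>v. m * (norm v)\<^sup>2 \<le> v \<bullet> (H *v v)"
  proof (rule quadratic_form_lower_bound[of "\<lambda>v. v \<bullet> (H *v v)"])
    show "continuous_on UNIV (\<lambda>v. v \<bullet> (H *v v))" by (intro continuous_intros)
    show "(t *\<^sub>R v) \<bullet> (H *v (t *\<^sub>R v)) = t\<^sup>2 * (v \<bullet> (H *v v))" for t v
      by (simp add: matrix_vector_mult_scaleR power2_eq_square)
    show "0 < v \<bullet> (H *v v)" if "v \<noteq> 0" for v
      using Hh_pos_def[OF x0] that unfolding pos_def_def H_def by blast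
  qed blast
  \<comment> \<open>Half of the curvature \<open>m\<close> is spent on the linearisation
    error.\<close>
  define c where "c = m / 2"
  have c: "c > 0" using m by (simp add: c_def)
  obtain r where r: "r > 0" "cball x0 r \<subseteq> X"
    "\<And>x y. x \<in> cball x0 r \<Longrightarrow> y \<in> cball x0 r \<Longrightarrow> norm (dh y - dh x - H *v (y - x)) \<le> c * norm (y - x)"
    using dh_local_linear[OF x0 c] unfolding H_def by blast
  have inner: "c * (norm (x - x0))\<^sup>2 \<le> (dh x - dh x0) \<bullet> (x - x0)" if "norm (x - x0) \<le> r" for x
  proof -
    have "norm (dh x - dh x0 - H *v (x - x0)) \<le> c * norm (x - x0)"
      using r(1) that by (intro r(3)) (auto simp: dist_norm norm_minus_commute)
    then have "norm (dh x - dh x0 - H *v (x - x0)) * norm (x - x0) \<le> c * norm (x - x0) * norm (x - x0)"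
      by (intro mult_right_mono) auto
    moreover have "\<bar>(dh x - dh x0 - H *v (x - x0)) \<bullet> (x - x0)\<bar> \<le> norm (dh x - dh x0 - H *v (x - x0)) * norm (x - x0)"
      by (rule Cauchy_Schwarz_ineq2)
    moreover have "(dh x - dh x0) \<bullet> (x - x0) =
        (x - x0) \<bullet> (H *v (x - x0)) + (dh x - dh x0 - H *v (x - x0)) \<bullet> (x - x0)"
      unfolding inner_diff_left[of "dh x - dh x0" "H *v (x - x0)" "x - x0"] by (simp add: inner_commute)
    moreover have "2 * c * (norm (x - x0))\<^sup>2 \<le> (x - x0) \<bullet> (H *v (x - x0))"
      using m(2)[of "x - x0"] by (simp add: c_def)
    ultimately show ?thesis by (simp add: power2_eq_square mult.assoc)
  qed
  have outer: "c * r * norm (x - x0) \<le> (dh x - dh x0) \<bullet> (x - x0)" if x: "x \<in> X" and far: "r < norm (x - x0)" for x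
  proof -
    \<comment> \<open>\<open>x1\<close> below is the point of the segment at distance
      \<open>r\<close> from \<open>x0\<close>; monotonicity of \<open>dh\<close> along the segment
      carries the bound from \<open>x1\<close> to \<open>x\<close>.\<close>
    define t where "t = r / norm (x - x0)"
    have "norm (x - x0) > 0" using r(1) far by linarith
    then have t: "0 < t" "t < 1" "t * norm (x - x0) = r" using r(1) far by (auto simp: t_def)
    define x1 where "x1 = x0 + t *\<^sub>R (x - x0)"
    have x1: "x1 \<in> X" using segment_in_X[OF x0 x, of t] t by (simp add: x1_def)
    have d1: "x1 - x0 = t *\<^sub>R (x - x0)" "x - x1 = (1 - t) *\<^sub>R (x - x0)" by (auto simp: x1_def algebra_simps)
    have n1: "norm (x1 - x0) = r" using t by (simp add: d1)
    have "x \<noteq> x1" using d1(2) t far r by auto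
    then have "0 < (1 - t) * ((dh x - dh x1) \<bullet> (x - x0))"
      using dh_strict_monotone[OF x1 x] by (simp add: d1)
    then have "0 < (dh x - dh x1) \<bullet> (x - x0)" using t by (simp add: zero_less_mult_iff)
    then have "t * ((dh x1 - dh x0) \<bullet> (x - x0)) \<le> t * ((dh x - dh x0) \<bullet> (x - x0))"
      using t by (intro mult_left_mono) (auto simp: inner_diff_left)
    moreover have "c * r\<^sup>2 \<le> t * ((dh x1 - dh x0) \<bullet> (x - x0))"
      using inner[of x1] n1 by (simp add: d1)
    ultimately have "t * (c * r * norm (x - x0)) \<le> t * ((dh x - dh x0) \<bullet> (x - x0))"
      using t(3) by (simp add: power2_eq_square mult_ac) 
    then show ?thesis using t by simp
  qed
  show ?thesis by (rule that[OF r(1) c inner outer])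
qed

text \<open>To map null sets to null sets, the inverse of the step only has to satisfy a Lipschitz
  estimate at each image point, with a constant that may depend on the point. Strong monotonicity
  supplies this estimate.\<close>

lemma negligible_step_preimage:
  assumes N: "negligible N" and s: "s \<in> space S" and a: "0 \<le> a" "a * L < 1"
  shows "negligible {x \<in> X. dh x - a *\<^sub>R lg x s \<in> N}"
proof -
  define \<Psi> where "\<Psi> x = dh x - a *\<^sub>R lg x s" for x
  define \<kappa> where "\<kappa> = 1 - a * L"
  have \<kappa>: "\<kappa> > 0" using a by (simp add: \<kappa>_def)
  have mono: "\<kappa> * ((dh y - dh x) \<bullet> (y - x)) \<le> norm (\<Psi> y - \<Psi> x) * norm (y - x)" if "x \<in> X" "y \<in> X" for x y
    using step_strongly_monotone[OF that s a(1)] norm_cauchy_schwarz[of "\<Psi> y - \<Psi> x" "y - x"]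
    unfolding \<Psi>_def \<kappa>_def by linarith
  have inj: "inj_on \<Psi> X"
  proof (rule inj_onI, rule ccontr)
    fix x y assume *: "x \<in> X" "y \<in> X" "\<Psi> x = \<Psi> y" "x \<noteq> y"
    then have "0 < \<kappa> * ((dh y - dh x) \<bullet> (y - x))" using \<kappa> dh_strict_monotone by simp
    then show False using mono[OF *(1,2)] *(3) by simp
  qed
  have "negligible (inv_into X \<Psi> ` (N \<inter> \<Psi> ` X))"
  proof (rule negligible_locally_Lipschitz_image)
    show "negligible (N \<inter> \<Psi> ` X)" using N by (rule negligible_subset) blast
    fix y0 assume "y0 \<in> N \<inter> \<Psi> ` X"
    then obtain x0 where x0: "x0 \<in> X" "y0 = \<Psi> x0" by blast
    obtain r c where rc: "r > 0" "c > 0"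
      "\<And>x. x \<in> X \<Longrightarrow> norm (x - x0) \<le> r \<Longrightarrow> c * (norm (x - x0))\<^sup>2 \<le> (dh x - dh x0) \<bullet> (x - x0)"
      "\<And>x. x \<in> X \<Longrightarrow> r < norm (x - x0) \<Longrightarrow> c * r * norm (x - x0) \<le> (dh x - dh x0) \<bullet> (x - x0)"
      by (rule dh_locally_strongly_monotone[OF x0(1)]) blast
    have "norm (x - x0) \<le> (1 / (\<kappa> * c)) * norm (\<Psi> x - \<Psi> x0)"
      if x: "x \<in> X" and near: "norm (\<Psi> x - \<Psi> x0) < \<kappa> * c * r" for x
    proof (cases "x = x0")
      case False
      then have pos: "norm (x - x0) > 0" by simp
      \<comment> \<open>Outside the ball the linear lower bound would push the images apart by at
        least \<open>\<kappa> * c * r\<close>.\<close>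
      have "norm (x - x0) \<le> r"
      proof (rule ccontr)
        assume "\<not> ?thesis"
        then have "\<kappa> * (c * r * norm (x - x0)) \<le> norm (\<Psi> x - \<Psi> x0) * norm (x - x0)"
          using mono[OF x0(1) x] mult_left_mono[OF rc(4)[OF x], of \<kappa>] \<kappa> by linarith
        then have "\<kappa> * c * r \<le> norm (\<Psi> x - \<Psi> x0)" using pos by (simp flip: mult.assoc)
        then show False using near by simp
      qed
      then have "\<kappa> * (c * (norm (x - x0))\<^sup>2) \<le> norm (\<Psi> x - \<Psi> x0) * norm (x - x0)"
        using mono[OF x0(1) x] mult_left_mono[OF rc(3)[OF x], of \<kappa>] \<kappa> by linarith
      then have "\<kappa> * c * norm (x - x0) \<le> norm (\<Psi> x - \<Psi> x0)"
        using pos by (simp add: power2_eq_square flip: mult.assoc)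
      then show ?thesis using \<kappa> rc(2) by (simp add: pos_le_divide_eq mult_ac)
    qed simp
    then have "\<forall>y\<in>(N \<inter> \<Psi> ` X) \<inter> ball y0 (\<kappa> * c * r).
        norm (inv_into X \<Psi> y - inv_into X \<Psi> y0) \<le> (1 / (\<kappa> * c)) * norm (y - y0)"
      using inj x0 by (auto simp: dist_norm norm_minus_commute)
    then show "\<exists>T B. open T \<and> y0 \<in> T \<and>
        (\<forall>y\<in>(N \<inter> \<Psi> ` X) \<inter> T. norm (inv_into X \<Psi> y - inv_into X \<Psi> y0) \<le> B * norm (y - y0))"
      using \<kappa> rc by (intro exI[of _ "ball y0 (\<kappa> * c * r)"] exI[of _ "1 / (\<kappa> * c)"]) auto
  qed simp
  moreover have "{x \<in> X. \<Psi> x \<in> N} \<subseteq> inv_into X \<Psi> ` (N \<inter> \<Psi> ` X)"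
  proof
    fix x assume x: "x \<in> {x \<in> X. \<Psi> x \<in> N}"
    then have "x = inv_into X \<Psi> (\<Psi> x)" using inj by simp
    then show "x \<in> inv_into X \<Psi> ` (N \<inter> \<Psi> ` X)" using x by blast
  qed
  ultimately show ?thesis unfolding \<Psi>_def by (rule negligible_subset)
qed

lemma negligible_dh_image:
  assumes "negligible N" "N \<subseteq> X"
  shows "negligible (dh ` N)"
proof (rule negligible_differentiable_image_negligible[OF order_refl assms(1)])
  show "dh differentiable_on N"
    using dh_derivative assms(2) unfolding differentiable_on_def
    by (meson differentiableI has_derivative_at_withinI subset_iff)
qed

text \<open>Relative smoothness passes to second derivatives: the form of \<open>lh c s\<close> is
  dominated by \<open>L\<close> times that of the kernel Hessian. The constant is the same for all
  samples, which makes the Hessian noise bounded.\<close>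

lemma lh_bound:
  assumes c: "c \<in> X"
  obtains B where "B \<ge> 0" "\<And>s v. s \<in> space S \<Longrightarrow> norm (lh c s *v v) \<le> B * norm v"
proof -
  define B where "B = L * norm (Hh c)"
  have "norm (lh c s *v v) \<le> B * norm v" if s: "s \<in> space S" for s v
  proof (rule norm_symmetric_matrix_le[OF lh_symmetric[OF s c]])
    fix v
    \<comment> \<open>The two signs \<open>\<sigma>\<close> give the two halves of the absolute
      value.\<close>
    have *: "\<sigma> * (v \<bullet> (lh c s *v v)) \<le> L * (v \<bullet> (Hh c *v v))" if \<sigma>: "\<bar>\<sigma>\<bar> = 1" for \<sigma>
    proof (rule ccontr)
      assume neg: "\<not> ?thesis"
      \<comment> \<open>If the bound failed, \<open>\<phi>\<close> would have a negative derivative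
        at 0 and negative values just to the right, where the relative bound on gradients makes it
        nonnegative.\<close>
      define \<phi> where "\<phi> t = (L *\<^sub>R (dh (c + t *\<^sub>R v) - dh c) - \<sigma> *\<^sub>R (lg (c + t *\<^sub>R v) s - lg c s)) \<bullet> v" for t
      have l: "((\<lambda>t. c + t *\<^sub>R v) has_derivative (\<lambda>t. t *\<^sub>R v)) (at 0)"
        by (auto intro!: derivative_eq_intros)
      have d1: "((\<lambda>t. dh (c + t *\<^sub>R v)) has_derivative (\<lambda>t. Hh c *v (t *\<^sub>R v))) (at 0)"
        by (rule has_derivative_compose[OF l]) (use dh_derivative[OF c] in simp)
      have d2: "((\<lambda>t. lg (c + t *\<^sub>R v) s) has_derivative (\<lambda>t. lh c s *v (t *\<^sub>R v))) (at 0)"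
        by (rule has_derivative_compose[OF l]) (use lg_derivative[OF s c] in simp)
      have "(\<phi> has_derivative (\<lambda>t. (L *\<^sub>R (Hh c *v (t *\<^sub>R v) - 0) - \<sigma> *\<^sub>R (lh c s *v (t *\<^sub>R v) - 0)) \<bullet> v)) (at 0)"
        unfolding \<phi>_def
        by (intro has_derivative_inner_left has_derivative_diff has_derivative_scaleR_right d1 d2 has_derivative_const)
      also have "(\<lambda>t. (L *\<^sub>R (Hh c *v (t *\<^sub>R v) - 0) - \<sigma> *\<^sub>R (lh c s *v (t *\<^sub>R v) - 0)) \<bullet> v) =
          (*) (L * (v \<bullet> (Hh c *v v)) - \<sigma> * (v \<bullet> (lh c s *v v)))"
        by (auto simp: matrix_vector_mult_scaleR inner_diff_left inner_commute algebra_simps)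
      finally have "DERIV \<phi> 0 :> L * (v \<bullet> (Hh c *v v)) - \<sigma> * (v \<bullet> (lh c s *v v))"
        unfolding has_field_derivative_def .
      from DERIV_neg_dec_right[OF this] neg
      obtain d where d: "d > 0" "\<And>t. 0 < t \<Longrightarrow> t < d \<Longrightarrow> \<phi> t < \<phi> 0" by auto
      obtain r where r: "r > 0" "cball c r \<subseteq> X" using open_X c open_contains_cball by blast
      define t where "t = min (d / 2) (r / (norm v + 1))"
      have nv: "norm v + 1 > 0" by (simp add: add_nonneg_pos)
      have t: "0 < t" "t < d" "t * (norm v + 1) \<le> r"
      proof -
        show "0 < t" using d(1) r(1) nv by (simp add: t_def)
        have "t \<le> d / 2" unfolding t_def by (rule min.cobounded1)
        then show "t < d" using d(1) by simp
        have "t \<le> r / (norm v + 1)" by (simp add: t_def)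
        then show "t * (norm v + 1) \<le> r" using nv by (simp add: pos_le_divide_eq)
      qed
      then have y: "c + t *\<^sub>R v \<in> X"
        using r(2) by (auto simp: subset_eq dist_norm distrib_left)
      have "\<bar>(lg (c + t *\<^sub>R v) s - lg c s) \<bullet> (t *\<^sub>R v)\<bar> \<le> L * ((dh (c + t *\<^sub>R v) - dh c) \<bullet> (t *\<^sub>R v))"
        using lg_relative_bound[OF c y s] by simp
      then have "t * \<bar>(lg (c + t *\<^sub>R v) s - lg c s) \<bullet> v\<bar> \<le> t * (L * ((dh (c + t *\<^sub>R v) - dh c) \<bullet> v))"
        using t(1) by (simp add: abs_mult mult_ac)
      then have "\<bar>(lg (c + t *\<^sub>R v) s - lg c s) \<bullet> v\<bar> \<le> L * ((dh (c + t *\<^sub>R v) - dh c) \<bullet> v)"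
        using t(1) by simp
      moreover have "\<sigma> * ((lg (c + t *\<^sub>R v) s - lg c s) \<bullet> v) \<le> \<bar>(lg (c + t *\<^sub>R v) s - lg c s) \<bullet> v\<bar>"
        using \<sigma> abs_ge_self[of "\<sigma> * ((lg (c + t *\<^sub>R v) s - lg c s) \<bullet> v)"] by (simp add: abs_mult)
      ultimately have "0 \<le> \<phi> t" by (simp add: \<phi>_def inner_diff_left)
      moreover have "\<phi> 0 = 0" by (simp add: \<phi>_def)
      ultimately show False using d(2)[OF t(1,2)] by simp
    qed
    have "v \<bullet> (Hh c *v v) \<le> norm v * (norm (Hh c) * norm v)"
      using norm_cauchy_schwarz[of v "Hh c *v v"] norm_matrix_vector_le[of "Hh c" v]
      by (meson mult_left_mono norm_ge_zero order_trans)
    then have "L * (v \<bullet> (Hh c *v v)) \<le> L * (norm v * (norm (Hh c) * norm v))"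
      using L_pos by simp
    then show "\<bar>v \<bullet> (lh c s *v v)\<bar> \<le> B * (norm v)\<^sup>2"
      using *[of 1] *[of "-1"] by (simp add: B_def power2_eq_square mult_ac abs_le_iff)
  qed
  then show ?thesis using that[of B] L_pos by (simp add: B_def)
qed

text \<open>The radius has to serve all samples at once, because it is fixed before the sample
  sequence; this rests on the Lipschitz constant of the Hessians being uniform in
  \<open>s\<close>.\<close>

lemma lg_local_linear:
  assumes c: "c \<in> X" and "\<epsilon> > 0"
  obtains r where "r > 0" "cball c r \<subseteq> X"
    "\<And>x y s. x \<in> cball c r \<Longrightarrow> y \<in> cball c r \<Longrightarrow> s \<in> space S \<Longrightarrow>
       norm (lg y s - lg x s - lh c s *v (y - x)) \<le> \<epsilon> * norm (y - x)"
proof -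
  obtain r0 where r0: "r0 > 0" "cball c r0 \<subseteq> X" using open_X c open_contains_cball by blast
  obtain K where K: "\<And>x s. x \<in> cball c r0 \<Longrightarrow> s \<in> space S \<Longrightarrow> opnorm (lh x s - lh c s) \<le> K * norm (x - c)"
    using hess_Lipschitz[OF compact_cball r0(2)] r0(1) by (metis centre_in_cball less_imp_le)
  \<comment> \<open>\<open>K\<close> may be zero or negative, hence
    \<open>\<bar>K\<bar> + 1\<close>.\<close>
  define r where "r = min r0 (\<epsilon> / (\<bar>K\<bar> + 1))"
  have r: "r > 0" "r \<le> r0" "(\<bar>K\<bar> + 1) * r \<le> \<epsilon>"
  proof -
    show "r > 0" "r \<le> r0" using r0 \<open>\<epsilon> > 0\<close> by (auto simp: r_def)
    have "r \<le> \<epsilon> / (\<bar>K\<bar> + 1)" by (simp add: r_def)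
    then show "(\<bar>K\<bar> + 1) * r \<le> \<epsilon>" by (simp add: pos_le_divide_eq mult.commute)
  qed
  have sub: "cball c r \<subseteq> cball c r0" using r by (auto intro: order_trans)
  show ?thesis
  proof (rule that[of r])
    show "cball c r \<subseteq> X" using sub r0 by blast
    fix x y s assume xy: "x \<in> cball c r" "y \<in> cball c r" and s: "s \<in> space S"
    show "norm (lg y s - lg x s - lh c s *v (y - x)) \<le> \<epsilon> * norm (y - x)"
    proof (rule has_derivative_local_linear[of "cball c r" "\<lambda>z. lg z s" "\<lambda>z. lh z s"])
      fix z v assume z: "z \<in> cball c r"
      then show "((\<lambda>z. lg z s) has_derivative (*v) (lh z s)) (at z)"
        using sub r0(2) by (intro lg_derivative[OF s]) blast
      have "opnorm (lh z s - lh c s) \<le> K * norm (z - c)" using K z sub s by blast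
      also have "\<dots> \<le> (\<bar>K\<bar> + 1) * r"
        using z by (intro mult_mono) (auto simp: dist_norm norm_minus_commute)
      finally have "opnorm (lh z s - lh c s) \<le> \<epsilon>" using r(3) by linarith
      then show "norm ((lh z s - lh c s) *v v) \<le> \<epsilon> * norm v"
        using norm_matrix_vector_le_opnorm by (meson mult_right_mono norm_ge_zero order_trans)
    qed (use xy in auto)
  qed (use r in auto)
qed

end

section \<open>Orbits near a strict saddle\<close>

locale mirror_descent = mirror_loss h S f L
  for h :: "real ^ 'n \<Rightarrow> ereal" and S :: "'s measure" and f :: "real ^ 'n \<Rightarrow> 's \<Rightarrow> real" and L :: real +
  fixes \<alpha> :: "nat \<Rightarrow> real"
  assumes \<alpha>: "\<And>k. 0 < \<alpha> k \<and> \<alpha> k < 1 / L"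
    and \<alpha>_diverges: "filterlim (\<lambda>n. \<Sum>k<n. \<alpha> k) at_top sequentially"
    and \<alpha>_square_summable: "summable (\<lambda>k. (\<alpha> k)\<^sup>2)"
begin

text \<open>A function of the initial point and of the whole sample sequence, so that the samples
  can be frozen while the initial point varies.\<close>

primrec orbit :: "nat \<Rightarrow> real ^ 'n \<Rightarrow> (nat \<Rightarrow> 's) \<Rightarrow> real ^ 'n" where
  "orbit 0 y s = y"
| "orbit (Suc k) y s = dh_inv (dh (orbit k y s) - \<alpha> k *\<^sub>R lg (orbit k y s) (s k))"

lemma orbit_in_X: "y \<in> X \<Longrightarrow> orbit k y s \<in> X"
  by (cases k) auto

lemma \<alpha>_L: "0 \<le> \<alpha> k" "\<alpha> k * L < 1"
  using \<alpha>[of k] L_pos by (auto simp: pos_less_divide_eq)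

text \<open>\<open>N\<close> is generalised in the induction: undoing the last step replaces it by
  the dual image of its preimage, which is again a null set.\<close>

lemma negligible_orbit_preimage:
  assumes s: "\<And>k. s k \<in> space S"
  shows "negligible N \<Longrightarrow> negligible {y \<in> X. dh (orbit k y s) \<in> N}"
proof (induction k arbitrary: N)
  case 0
  \<comment> \<open>With step size 0 the step map is \<open>dh\<close> itself.\<close>
  then show ?case using negligible_step_preimage[of N "s 0" 0] s by simp
next
  case (Suc k)
  define N' where "N' = {y \<in> X. dh y - \<alpha> k *\<^sub>R lg y (s k) \<in> N}"
  have "negligible N'"
    unfolding N'_def by (rule negligible_step_preimage[OF Suc.prems s \<alpha>_L])
  then have "negligible (dh ` N')" by (rule negligible_dh_image) (auto simp: N'_def)
  from Suc.IH[OF this] show ?case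
    by (rule negligible_subset) (auto simp: N'_def orbit_in_X)
qed

lemma \<alpha>_tendsto_0: "\<alpha> \<longlonglongrightarrow> 0"
proof -
  have "(\<lambda>k. sqrt ((\<alpha> k)\<^sup>2)) \<longlonglongrightarrow> sqrt 0"
    by (intro tendsto_real_sqrt summable_LIMSEQ_zero \<alpha>_square_summable)
  moreover have "sqrt ((\<alpha> k)\<^sup>2) = \<alpha> k" for k using \<alpha>_L(1)[of k] by simp
  ultimately show ?thesis by simp
qed

lemma \<alpha>_shift_diverges: "filterlim (\<lambda>n. \<Sum>k<n. \<alpha> (K + k)) at_top sequentially"
proof -
  have "(\<Sum>k<n. \<alpha> (K + k)) = - (\<Sum>k<K. \<alpha> k) + (\<Sum>k<n + K. \<alpha> k)" for n
  proof -
    have split: "{..<n + K} = {..<K} \<union> {K..<K + n}" by auto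
    have "(\<Sum>k<n + K. \<alpha> k) = (\<Sum>k<K. \<alpha> k) + (\<Sum>k\<in>{K..<K + n}. \<alpha> k)"
      unfolding split by (rule sum.union_disjoint) auto
    also have "(\<Sum>k\<in>{K..<K + n}. \<alpha> k) = (\<Sum>k<n. \<alpha> (K + k))"
      using sum.shift_bounds_nat_ivl[of \<alpha> 0 K n] by (simp add: add.commute atLeast0LessThan)
    finally show ?thesis by simp
  qed
  moreover have "filterlim (\<lambda>n. (\<Sum>k<n + K. \<alpha> k)) at_top sequentially"
    using filterlim_compose[OF \<alpha>_diverges filterlim_add_const_nat_at_top] .
  then have "filterlim (\<lambda>n. - (\<Sum>k<K. \<alpha> k) + (\<Sum>k<n + K. \<alpha> k)) at_top sequentially"
    by (rule filterlim_tendsto_add_at_top[OF tendsto_const])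
  ultimately show ?thesis by simp
qed

text \<open>Two orbits that stay near the saddle have a dual difference outside the unstable cone, so at each
  time the dual positions of such orbits meet each line in an unstable direction at most once.\<close>

lemma negligible_saddle_neighbourhood:
  assumes c: "c \<in> X" and F: "\<And>u v. u \<bullet> (F *v v) = v \<bullet> (F *v u)" and neg: "p0 \<bullet> (F *v p0) < 0"
  obtains r where "r > 0"
    "\<And>s. (\<And>k. s k \<in> space S) \<Longrightarrow> convergent (\<lambda>n. \<Sum>k<n. \<alpha> k *\<^sub>R (lh c (s k) - F)) \<Longrightarrow>
       negligible {y \<in> X. \<exists>K. \<forall>k\<ge>K. orbit k y s \<in> cball c r}"
proof -
  define H where "H = Hh c"
  have H: "pos_def H" using Hh_pos_def[OF c] by (simp add: H_def)
  obtain P where P: "\<And>v. P *v (H *v v) = v" "\<And>v. H *v (P *v v) = v"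
    "\<And>u v. u \<bullet> (P *v v) = v \<bullet> (P *v u)" "\<And>v. v \<noteq> 0 \<Longrightarrow> 0 < v \<bullet> (P *v v)"
    by (rule pos_def_inverse[OF H]) blast
  obtain C \<delta> m v0 where C: "\<And>u v. u \<bullet> (C *v v) = v \<bullet> (C *v u)" "\<delta> > 0" "m > 0"
    "v0 \<bullet> (C *v v0) < 0"
    "\<And>u. m * (norm u)\<^sup>2 \<le> (C *v u) \<bullet> ((F ** P) *v u) + \<delta> * (u \<bullet> (C *v u))"
  proof (rule unstable_quadratic_form[OF F H P neg])
    fix C \<delta> m v0
    assume "\<And>u v. u \<bullet> (C *v v) = v \<bullet> (C *v u)" "\<delta> > 0" "m > 0" "v0 \<bullet> (C *v v0) < 0"
      "\<And>u. m * (norm u)\<^sup>2 \<le> (C *v u) \<bullet> ((F ** P) *v u) + \<delta> * (u \<bullet> (C *v u))"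
    then show thesis by (rule that)
  qed
  obtain B where B: "B \<ge> 0" "\<And>s v. s \<in> space S \<Longrightarrow> norm (lh c s *v v) \<le> B * norm v"
    by (rule lh_bound[OF c]) blast
  define p where "p = norm P + 1"
  have p: "p \<ge> 1" and Pb: "norm (P *v v) \<le> p * norm v" for v
    using norm_matrix_vector_le[of P v] by (auto simp: p_def algebra_simps intro: order_trans)
  define b where "b = (B + norm F) * p"
  have b: "b \<ge> 0" using B p by (simp add: b_def)
  note bounded_imp_nonpos = unstable_form_nonpos_of_bounded[OF C(1-3) b C(5)]
  obtain \<epsilon> where \<epsilon>: "\<epsilon> > 0" "\<epsilon> \<le> 1/2"
    "\<And>a w M T e R. \<lbrakk>\<And>k. 0 < a k \<and> a k \<le> \<epsilon>; filterlim (\<lambda>n. \<Sum>k<n. a k) at_top sequentially;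
      \<And>k. T k - T (Suc k) = a k *\<^sub>R M k; \<And>k v. norm (T k *v v) \<le> \<epsilon> * norm v;
      \<And>k v. norm (M k *v v) \<le> b * norm v;
      \<And>k. norm (e k) \<le> \<epsilon> * norm (w k);
      \<And>k. w (Suc k) = w k - a k *\<^sub>R ((F ** P) *v w k + M k *v w k + e k);
      \<And>k. norm (w k) \<le> R\<rbrakk>
      \<Longrightarrow> 0 \<le> (w (0::nat) - T 0 *v w 0) \<bullet> (C *v (w 0 - T 0 *v w 0))"
    using bounded_imp_nonpos by blast
  \<comment> \<open>\<open>\<epsilon>1\<close> is for the linearisation of \<open>dh\<close>: its
    first bound yields \<open>norm d \<le> 2 * p * norm w\<close>, its second keeps the resulting
    error below \<open>\<epsilon> / 2 * norm w\<close>. \<open>\<epsilon>2\<close> leaves the other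
    half to the loss gradient, after the same factor \<open>2 * p\<close>.\<close>
  define \<epsilon>1 \<epsilon>2 where "\<epsilon>1 = min (1 / (2 * p)) (\<epsilon> / (4 * (B + 1) * p\<^sup>2))" and "\<epsilon>2 = \<epsilon> / (4 * p)"
  have \<epsilon>12: "\<epsilon>1 > 0" "\<epsilon>2 > 0" "p * \<epsilon>1 \<le> 1/2" "(B + 1) * p\<^sup>2 * \<epsilon>1 \<le> \<epsilon> / 4" "\<epsilon>2 * p = \<epsilon> / 4"
  proof -
    have pos: "4 * (B + 1) * p\<^sup>2 > 0" using B p by simp
    then show "\<epsilon>1 > 0" "\<epsilon>2 > 0" using \<epsilon>(1) p by (auto simp: \<epsilon>1_def \<epsilon>2_def)
    have "\<epsilon>1 \<le> 1 / (2 * p)" by (simp add: \<epsilon>1_def)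
    then show "p * \<epsilon>1 \<le> 1/2" using p by (simp add: pos_le_divide_eq mult_ac)
    have "\<epsilon>1 \<le> \<epsilon> / (4 * (B + 1) * p\<^sup>2)" by (simp add: \<epsilon>1_def)
    then show "(B + 1) * p\<^sup>2 * \<epsilon>1 \<le> \<epsilon> / 4" using pos by (simp add: pos_le_divide_eq algebra_simps)
    show "\<epsilon>2 * p = \<epsilon> / 4" using p by (simp add: \<epsilon>2_def)
  qed
  obtain r1 where r1: "r1 > 0" "cball c r1 \<subseteq> X"
    "\<And>x y. x \<in> cball c r1 \<Longrightarrow> y \<in> cball c r1 \<Longrightarrow> norm (dh y - dh x - H *v (y - x)) \<le> \<epsilon>1 * norm (y - x)"
    unfolding H_def by (rule dh_local_linear[OF c \<epsilon>12(1)]) blast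
  obtain r2 where r2: "r2 > 0" "cball c r2 \<subseteq> X"
    "\<And>x y s. x \<in> cball c r2 \<Longrightarrow> y \<in> cball c r2 \<Longrightarrow> s \<in> space S \<Longrightarrow>
       norm (lg y s - lg x s - lh c s *v (y - x)) \<le> \<epsilon>2 * norm (y - x)"
    by (rule lg_local_linear[OF c \<epsilon>12(2)]) blast
  define r where "r = min r1 r2"
  have r: "r > 0" "cball c r \<subseteq> cball c r1" "cball c r \<subseteq> cball c r2" "cball c r \<subseteq> X"
    using r1(1) r2(1) r1(2) by (auto simp: r_def)
  have err: "norm (lg y s - lg x s - lh c s *v (P *v (dh y - dh x))) \<le> \<epsilon> * norm (dh y - dh x)"
    if xy: "x \<in> cball c r" "y \<in> cball c r" and s: "s \<in> space S" for x y s
  proof -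
    define w d where "w = dh y - dh x" and "d = y - x"
    \<comment> \<open>Translates primal differences into dual ones: \<open>H *v d\<close> is close
      to \<open>w\<close>, hence \<open>d\<close> is close to \<open>P *v w\<close>.\<close>
    have "P *v (w - H *v d) = P *v w - d" by (simp add: matrix_vector_mult_diff_distrib P)
    then have "norm (P *v w - d) \<le> p * norm (w - H *v d)" using Pb[of "w - H *v d"] by simp
    also have "\<dots> \<le> p * (\<epsilon>1 * norm d)"
    proof (rule mult_left_mono)
      show "norm (w - H *v d) \<le> \<epsilon>1 * norm d"
        unfolding w_def d_def using xy r(2) by (intro r1(3)) blast+
    qed (use p in simp)
    finally have 1: "norm (P *v w - d) \<le> p * \<epsilon>1 * norm d" by simp
    also have "\<dots> \<le> 1/2 * norm d" by (intro mult_right_mono \<epsilon>12) auto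
    finally have "norm d \<le> norm (P *v w) + 1/2 * norm d"
      using norm_triangle_ineq2[of d "P *v w"] by (simp add: norm_minus_commute)
    then have dw: "norm d \<le> 2 * p * norm w" using Pb[of w] by linarith
    have "norm (lh c s *v (d - P *v w)) \<le> B * (p * \<epsilon>1 * norm d)"
      using 1 by (intro order_trans[OF B(2)[OF s] mult_left_mono[OF _ B(1)]]) (simp add: norm_minus_commute)
    also have "\<dots> \<le> B * (p * \<epsilon>1 * (2 * p * norm w))"
      using dw B(1) p \<epsilon>12(1) by (intro mult_left_mono) auto
    also have "\<dots> = 2 * (B * p\<^sup>2 * \<epsilon>1) * norm w" by (simp add: power2_eq_square)
    also have "\<dots> \<le> 2 * (\<epsilon> / 4) * norm w"
    proof -
      have "B * p\<^sup>2 * \<epsilon>1 \<le> (B + 1) * p\<^sup>2 * \<epsilon>1" using \<epsilon>12(1) by (simp add: mult_right_mono)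
      then show ?thesis using \<epsilon>12(4) by (intro mult_right_mono mult_left_mono) auto
    qed
    finally have 2: "norm (lh c s *v (d - P *v w)) \<le> \<epsilon> / 2 * norm w" by simp
    have "norm (lg y s - lg x s - lh c s *v d) \<le> \<epsilon>2 * norm d"
      unfolding d_def using xy r(3) by (intro r2(3) s) blast+
    also have "\<dots> \<le> \<epsilon>2 * (2 * p * norm w)" using dw \<epsilon>12(2) by simp
    also have "\<dots> = \<epsilon> / 2 * norm w" using \<epsilon>12(5) by simp
    finally have 3: "norm (lg y s - lg x s - lh c s *v d) \<le> \<epsilon> / 2 * norm w" .
    have eq: "lg y s - lg x s - lh c s *v (P *v w) = (lg y s - lg x s - lh c s *v d) + lh c s *v (d - P *v w)"
      by (simp add: matrix_vector_mult_diff_distrib)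
    have "norm (lg y s - lg x s - lh c s *v (P *v w)) \<le> \<epsilon> / 2 * norm w + \<epsilon> / 2 * norm w"
      unfolding eq by (rule norm_triangle_le[OF add_mono[OF 3 2]])
    then show ?thesis by (simp add: w_def)
  qed
  obtain R where R: "\<And>x. x \<in> cball c r \<Longrightarrow> norm (dh x) \<le> R"
  proof -
    have "compact (dh ` cball c r)"
      using r(4) by (intro compact_continuous_image continuous_on_subset[OF dh_continuous] compact_cball)
    then have "bounded (dh ` cball c r)" by (rule compact_imp_bounded)
    then show ?thesis using that unfolding bounded_iff by blast
  qed
  show ?thesis
  proof (rule that[OF r(1)])
    fix s :: "nat \<Rightarrow> 's"
    assume s: "\<And>k. s k \<in> space S" and conv: "convergent (\<lambda>n. \<Sum>k<n. \<alpha> k *\<^sub>R (lh c (s k) - F))"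
    define D where "D n = (\<Sum>k<n. \<alpha> k *\<^sub>R (lh c (s k) - F))" for n
    obtain l where l: "D \<longlonglongrightarrow> l" using conv unfolding convergent_def D_def[abs_def] by blast
    \<comment> \<open>The tail of the noise series, acting on dual differences through
      \<open>P\<close>. It tends to zero, while the single deviations \<open>M k\<close> are only
      bounded.\<close>
    define T where "T k = (l - D k) ** P" for k
    define M where "M k = (lh c (s k) - F) ** P" for k
    have "\<forall>\<^sub>F k in sequentially. \<alpha> k < \<epsilon> \<and> norm (D k - l) < \<epsilon> / p"
    proof (rule eventually_conj)
      show "\<forall>\<^sub>F k in sequentially. \<alpha> k < \<epsilon>" using order_tendstoD(2)[OF \<alpha>_tendsto_0 \<epsilon>(1)] .
      show "\<forall>\<^sub>F k in sequentially. norm (D k - l) < \<epsilon> / p"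
        using tendstoD[OF l, of "\<epsilon> / p"] \<epsilon>(1) p by (simp add: dist_norm)
    qed
    \<comment> \<open>\<open>K0\<close> depends on the sample sequence, since it waits for the tails
      of that sequence to become small.\<close>
    then obtain K0 where K0: "\<And>k. k \<ge> K0 \<Longrightarrow> \<alpha> k < \<epsilon>" "\<And>k. k \<ge> K0 \<Longrightarrow> norm (D k - l) < \<epsilon> / p"
      unfolding eventually_sequentially by blast
    have Tb: "norm (T k *v v) \<le> \<epsilon> * norm v" if "k \<ge> K0" for k v
    proof -
      have "norm (T k *v v) \<le> norm (l - D k) * norm (P *v v)"
        unfolding T_def by (simp add: norm_matrix_vector_le flip: matrix_vector_mul_assoc)
      also have "\<dots> \<le> (\<epsilon> / p) * (p * norm v)"
        using K0(2)[OF that] Pb \<epsilon>(1) p by (intro mult_mono) (auto simp: norm_minus_commute)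
      finally show ?thesis using p by simp
    qed
    have T': "T k - T (Suc k) = \<alpha> k *\<^sub>R M k" for k
    proof -
      have "T k - T (Suc k) = (D (Suc k) - D k) ** P"
        unfolding T_def matrix_matrix_mult_def by (simp add: vec_eq_iff algebra_simps sum_subtractf)
      also have "\<dots> = \<alpha> k *\<^sub>R M k"
        unfolding M_def D_def matrix_matrix_mult_def by (simp add: vec_eq_iff sum_distrib_left mult.assoc)
      finally show ?thesis .
    qed
    have Mb: "norm (M k *v v) \<le> b * norm v" for k v
    proof -
      have "norm (M k *v v) = norm (lh c (s k) *v (P *v v) - F *v (P *v v))"
        unfolding M_def by (simp add: matrix_vector_mult_diff_rdistrib flip: matrix_vector_mul_assoc)
      also have "\<dots> \<le> norm (lh c (s k) *v (P *v v)) + norm (F *v (P *v v))" by (rule norm_triangle_ineq4)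
      also have "\<dots> \<le> B * norm (P *v v) + norm F * norm (P *v v)"
        by (intro add_mono B(2) s norm_matrix_vector_le)
      also have "\<dots> = (B + norm F) * norm (P *v v)" by (simp add: algebra_simps)
      also have "\<dots> \<le> (B + norm F) * (p * norm v)" using B(1) by (intro mult_left_mono Pb) simp
      finally show ?thesis by (simp add: b_def mult.assoc)
    qed
    define U where "U K = {y \<in> X. \<forall>k\<ge>K. orbit k y s \<in> cball c r}" for K
    have "negligible (U K)" if K: "K \<ge> K0" for K
    proof -
      define Z where "Z = (\<lambda>y. dh (orbit K y s)) ` U K"
      define q where "q z = - ((z - T K *v z) \<bullet> (C *v (z - T K *v z)))" for z
      have "negligible Z"
      proof -
        have linT: "linear (\<lambda>z. z - T K *v z)"
          by (intro linear_compose_sub linear_ident matrix_vector_mul_linear)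
        \<comment> \<open>\<open>T K\<close> is a contraction, so \<open>v0\<close> has a preimage
          \<open>v\<close> under \<open>z - T K *v z\<close>; this is the direction in which no two
          points of \<open>Z\<close> can differ.\<close>
        have "inj (\<lambda>z. z - T K *v z)"
        proof (rule linear_injective_0[OF linT, THEN iffD2], intro allI impI)
          fix z assume "z - T K *v z = 0"
          then have "norm z \<le> \<epsilon> * norm z" using Tb[OF K, of z] by simp
          also have "\<dots> \<le> 1/2 * norm z" using \<epsilon>(2) by (intro mult_right_mono) auto
          finally show "z = 0" by simp
        qed
        then have "surj (\<lambda>z. z - T K *v z)" using linT linear_injective_imp_surjective by blast
        then obtain v where v: "v0 = v - T K *v v" unfolding surj_def by blast
        show ?thesis
        proof (rule negligible_no_differences_in_cone[of Z q v])
          show "bounded Z"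
            unfolding bounded_iff Z_def using R by (auto simp: U_def)
          show "continuous_on UNIV q" unfolding q_def
            by (intro continuous_intros linear_continuous_on bounded_linear_compose[OF matrix_vector_mul_bounded_linear]
                bounded_linear_sub bounded_linear_ident matrix_vector_mul_bounded_linear)
          show "q (t *\<^sub>R v) > 0" if "t \<noteq> 0" for t
          proof -
            have "t *\<^sub>R v - T K *v (t *\<^sub>R v) = t *\<^sub>R v0"
              by (simp add: v matrix_vector_mult_scaleR scaleR_diff_right)
            then have "q (t *\<^sub>R v) = t\<^sup>2 * (- (v0 \<bullet> (C *v v0)))"
              by (simp add: q_def matrix_vector_mult_scaleR power2_eq_square)
            then show ?thesis using that C(4) by (simp add: mult_pos_neg)
          qed
          fix z z' assume "z \<in> Z" "z' \<in> Z"
          then obtain y y' where y: "y \<in> U K" "z = dh (orbit K y s)" and y': "y' \<in> U K" "z' = dh (orbit K y' s)"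
            unfolding Z_def by blast
          define a where "a k = \<alpha> (K + k)" for k
          define w where "w k = dh (orbit (K + k) y s) - dh (orbit (K + k) y' s)" for k
          define e where "e k = lg (orbit (K + k) y s) (s (K + k)) - lg (orbit (K + k) y' s) (s (K + k))
             - lh c (s (K + k)) *v (P *v w k)" for k
          have in_ball: "orbit (K + k) y s \<in> cball c r" "orbit (K + k) y' s \<in> cball c r" for k
            using y(1) y'(1) unfolding U_def by auto
          \<comment> \<open>The recursion is restarted at time \<open>K\<close>, from which on both
            orbits stay in the ball.\<close>
          have "0 \<le> (w 0 - T (K + 0) *v w 0) \<bullet> (C *v (w 0 - T (K + 0) *v w 0))"
          proof (rule \<epsilon>(3)[of a "\<lambda>k. T (K + k)" "\<lambda>k. M (K + k)" e w "R + R"])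
            show "0 < a k \<and> a k \<le> \<epsilon>" for k
              using \<alpha>[of "K + k"] K0(1)[of "K + k"] K by (simp add: a_def less_imp_le)
            show "filterlim (\<lambda>n. sum a {..<n}) at_top sequentially"
              unfolding a_def by (rule \<alpha>_shift_diverges)
            show "T (K + k) - T (K + Suc k) = a k *\<^sub>R M (K + k)" for k
              using T'[of "K + k"] by (simp add: a_def)
            show "norm (T (K + k) *v v) \<le> \<epsilon> * norm v" for k v using K by (intro Tb) simp
            show "norm (M (K + k) *v v) \<le> b * norm v" for k v by (rule Mb)
            show "norm (e k) \<le> \<epsilon> * norm (w k)" for k
              unfolding e_def w_def by (rule err[OF in_ball(2,1) s])
            show "norm (w k) \<le> R + R" for k
              unfolding w_def by (rule order_trans[OF norm_triangle_ineq4 add_mono]) (auto intro!: R simp del: mem_cball simp: in_ball)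
            have "(F ** P) *v u + M k *v u = lh c (s k) *v (P *v u)" for k u
              unfolding M_def by (simp add: matrix_vector_mult_diff_rdistrib flip: matrix_vector_mul_assoc)
            then have eq: "(F ** P) *v w k + M (K + k) *v w k + e k =
               lg (orbit (K + k) y s) (s (K + k)) - lg (orbit (K + k) y' s) (s (K + k))" for k
              by (simp add: e_def)
            show "w (Suc k) = w k - a k *\<^sub>R ((F ** P) *v w k + M (K + k) *v w k + e k)" for k
              unfolding eq by (simp add: w_def a_def scaleR_diff_right)
          qed
          then show "q (z - z') \<le> 0" by (simp add: q_def w_def y y')
        qed
      qed
      from negligible_orbit_preimage[where s = s, OF s this, of K] show ?thesis
        by (rule negligible_subset) (auto simp: U_def Z_def)
    qed
    \<comment> \<open>An orbit that stays in the ball from time \<open>K\<close> on also does so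
      from \<open>K0 + K\<close> on, which covers the times before \<open>K0\<close>.\<close>
    then have "negligible (\<Union>K. U (K0 + K))" by (intro negligible_countable_Union) auto
    then show "negligible {y \<in> X. \<exists>K. \<forall>k\<ge>K. orbit k y s \<in> cball c r}"
    proof (rule negligible_subset)
      show "{y \<in> X. \<exists>K. \<forall>k\<ge>K. orbit k y s \<in> cball c r} \<subseteq> (\<Union>K. U (K0 + K))"
      proof
        fix y assume "y \<in> {y \<in> X. \<exists>K. \<forall>k\<ge>K. orbit k y s \<in> cball c r}"
        then obtain K where "y \<in> X" "\<forall>k\<ge>K. orbit k y s \<in> cball c r" by blast
        then have "y \<in> U (K0 + K)" unfolding U_def by auto
        then show "y \<in> (\<Union>K. U (K0 + K))" by blast
      qed
    qed
  qed
qed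

end

section \<open>Almost sure convergence of weighted series\<close>

text \<open>\<open>y powr a * exp (- y)\<close> is bounded; this trades exponentially small
  probabilities for a power of the tail of the squared step sizes.\<close>

lemma powr_le_exp:
  fixes a y :: real
  assumes "a > 0" "y > 0"
  shows "y powr a \<le> a powr a * exp y"
proof -
  have "ln (y / a) \<le> y / a - 1" using assms by (intro ln_le_minus_one) simp
  then have "a * ln (y / a) \<le> a * (y / a - 1)" using assms by (intro mult_left_mono) auto
  then have "a * ln y \<le> a * ln a + y"
    using assms by (simp add: ln_div algebra_simps)
  then have "exp (a * ln y) \<le> exp (a * ln a + y)" by simp
  then show ?thesis using assms by (simp add: powr_def exp_add)
qed

context prob_space
begin

text \<open>\<open>v\<close> may be any bound for the sum of squared weights: inserting the whole
  tail makes the estimate independent of \<open>n\<close>.\<close>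

lemma hoeffding_weighted_sum:
  fixes Y :: "nat \<Rightarrow> 'a \<Rightarrow> real" and \<alpha> :: "nat \<Rightarrow> real"
  assumes indep: "indep_vars (\<lambda>_. borel) Y UNIV"
    and bounded: "\<And>i \<omega>. \<omega> \<in> space M \<Longrightarrow> \<bar>Y i \<omega>\<bar> \<le> C" and mean: "\<And>i. expectation (Y i) = 0"
    and pos: "\<And>i. \<alpha> i > 0" "C > 0" and "\<epsilon> > 0" "m < n"
    and v: "(\<Sum>i\<in>{m..<n}. (\<alpha> i)\<^sup>2) \<le> v"
  shows "prob {\<omega> \<in> space M. \<bar>\<Sum>i\<in>{m..<n}. \<alpha> i * Y i \<omega>\<bar> \<ge> \<epsilon>} \<le> 2 * exp (- (\<epsilon>\<^sup>2 / (2 * C\<^sup>2)) / v)"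
proof -
  define X where "X i \<omega> = \<alpha> i * Y i \<omega>" for i \<omega>
  have "indep_vars (\<lambda>_. borel) Y {m..<n}" by (rule indep_vars_subset[OF indep]) simp
  then have indX: "indep_vars (\<lambda>_. borel) X {m..<n}"
    unfolding X_def by (rule indep_vars_compose2) simp
  have bd: "X i \<omega> \<in> {- (\<alpha> i * C)..\<alpha> i * C}" if "\<omega> \<in> space M" for i \<omega>
  proof -
    have "\<bar>X i \<omega>\<bar> \<le> \<alpha> i * C"
      unfolding X_def abs_mult using bounded[OF that, of i] pos(1)[of i] by (simp add: mult_left_mono)
    then show ?thesis by (simp add: abs_le_iff)
  qed
  define \<mu> where "\<mu> = (\<Sum>i\<in>{m..<n}. expectation (X i))"
  have \<mu>: "\<mu> = 0" by (simp add: \<mu>_def X_def[abs_def] mean)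
  interpret Hoeffding_ineq M "{m..<n}" X "\<lambda>i. - (\<alpha> i * C)" "\<lambda>i. \<alpha> i * C" \<mu>
    using indX bd by unfold_locales (auto simp: \<mu>_def)
  define V where "V = (\<Sum>i\<in>{m..<n}. (\<alpha> i * C - - (\<alpha> i * C))\<^sup>2)"
  have V: "V = 4 * C\<^sup>2 * (\<Sum>i\<in>{m..<n}. (\<alpha> i)\<^sup>2)"
    unfolding V_def sum_distrib_left by (intro sum.cong) (auto simp: power2_eq_square algebra_simps)
  have sq: "(\<Sum>i\<in>{m..<n}. (\<alpha> i)\<^sup>2) > 0"
    using \<open>m < n\<close> pos(1) by (intro sum_pos) (auto simp: less_imp_neq[symmetric])
  then have V0: "V > 0" using pos by (simp add: V)
  have "prob {\<omega> \<in> space M. \<bar>(\<Sum>i\<in>{m..<n}. X i \<omega>) - \<mu>\<bar> \<ge> \<epsilon>} \<le> 2 * exp (- 2 * \<epsilon>\<^sup>2 / V)"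
    unfolding V_def by (rule Hoeffding_ineq_abs_ge) (use \<open>\<epsilon> > 0\<close> V0 V_def in auto)
  also have "\<dots> \<le> 2 * exp (- (\<epsilon>\<^sup>2 / (2 * C\<^sup>2)) / v)"
  proof -
    have "(\<epsilon>\<^sup>2 / (2 * C\<^sup>2)) / v \<le> (\<epsilon>\<^sup>2 / (2 * C\<^sup>2)) / (\<Sum>i\<in>{m..<n}. (\<alpha> i)\<^sup>2)"
      using v sq by (intro divide_left_mono) auto
    also have "\<dots> = 2 * \<epsilon>\<^sup>2 / V" by (simp add: V)
    finally show ?thesis by simp
  qed
  finally show ?thesis by (simp add: X_def \<mu>)
qed

text \<open>A union bound over the left endpoint of \<open>{m..<N}\<close> replaces a maximal inequality, because
  the tail bounds are summable in \<open>m\<close>.\<close>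

lemma AE_convergent_weighted_series:
  fixes Y :: "nat \<Rightarrow> 'a \<Rightarrow> real" and \<alpha> :: "nat \<Rightarrow> real"
  assumes indep: "indep_vars (\<lambda>_. borel) Y UNIV"
    and bounded: "\<And>i \<omega>. \<omega> \<in> space M \<Longrightarrow> \<bar>Y i \<omega>\<bar> \<le> C" and mean: "\<And>i. expectation (Y i) = 0"
    and \<alpha>: "\<And>i. \<alpha> i > 0" "summable (\<lambda>i. (\<alpha> i)\<^sup>2)"
    and a: "a > 0" "summable (\<lambda>k. (\<Sum>i. (\<alpha> (k + 1 + i))\<^sup>2) powr a)"
  shows "AE \<omega> in M. convergent (\<lambda>n. \<Sum>k<n. \<alpha> k * Y k \<omega>)"
proof -
  \<comment> \<open>A strictly positive bound, as \<open>hoeffding_weighted_sum\<close>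
    requires.\<close>
  define D where "D = \<bar>C\<bar> + 1"
  have D: "D > 0" by (simp add: D_def)
  have bounded': "\<bar>Y i \<omega>\<bar> \<le> D" if "\<omega> \<in> space M" for i \<omega>
    using bounded[OF that, of i] by (simp add: D_def)
  have [measurable]: "Y i \<in> borel_measurable M" for i
    using indep unfolding indep_vars_def by blast
  define T where "T n \<omega> = (\<Sum>k<n. \<alpha> k * Y k \<omega>)" for n \<omega>
  have [measurable]: "T n \<in> borel_measurable M" for n unfolding T_def[abs_def] by measurable
  define r where "r m = (\<Sum>i. (\<alpha> (m + i))\<^sup>2)" for m
  have sm: "summable (\<lambda>i. (\<alpha> (m + i))\<^sup>2)" for m
    using summable_ignore_initial_segment[OF \<alpha>(2), of m] by (simp add: add.commute)
  have r0: "r m > 0" for m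
    unfolding r_def using \<alpha>(1) by (intro suminf_pos sm zero_less_power)
  have Tdiff: "T n \<omega> - T m \<omega> = (\<Sum>i\<in>{m..<n}. \<alpha> i * Y i \<omega>)" if "m \<le> n" for m n \<omega>
    using that unfolding T_def by (simp add: sum_diff_nat_ivl[of 0 m n, unfolded atLeast0LessThan, symmetric])
  have osc: "AE \<omega> in M. \<exists>K. \<forall>m\<ge>K. \<forall>m'\<ge>K. \<bar>T m \<omega> - T m' \<omega>\<bar> < 2 * \<epsilon>" if \<epsilon>: "\<epsilon> > 0" for \<epsilon>
  proof -
    define c where "c = \<epsilon>\<^sup>2 / (2 * D\<^sup>2)"
    have c: "c > 0" using \<epsilon> D by (simp add: c_def)
    define p where "p m = 2 * exp (- c / r m)" for m
    have p: "prob {\<omega> \<in> space M. \<bar>T n \<omega> - T m \<omega>\<bar> \<ge> \<epsilon>} \<le> p m" if "m \<le> n" for m n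
    proof (cases "m = n")
      case True
      then show ?thesis using \<epsilon> by (simp add: p_def)
    next
      case False
      have "(\<Sum>i\<in>{m..<n}. (\<alpha> i)\<^sup>2) = (\<Sum>i<n - m. (\<alpha> (m + i))\<^sup>2)"
        using sum.shift_bounds_nat_ivl[of "\<lambda>i. (\<alpha> i)\<^sup>2" 0 m "n - m"] that
        by (simp add: add.commute atLeast0LessThan)
      also have "\<dots> \<le> r m" unfolding r_def by (rule sum_le_suminf[OF sm]) auto
      finally show ?thesis
        unfolding p_def c_def Tdiff[OF that]
        using False that \<epsilon> D \<alpha>(1) by (intro hoeffding_weighted_sum indep bounded' mean) auto
    qed
    \<comment> \<open>The assumption on the tails starts at index 1; one extra term does not affect
      summability.\<close>
    have "summable (\<lambda>k. p (k + 1))"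
    proof (rule summable_comparison_test')
      show "summable (\<lambda>k. 2 * ((a / c) powr a * r (k + 1) powr a))"
        using a(2) unfolding r_def by (intro summable_mult)
      fix k :: nat
      \<comment> \<open>The exponential estimate at \<open>y = c / r (k + 1)\<close>: it dominates
        \<open>p\<close> by a multiple of \<open>r powr a\<close>.\<close>
      have "(c / r (k + 1)) powr a \<le> a powr a * exp (c / r (k + 1))"
        using c r0 a(1) by (intro powr_le_exp) auto
      then have "c powr a * exp (- c / r (k + 1)) \<le> a powr a * r (k + 1) powr a"
        using c r0[of "k + 1"] by (simp add: powr_divide exp_minus field_simps)
      then have "exp (- c / r (k + 1)) \<le> (a / c) powr a * r (k + 1) powr a"
        using c a(1) by (simp add: powr_divide field_simps)
      then show "norm (p (k + 1)) \<le> 2 * ((a / c) powr a * r (k + 1) powr a)"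
        by (simp add: p_def)
    qed
    then have psum: "summable p" by (subst (asm) summable_iff_shift)
    have psumK: "summable (\<lambda>i. p (i + K))" for K using psum by (subst summable_iff_shift)
    have p0: "p m \<ge> 0" for m by (simp add: p_def)
    define t where "t K = (\<Sum>i. p (i + K))" for K
    have t0: "t \<longlonglongrightarrow> 0"
      unfolding t_def using suminf_exist_split2[OF psum] .
    define A where "A K N = {\<omega> \<in> space M. \<exists>m\<in>{K..N}. \<exists>m'\<in>{K..N}. \<bar>T m \<omega> - T m' \<omega>\<bar> \<ge> 2 * \<epsilon>}" for K N
    have [measurable]: "A K N \<in> sets M" for K N unfolding A_def by measurable
    have PA: "prob (A K N) \<le> t K" for K N
    proof -
      \<comment> \<open>Two partial sums that are \<open>2 * \<epsilon>\<close> apart cannot both be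
        closer than \<open>\<epsilon>\<close> to the last one, \<open>T N\<close>.\<close>
      have "A K N \<subseteq> (\<Union>m\<in>{K..N}. {\<omega> \<in> space M. \<bar>T N \<omega> - T m \<omega>\<bar> \<ge> \<epsilon>})"
      proof
        fix \<omega> assume "\<omega> \<in> A K N"
        then obtain m m' where m: "\<omega> \<in> space M" "m \<in> {K..N}" "m' \<in> {K..N}" "\<bar>T m \<omega> - T m' \<omega>\<bar> \<ge> 2 * \<epsilon>"
          unfolding A_def by blast
        then have "\<bar>T N \<omega> - T m \<omega>\<bar> \<ge> \<epsilon> \<or> \<bar>T N \<omega> - T m' \<omega>\<bar> \<ge> \<epsilon>" by linarith
        then show "\<omega> \<in> (\<Union>m\<in>{K..N}. {\<omega> \<in> space M. \<bar>T N \<omega> - T m \<omega>\<bar> \<ge> \<epsilon>})" using m by blast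
      qed
      then have "prob (A K N) \<le> prob (\<Union>m\<in>{K..N}. {\<omega> \<in> space M. \<bar>T N \<omega> - T m \<omega>\<bar> \<ge> \<epsilon>})"
        by (intro finite_measure_mono) auto
      also have "\<dots> \<le> (\<Sum>m\<in>{K..N}. prob {\<omega> \<in> space M. \<bar>T N \<omega> - T m \<omega>\<bar> \<ge> \<epsilon>})"
        by (intro finite_measure_subadditive_finite) auto
      also have "\<dots> \<le> (\<Sum>m\<in>{K..N}. p m)" by (intro sum_mono p) auto
      also have "\<dots> \<le> t K"
      proof (cases "K \<le> N")
        case True
        have "(\<Sum>m\<in>{K..N}. p m) = (\<Sum>i<Suc N - K. p (i + K))"
          using sum.shift_bounds_nat_ivl[of p 0 K "Suc N - K"] True
          by (simp add: atLeast0LessThan atLeastLessThanSuc_atLeastAtMost)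
        also have "\<dots> \<le> t K"
          unfolding t_def by (rule sum_le_suminf[OF psumK]) (auto simp: p0)
        finally show ?thesis .
      next
        case False
        then show ?thesis
          unfolding t_def by (simp add: suminf_nonneg[OF psumK] p0)
      qed
      finally show ?thesis .
    qed
    define B where "B K = (\<Union>N. A K N)" for K
    have [measurable]: "B K \<in> sets M" for K unfolding B_def by measurable
    have PB: "prob (B K) \<le> t K" for K
    proof (rule LIMSEQ_le_const2)
      show "(\<lambda>N. prob (A K N)) \<longlonglongrightarrow> prob (B K)"
        unfolding B_def
        by (intro finite_Lim_measure_incseq) (fastforce simp: incseq_def A_def)+
    qed (use PA in blast)
    have "prob (\<Inter>K. B K) \<le> 0"
    proof (rule LIMSEQ_le_const[OF t0])
      have "prob (\<Inter>K. B K) \<le> t K" for K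
        using finite_measure_mono[of "\<Inter>K. B K" "B K"] PB[of K] by fastforce
      then show "\<exists>N. \<forall>n\<ge>N. prob (\<Inter>K. B K) \<le> t n" by blast
    qed
    then have "prob (\<Inter>K. B K) = 0" by (simp add: measure_le_0_iff)
    then have "AE \<omega> in M. \<omega> \<notin> (\<Inter>K. B K)"
      by (intro AE_not_in) (simp add: null_sets_def emeasure_eq_measure)
    with AE_space show ?thesis
    proof eventually_elim
      case (elim \<omega>)
      from elim(2) obtain K where K: "\<omega> \<notin> B K" by blast
      show ?case
      proof (intro exI allI impI)
        fix m m' assume mm: "m \<ge> K" "m' \<ge> K"
        show "\<bar>T m \<omega> - T m' \<omega>\<bar> < 2 * \<epsilon>"
        proof (rule ccontr)
          assume "\<not> ?thesis"
          then have "\<omega> \<in> A K (max m m')" using mm elim(1) unfolding A_def by force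
          then show False using K unfolding B_def by blast
        qed
      qed
    qed
  qed
  have "AE \<omega> in M. \<forall>j. \<exists>K. \<forall>m\<ge>K. \<forall>m'\<ge>K. \<bar>T m \<omega> - T m' \<omega>\<bar> < 2 * (1 / real (Suc j))"
    unfolding AE_all_countable by (intro allI osc) simp
  then show ?thesis
  proof eventually_elim
    case (elim \<omega>)
    have "Cauchy (\<lambda>n. T n \<omega>)"
      unfolding Cauchy_def dist_real_def
    proof (intro allI impI)
      fix e :: real assume "e > 0"
      then obtain j where j: "inverse (real (Suc j)) < e / 2" using reals_Archimedean[of "e / 2"] by auto
      obtain K where "\<forall>m\<ge>K. \<forall>m'\<ge>K. \<bar>T m \<omega> - T m' \<omega>\<bar> < 2 * (1 / real (Suc j))" using elim by blast
      moreover have "2 * (1 / real (Suc j)) < e" using j by (simp add: inverse_eq_divide)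
      ultimately show "\<exists>K. \<forall>m\<ge>K. \<forall>n\<ge>K. \<bar>T m \<omega> - T n \<omega>\<bar> < e" by (meson less_trans)
    qed
    then show ?case unfolding T_def by (rule Cauchy_convergent)
  qed
qed

end

lemma convergent_matrixI:
  fixes X :: "nat \<Rightarrow> real ^ 'n ^ 'm"
  assumes "\<And>i j. convergent (\<lambda>n. X n $ i $ j)"
  shows "convergent X"
proof -
  obtain l where "\<And>i j. (\<lambda>n. X n $ i $ j) \<longlonglongrightarrow> l i j"
    using assms unfolding convergent_def by metis
  then have "X \<longlonglongrightarrow> (\<chi> i j. l i j)"
    by (intro vec_tendstoI) simp
  then show ?thesis unfolding convergent_def by blast
qed

section \<open>Stochastic mirror descent\<close>

text \<open>Completeness turns convergence into the Cauchy property, a countable condition; where it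
  fails, the default value of \<open>lim\<close> is removed by the intersection.\<close>

lemma sets_tendsto_in:
  fixes f :: "nat \<Rightarrow> 'a \<Rightarrow> 'b :: {banach, second_countable_topology}"
  assumes [measurable]: "\<And>k. f k \<in> borel_measurable N" "B \<in> sets borel"
  shows "{p \<in> space N. \<exists>l\<in>B. (\<lambda>k. f k p) \<longlonglongrightarrow> l} \<in> sets N"
proof -
  have "{p \<in> space N. \<exists>l\<in>B. (\<lambda>k. f k p) \<longlonglongrightarrow> l} =
      {p \<in> space N. Cauchy (\<lambda>k. f k p)} \<inter> {p \<in> space N. lim (\<lambda>k. f k p) \<in> B}"
    by (auto simp: Cauchy_convergent_iff convergent_def limI intro: LIMSEQ_imp_Cauchy)
  also have "\<dots> \<in> sets N" by measurable
  finally show ?thesis .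
qed

text \<open>Negligible sets are null for the completed measure, while the density of the dual
  initial point refers to \<open>lborel\<close>; a Borel null superset bridges the two.\<close>

lemma negligible_subset_null_sets_lborel:
  assumes "negligible N"
  obtains N' where "N' \<in> null_sets lborel" "N \<subseteq> N'"
  using assms unfolding negligible_iff_null_sets null_sets_completion_iff2 by blast

text \<open>The tails in \<open>tail_summable\<close> have their intended meaning because
  \<open>mirror_descent\<close> contains square summability: \<open>suminf\<close> of a divergent
  series is an unspecified value.\<close>

locale stochastic_mirror_descent = mirror_descent h S f L \<alpha> + prob_space M
  for h :: "real ^ 'n \<Rightarrow> ereal" and S :: "'s measure" and f :: "real ^ 'n \<Rightarrow> 's \<Rightarrow> real"
    and L :: real and \<alpha> :: "nat \<Rightarrow> real" and M :: "'w measure" +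
  fixes \<xi> :: "nat \<Rightarrow> 'w \<Rightarrow> 's" and q :: real and x :: "nat \<Rightarrow> 'w \<Rightarrow> real ^ 'n"
  assumes q: "q > 2" and sample: "sample_loss M S \<xi> (mirror_domain h) f q"
    and tail_summable: "summable (\<lambda>k. (\<Sum>i. (\<alpha> (k + 1 + i))\<^sup>2) powr (q / 2))"
    and x0_measurable: "x 0 \<in> borel_measurable M"
    and x0_in_X: "\<And>\<omega>. \<omega> \<in> space M \<Longrightarrow> x 0 \<omega> \<in> mirror_domain h"
    and x0_indep: "init_indep M S \<xi> (x 0)"
    and x0_density: "\<exists>\<rho>. distributed M lborel (\<lambda>\<omega>. kernel_grad h (x 0 \<omega>)) \<rho>"
    and step: "\<And>k \<omega>. \<omega> \<in> space M \<Longrightarrow>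
      smd_step h (\<alpha> k) (loss_grad f (x k \<omega>) (\<xi> k \<omega>)) (x k \<omega>) (x (Suc k) \<omega>)"
begin

abbreviation "EF \<equiv> expected_loss S f"
abbreviation "HF \<equiv> hessian EF"
abbreviation "R \<equiv> restrict_space borel X"
abbreviation "PS \<equiv> PiM (UNIV :: nat set) (\<lambda>_. S)"

section \<open>The mean Hessian, and measurability of saddles and orbits\<close>

lemma
  shows \<xi>_indep: "indep_vars (\<lambda>_. S) \<xi> UNIV"
    and \<xi>_measurable [measurable]: "\<xi> k \<in> measurable M S"
    and lg_measurable: "(\<lambda>(y, s). lg y s) \<in> borel_measurable (R \<Otimes>\<^sub>M S)"
    and lh_measurable: "(\<lambda>(y, s). lh y s) \<in> borel_measurable (R \<Otimes>\<^sub>M S)"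
    and EF_twice_differentiable: "twice_differentiable_on EF X"
    and lh_mean: "y \<in> X \<Longrightarrow> has_bochner_integral M (\<lambda>\<omega>. lh y (\<xi> k \<omega>)) (HF y)"
  using sample by (simp_all add: sample_loss_def iid_samples_def)

lemma \<xi>_space: "\<omega> \<in> space M \<Longrightarrow> \<xi> k \<omega> \<in> space S"
  using \<xi>_measurable by (rule measurable_space)

lemma lh_form_mean:
  assumes "y \<in> X"
  shows "has_bochner_integral M (\<lambda>\<omega>. u \<bullet> (lh y (\<xi> k \<omega>) *v v)) (u \<bullet> (HF y *v v))"
proof (rule has_bochner_integral_bounded_linear[OF _ lh_mean[OF assms]])
  have "linear (\<lambda>A :: real ^ 'n ^ 'n. u \<bullet> (A *v v))"
    by (intro linearI) (simp_all add: matrix_vector_mult_add_rdistrib inner_add_right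
        flip: scaleR_matrix_vector_assoc)
  then show "bounded_linear (\<lambda>A :: real ^ 'n ^ 'n. u \<bullet> (A *v v))"
    by (simp add: linear_conv_bounded_linear)
qed

text \<open>Inherited from the sample Hessians, whose mean is \<open>HF y\<close>.\<close>

lemma HF_symmetric:
  assumes y: "y \<in> X"
  shows "u \<bullet> (HF y *v v) = v \<bullet> (HF y *v u)"
proof -
  have "has_bochner_integral M (\<lambda>\<omega>. u \<bullet> (lh y (\<xi> 0 \<omega>) *v v)) (v \<bullet> (HF y *v u))"
    using lh_form_mean[OF y, of v 0 u]
    by (subst has_bochner_integral_cong[OF refl lh_symmetric[OF \<xi>_space y] refl]) auto
  then show ?thesis
    using lh_form_mean[OF y, of u 0 v] has_bochner_integral_eq by blast
qed

text \<open>The expected loss is only twice differentiable. Continuity of its Hessian form comes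
  from the Lipschitz constant of the sample Hessians, which survives the expectation because it is
  uniform in the sample.\<close>

lemma HF_form_continuous: "continuous_on X (\<lambda>y. v \<bullet> (HF y *v v))"
  unfolding continuous_on_iff
proof (intro ballI allI impI)
  fix c and e :: real assume c: "c \<in> X" and e: "e > 0"
  obtain r where r: "r > 0" "cball c r \<subseteq> X" using open_X c open_contains_cball by blast
  obtain K where K: "\<And>y s. y \<in> cball c r \<Longrightarrow> s \<in> space S \<Longrightarrow> opnorm (lh y s - lh c s) \<le> K * norm (y - c)"
    using hess_Lipschitz[OF compact_cball r(2)] r(1) by (metis centre_in_cball less_imp_le)
  define d where "d = min r (e / (\<bar>K\<bar> * (norm v)\<^sup>2 + 1))"
  have pos: "\<bar>K\<bar> * (norm v)\<^sup>2 + 1 > 0" by (simp add: add_nonneg_pos)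
  have d: "d > 0" using r e pos by (simp add: d_def)
  show "\<exists>d>0. \<forall>y\<in>X. dist y c < d \<longrightarrow> dist (v \<bullet> (HF y *v v)) (v \<bullet> (HF c *v v)) < e"
  proof (intro exI[of _ d] conjI ballI impI d)
    fix y assume y: "y \<in> X" and yd: "dist y c < d"
    define \<phi> where "\<phi> \<omega> = v \<bullet> (lh y (\<xi> 0 \<omega>) *v v) - v \<bullet> (lh c (\<xi> 0 \<omega>) *v v)" for \<omega>
    define k where "k = \<bar>K\<bar> * norm (y - c) * (norm v)\<^sup>2"
    have "has_bochner_integral M \<phi> (v \<bullet> (HF y *v v) - v \<bullet> (HF c *v v))"
      unfolding \<phi>_def by (intro has_bochner_integral_diff lh_form_mean y c)
    then have int: "integrable M \<phi>" "expectation \<phi> = v \<bullet> (HF y *v v) - v \<bullet> (HF c *v v)"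
      by (auto simp: has_bochner_integral_iff)
    have bound: "\<bar>\<phi> \<omega>\<bar> \<le> k" if "\<omega> \<in> space M" for \<omega>
    proof -
      have "y \<in> cball c r" using yd by (simp add: d_def dist_commute)
      then have "opnorm (lh y (\<xi> 0 \<omega>) - lh c (\<xi> 0 \<omega>)) \<le> K * norm (y - c)"
        using K \<xi>_space[OF that] by blast
      also have "\<dots> \<le> \<bar>K\<bar> * norm (y - c)" by (intro mult_right_mono) auto
      finally have op: "opnorm (lh y (\<xi> 0 \<omega>) - lh c (\<xi> 0 \<omega>)) \<le> \<bar>K\<bar> * norm (y - c)" .
      have "\<phi> \<omega> = v \<bullet> ((lh y (\<xi> 0 \<omega>) - lh c (\<xi> 0 \<omega>)) *v v)"
        by (simp add: \<phi>_def matrix_vector_mult_diff_rdistrib inner_diff_right)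
      then have "\<bar>\<phi> \<omega>\<bar> \<le> norm v * norm ((lh y (\<xi> 0 \<omega>) - lh c (\<xi> 0 \<omega>)) *v v)"
        using Cauchy_Schwarz_ineq2 by metis
      also have "\<dots> \<le> norm v * (\<bar>K\<bar> * norm (y - c) * norm v)"
        by (intro mult_left_mono order_trans[OF norm_matrix_vector_le_opnorm mult_right_mono[OF op]]) auto
      finally show ?thesis by (simp add: k_def power2_eq_square mult_ac)
    qed
    have "expectation \<phi> \<le> k"
      by (rule integral_le_const[OF int(1)]) (use bound in \<open>auto intro!: AE_I2 simp: abs_le_iff\<close>)
    moreover have "expectation (\<lambda>\<omega>. - \<phi> \<omega>) \<le> k"
      by (rule integral_le_const) (use bound int(1) in \<open>auto intro!: AE_I2 simp: abs_le_iff\<close>)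
    ultimately have "dist (v \<bullet> (HF y *v v)) (v \<bullet> (HF c *v v)) \<le> k"
      using int by (simp add: dist_real_def abs_le_iff)
    also have "k \<le> (\<bar>K\<bar> * (norm v)\<^sup>2) * d"
    proof -
      have "(\<bar>K\<bar> * (norm v)\<^sup>2) * norm (y - c) \<le> (\<bar>K\<bar> * (norm v)\<^sup>2) * d"
        using yd by (intro mult_left_mono) (auto simp: dist_norm)
      then show ?thesis by (simp add: k_def mult_ac)
    qed
    also have "\<dots> < (\<bar>K\<bar> * (norm v)\<^sup>2 + 1) * d" using d by (simp add: algebra_simps)
    also have "\<dots> \<le> e"
    proof -
      have "d \<le> e / (\<bar>K\<bar> * (norm v)\<^sup>2 + 1)" by (simp add: d_def)
      then show ?thesis using pos by (simp add: pos_le_divide_eq mult.commute)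
    qed
    finally show "dist (v \<bullet> (HF y *v v)) (v \<bullet> (HF c *v v)) < e" .
  qed
qed

text \<open>Negative curvature is an open condition, as a union over the directions
  \<open>v\<close>, and a nonzero gradient is another; the saddle set is a difference of two open
  sets.\<close>

lemma strict_saddles_borel: "strict_saddles X EF \<in> sets borel"
proof -
  have cg: "continuous_on X (gradient EF)"
    by (intro continuous_at_imp_continuous_on ballI
        has_derivative_continuous[OF gradient_has_derivative[OF EF_twice_differentiable]])
  have "open (X \<inter> gradient EF -` (- {0}))"
    by (rule continuous_open_preimage[OF cg open_X]) auto
  moreover have "open (X \<inter> (\<lambda>y. v \<bullet> (HF y *v v)) -` {..<0})" for v
    by (rule continuous_open_preimage[OF HF_form_continuous open_X]) auto
  then have "open (\<Union>v. X \<inter> (\<lambda>y. v \<bullet> (HF y *v v)) -` {..<0})" by blast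
  moreover have "strict_saddles X EF =
      (\<Union>v. X \<inter> (\<lambda>y. v \<bullet> (HF y *v v)) -` {..<0}) - (X \<inter> gradient EF -` (- {0}))"
    unfolding strict_saddles_def using lambda_min_neg_iff[OF HF_symmetric] by auto
  ultimately show ?thesis by auto
qed

lemma orbit_measurable: "(\<lambda>(y, s). orbit k y s) \<in> measurable (R \<Otimes>\<^sub>M PS) R"
proof (induction k)
  case 0
  then show ?case by (simp add: case_prod_beta')
next
  case (Suc k)
  have O: "(\<lambda>p. orbit k (fst p) (snd p)) \<in> measurable (R \<Otimes>\<^sub>M PS) R"
    using Suc by (simp add: case_prod_beta')
  have dhm: "dh \<in> borel_measurable R"
    by (rule borel_measurable_continuous_on_restrict[OF dh_continuous])
  have "(\<lambda>p. dh (orbit k (fst p) (snd p))) \<in> borel_measurable (R \<Otimes>\<^sub>M PS)"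
    by (rule measurable_compose[OF O dhm])
  moreover have "(\<lambda>p. (orbit k (fst p) (snd p), snd p k)) \<in> measurable (R \<Otimes>\<^sub>M PS) (R \<Otimes>\<^sub>M S)"
    by (intro measurable_Pair O measurable_compose[OF measurable_snd measurable_component_singleton]) auto
  from measurable_compose[OF this lg_measurable]
  have "(\<lambda>p. lg (orbit k (fst p) (snd p)) (snd p k)) \<in> borel_measurable (R \<Otimes>\<^sub>M PS)" by simp
  ultimately have "(\<lambda>p. dh (orbit k (fst p) (snd p)) - \<alpha> k *\<^sub>R lg (orbit k (fst p) (snd p)) (snd p k))
      \<in> borel_measurable (R \<Otimes>\<^sub>M PS)" by measurable
  from measurable_compose[OF this borel_measurable_continuous_onI[OF dh_inv_continuous]]
  have "(\<lambda>p. orbit (Suc k) (fst p) (snd p)) \<in> borel_measurable (R \<Otimes>\<^sub>M PS)" by simp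
  then show ?case
    by (intro measurable_restrict_space2) (auto simp: case_prod_beta')
qed

text \<open>Convergence is checked entry by entry: each entry of the noise is an independent centred
  sequence, bounded thanks to relative smoothness.\<close>

lemma AE_noise_convergent:
  assumes c: "c \<in> X"
  shows "AE \<omega> in M. convergent (\<lambda>n. \<Sum>k<n. \<alpha> k *\<^sub>R (lh c (\<xi> k \<omega>) - HF c))"
proof -
  obtain B where B: "\<And>s v. s \<in> space S \<Longrightarrow> norm (lh c s *v v) \<le> B * norm v"
    by (rule lh_bound[OF c]) blast
  \<comment> \<open>Entries become values of a bilinear form, for which the norm bound and the mean
    are known.\<close>
  have entry: "A $ i $ j = axis i 1 \<bullet> (A *v axis j 1)" for A :: "real ^ 'n ^ 'n" and i j
    by (simp add: inner_axis' matrix_vector_mult_basis column_def)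
  have lhc: "lh c \<in> borel_measurable S"
    using measurable_compose[OF measurable_Pair[OF measurable_const measurable_ident] lh_measurable, of c] c
    by (simp add: space_restrict_space)
  have "AE \<omega> in M. convergent (\<lambda>n. \<Sum>k<n. \<alpha> k * (lh c (\<xi> k \<omega>) - HF c) $ i $ j)" for i j
  proof (rule AE_convergent_weighted_series)
    have "(\<lambda>A :: real ^ 'n ^ 'n. (A - HF c) $ i $ j) \<in> borel_measurable borel"
      by (intro borel_measurable_continuous_onI continuous_intros)
    from measurable_compose[OF lhc this]
    show "indep_vars (\<lambda>_. borel) (\<lambda>k \<omega>. (lh c (\<xi> k \<omega>) - HF c) $ i $ j) UNIV"
      by (intro indep_vars_compose2[OF \<xi>_indep]) auto
    show "\<bar>(lh c (\<xi> k \<omega>) - HF c) $ i $ j\<bar> \<le> B + \<bar>HF c $ i $ j\<bar>" if "\<omega> \<in> space M" for k \<omega>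
    proof -
      have "\<bar>lh c (\<xi> k \<omega>) $ i $ j\<bar> \<le> norm (lh c (\<xi> k \<omega>) *v axis j 1)"
        using Cauchy_Schwarz_ineq2[of "axis i 1" "lh c (\<xi> k \<omega>) *v axis j 1"] by (simp add: entry)
      also have "\<dots> \<le> B" using B[OF \<xi>_space[OF that], of k "axis j 1"] by simp
      finally show ?thesis by simp
    qed
    show "expectation (\<lambda>\<omega>. (lh c (\<xi> k \<omega>) - HF c) $ i $ j) = 0" for k
    proof -
      have "has_bochner_integral M (\<lambda>\<omega>. lh c (\<xi> k \<omega>) $ i $ j) (HF c $ i $ j)"
        unfolding entry by (rule lh_form_mean[OF c])
      then show ?thesis by (simp add: has_bochner_integral_iff prob_space)
    qed
  qed (use \<alpha> \<alpha>_square_summable q tail_summable in auto)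
  then have "AE \<omega> in M. \<forall>i j. convergent (\<lambda>n. \<Sum>k<n. \<alpha> k * (lh c (\<xi> k \<omega>) - HF c) $ i $ j)"
    by (simp add: AE_all_countable)
  then show ?thesis
  proof eventually_elim
    case (elim \<omega>)
    then show ?case by (intro convergent_matrixI) simp
  qed
qed

section \<open>Initial points attracted to strict saddles\<close>

definition "attracted s = {y \<in> X. \<exists>l\<in>strict_saddles X EF. (\<lambda>k. orbit k y s) \<longlonglongrightarrow> l}"

text \<open>There may be uncountably many saddles, each with its own exceptional set of outcomes.
  Because the trapping radii do not depend on the outcome, the countable cover can be chosen first,
  and the union of countably many exceptional null sets remains null.\<close>

lemma AE_negligible_attracted: "AE \<omega> in M. negligible (attracted (\<lambda>k. \<xi> k \<omega>))"
proof -
  let ?SS = "strict_saddles X EF"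
  define trap where "trap c \<rho> \<longleftrightarrow> \<rho> > 0 \<and> (\<forall>s. (\<forall>k. s k \<in> space S) \<longrightarrow>
      convergent (\<lambda>n. \<Sum>k<n. \<alpha> k *\<^sub>R (lh c (s k) - HF c)) \<longrightarrow>
      negligible {y \<in> X. \<exists>K. \<forall>k\<ge>K. orbit k y s \<in> cball c \<rho>})" for c and \<rho> :: real
  have "\<exists>\<rho>. trap c \<rho>" if saddle: "c \<in> ?SS" for c
  proof -
    have c: "c \<in> X" using saddle by (simp add: strict_saddles_def)
    obtain p0 where "p0 \<bullet> (HF c *v p0) < 0"
      using saddle lambda_min_neg_iff[OF HF_symmetric[OF c]] unfolding strict_saddles_def by blast
    then show ?thesis
    proof (rule negligible_saddle_neighbourhood[OF c HF_symmetric[OF c]])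
      fix \<rho> :: real
      assume "\<rho> > 0" "\<And>s. (\<And>k. s k \<in> space S) \<Longrightarrow>
        convergent (\<lambda>n. \<Sum>k<n. \<alpha> k *\<^sub>R (lh c (s k) - HF c)) \<Longrightarrow>
        negligible {y \<in> X. \<exists>K. \<forall>k\<ge>K. orbit k y s \<in> cball c \<rho>}"
      then have "trap c \<rho>" unfolding trap_def by blast
      then show ?thesis ..
    qed
  qed
  then have "\<forall>c\<in>?SS. \<exists>\<rho>. trap c \<rho>" by blast
  from bchoice[OF this] obtain r where trap: "\<And>c. c \<in> ?SS \<Longrightarrow> trap c (r c)" by blast
  have r: "r c > 0" if "c \<in> ?SS" for c using trap[OF that] by (simp add: trap_def)
  obtain \<D> where \<D>: "\<D> \<subseteq> (\<lambda>c. ball c (r c)) ` ?SS" "countable \<D>" "\<Union>\<D> = (\<Union>c\<in>?SS. ball c (r c))"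
    using Lindelof[of "(\<lambda>c. ball c (r c)) ` ?SS"] by auto
  from countable_subset_image[THEN iffD1, OF conjI, OF \<D>(2,1)]
  obtain C where C: "C \<subseteq> ?SS" "countable C" "\<D> = (\<lambda>c. ball c (r c)) ` C"
    by blast
  have cover: "?SS \<subseteq> (\<Union>c\<in>C. ball c (r c))"
  proof
    fix l assume l: "l \<in> ?SS"
    then have "l \<in> (\<Union>c\<in>?SS. ball c (r c))" by (rule UN_I) (simp add: r[OF l])
    then show "l \<in> (\<Union>c\<in>C. ball c (r c))" using \<D>(3) C(3) by auto
  qed
  have "AE \<omega> in M. \<forall>c\<in>C. convergent (\<lambda>n. \<Sum>k<n. \<alpha> k *\<^sub>R (lh c (\<xi> k \<omega>) - HF c))"
    using C AE_noise_convergent by (intro AE_ball_countable[THEN iffD2] ballI) (auto simp: strict_saddles_def)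
  with AE_space show ?thesis
  proof eventually_elim
    case (elim \<omega>)
    define s where "s k = \<xi> k \<omega>" for k
    have "negligible (\<Union>c\<in>C. {y \<in> X. \<exists>K. \<forall>k\<ge>K. orbit k y s \<in> cball c (r c)})"
    proof (rule negligible_countable_Union)
      show "countable ((\<lambda>c. {y \<in> X. \<exists>K. \<forall>k\<ge>K. orbit k y s \<in> cball c (r c)}) ` C)" using C by simp
      fix N assume "N \<in> (\<lambda>c. {y \<in> X. \<exists>K. \<forall>k\<ge>K. orbit k y s \<in> cball c (r c)}) ` C"
      then obtain c where c: "c \<in> C" "N = {y \<in> X. \<exists>K. \<forall>k\<ge>K. orbit k y s \<in> cball c (r c)}" by blast
      show "negligible N"
      proof -
        have trapc: "trap c (r c)" using trap c(1) C(1) by blast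
        have sp: "\<forall>k. s k \<in> space S" using \<xi>_space[OF elim(1)] by (simp add: s_def)
        have conv: "convergent (\<lambda>n. \<Sum>k<n. \<alpha> k *\<^sub>R (lh c (s k) - HF c))"
          using elim(2) c(1) by (simp add: s_def)
        show ?thesis
          unfolding c(2) by (rule trapc[unfolded trap_def, THEN conjunct2, THEN spec, THEN mp, OF sp, THEN mp, OF conv])
      qed
    qed
    then have "negligible (attracted s)"
    proof (rule negligible_subset)
      show "attracted s \<subseteq> (\<Union>c\<in>C. {y \<in> X. \<exists>K. \<forall>k\<ge>K. orbit k y s \<in> cball c (r c)})"
      proof
        fix y assume "y \<in> attracted s"
        then obtain l where y: "y \<in> X" "l \<in> ?SS" "(\<lambda>k. orbit k y s) \<longlonglongrightarrow> l"
          unfolding attracted_def by blast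
        then obtain c where c: "c \<in> C" "l \<in> ball c (r c)" using cover by blast
        have "\<forall>\<^sub>F k in sequentially. orbit k y s \<in> ball c (r c)"
          using topological_tendstoD[OF y(3) open_ball c(2)] .
        then have "\<exists>K. \<forall>k\<ge>K. orbit k y s \<in> cball c (r c)"
          unfolding eventually_sequentially using ball_subset_cball by blast
        then show "y \<in> (\<Union>c\<in>C. {y \<in> X. \<exists>K. \<forall>k\<ge>K. orbit k y s \<in> cball c (r c)})"
          using y(1) c(1) by blast
      qed
    qed
    then show ?case by (simp add: s_def[abs_def])
  qed
qed

text \<open>Measurability is assumed of \<open>x 0\<close> only; through this identity the later
  iterates inherit it from the orbits.\<close>

lemma x_eq_orbit: "\<omega> \<in> space M \<Longrightarrow> x k \<omega> = orbit k (x 0 \<omega>) (\<lambda>k. \<xi> k \<omega>)"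
proof (induction k)
  case (Suc k)
  have "x k \<omega> \<in> X" using Suc orbit_in_X[OF x0_in_X] by metis
  from smd_step_eq[OF step[OF Suc.prems] this] show ?case using Suc \<alpha> by simp
qed simp

text \<open>The density belongs to the dual initial point, so the null set is first carried to the
  dual space by the differentiable map \<open>dh\<close>.\<close>

lemma prob_x0_negligible:
  assumes V: "V \<in> sets R" "negligible V"
  shows "emeasure (distr M R (x 0)) V = 0"
proof -
  have x0R: "x 0 \<in> measurable M R"
    using x0_measurable x0_in_X by (intro measurable_restrict_space2) auto
  have "V \<subseteq> X" using sets.sets_into_space[OF V(1)] by (simp add: space_restrict_space)
  then have "negligible (dh ` V)" using V(2) by (intro negligible_dh_image)
  then obtain N where N: "N \<in> null_sets lborel" "dh ` V \<subseteq> N"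
    by (rule negligible_subset_null_sets_lborel)
  obtain \<rho> where \<rho>: "distributed M lborel (\<lambda>\<omega>. dh (x 0 \<omega>)) \<rho>" using x0_density by blast
  have Zm: "(\<lambda>\<omega>. dh (x 0 \<omega>)) \<in> measurable M lborel" using distributed_measurable[OF \<rho>] .
  have "emeasure M (x 0 -` V \<inter> space M) \<le> emeasure M ((\<lambda>\<omega>. dh (x 0 \<omega>)) -` N \<inter> space M)"
    using N Zm by (intro emeasure_mono) (auto intro: measurable_sets)
  also have "\<dots> = emeasure (distr M lborel (\<lambda>\<omega>. dh (x 0 \<omega>))) N"
    using N by (subst emeasure_distr[OF Zm]) auto
  also have "\<dots> = emeasure (density lborel \<rho>) N"
    using distributed_distr_eq_density[OF \<rho>] by simp
  also have "\<dots> = 0"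
    using absolutely_continuousI_density[OF distributed_borel_measurable[OF \<rho>]] N(1)
    unfolding absolutely_continuous_def by blast
  finally show ?thesis by (simp add: emeasure_distr[OF x0R V(1)])
qed

text \<open>Independence is the product formula on rectangles, and these determine the product
  measure.\<close>

lemma distr_pair:
  "distr M R (x 0) \<Otimes>\<^sub>M distr M PS (\<lambda>\<omega> k. \<xi> k \<omega>) =
    distr M (R \<Otimes>\<^sub>M PS) (\<lambda>\<omega>. (x 0 \<omega>, \<lambda>k. \<xi> k \<omega>))"
proof (rule pair_measure_eqI)
  have x0R: "x 0 \<in> measurable M R"
    using x0_measurable x0_in_X by (intro measurable_restrict_space2) auto
  have \<xi>PS: "(\<lambda>\<omega> k. \<xi> k \<omega>) \<in> measurable M PS" by (intro measurable_PiM_single') (auto simp: \<xi>_space)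
  interpret P1: prob_space "distr M R (x 0)" by (rule prob_space_distr[OF x0R])
  interpret P2: prob_space "distr M PS (\<lambda>\<omega> k. \<xi> k \<omega>)" by (rule prob_space_distr[OF \<xi>PS])
  show "sigma_finite_measure (distr M R (x 0))" "sigma_finite_measure (distr M PS (\<lambda>\<omega> k. \<xi> k \<omega>))"
    by unfold_locales
  fix A B assume "A \<in> sets (distr M R (x 0))" "B \<in> sets (distr M PS (\<lambda>\<omega> k. \<xi> k \<omega>))"
  then have A: "A \<in> sets R" and B: "B \<in> sets PS" by auto
  \<comment> \<open>\<open>X\<close> is open, so measurable sets of the restricted space are Borel,
    as \<open>init_indep\<close> expects.\<close>
  have A': "A \<in> sets borel" using A open_X by (subst (asm) sets_restrict_space_iff) auto
  have "prob ((x 0 -` A \<inter> space M) \<inter> ((\<lambda>\<omega> k. \<xi> k \<omega>) -` B \<inter> space M)) =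
      prob (x 0 -` A \<inter> space M) * prob ((\<lambda>\<omega> k. \<xi> k \<omega>) -` B \<inter> space M)"
    by (rule indep_setD[OF x0_indep[unfolded init_indep_def]]) (use A' B in blast)+
  moreover have "(\<lambda>\<omega>. (x 0 \<omega>, \<lambda>k. \<xi> k \<omega>)) -` (A \<times> B) \<inter> space M =
      (x 0 -` A \<inter> space M) \<inter> ((\<lambda>\<omega> k. \<xi> k \<omega>) -` B \<inter> space M)" by auto
  ultimately show "emeasure (distr M R (x 0)) A * emeasure (distr M PS (\<lambda>\<omega> k. \<xi> k \<omega>)) B =
      emeasure (distr M (R \<Otimes>\<^sub>M PS) (\<lambda>\<omega>. (x 0 \<omega>, \<lambda>k. \<xi> k \<omega>))) (A \<times> B)"
    using A B x0R \<xi>PS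
    by (simp add: emeasure_distr measurable_Pair emeasure_eq_measure ennreal_mult)
qed (simp cong: sets_pair_measure_cong)

theorem strict_saddles_avoided:
  defines "E \<equiv> {\<omega> \<in> space M. \<exists>l\<in>strict_saddles X EF. (\<lambda>k. x k \<omega>) \<longlonglongrightarrow> l}"
  shows "E \<in> sets M" "prob E = 0"
proof -
  define W where "W = {p \<in> space (R \<Otimes>\<^sub>M PS). \<exists>l\<in>strict_saddles X EF. (\<lambda>k. orbit k (fst p) (snd p)) \<longlonglongrightarrow> l}"
  have "(\<lambda>p. orbit k (fst p) (snd p)) \<in> borel_measurable (R \<Otimes>\<^sub>M PS)" for k
  proof -
    have "(\<lambda>y. y) \<in> borel_measurable R" by (intro measurable_restrict_space1) simp
    from measurable_compose[OF orbit_measurable this] show ?thesis by (simp add: case_prod_beta')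
  qed
  then have W: "W \<in> sets (R \<Otimes>\<^sub>M PS)"
    unfolding W_def by (intro sets_tendsto_in strict_saddles_borel)
  have x0R: "x 0 \<in> measurable M R"
    using x0_measurable x0_in_X by (intro measurable_restrict_space2) auto
  have \<xi>PS: "(\<lambda>\<omega> k. \<xi> k \<omega>) \<in> measurable M PS" by (intro measurable_PiM_single') (auto simp: \<xi>_space)
  define J where "J \<omega> = (x 0 \<omega>, \<lambda>k. \<xi> k \<omega>)" for \<omega>
  have J: "J \<in> measurable M (R \<Otimes>\<^sub>M PS)" unfolding J_def by (intro measurable_Pair x0R \<xi>PS)
  have E: "E = J -` W \<inter> space M"
  proof -
    have "J \<omega> \<in> W \<longleftrightarrow> (\<exists>l\<in>strict_saddles X EF. (\<lambda>k. x k \<omega>) \<longlonglongrightarrow> l)" if "\<omega> \<in> space M" for \<omega>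
    proof -
      have eq: "(\<lambda>k. x k \<omega>) = (\<lambda>k. orbit k (x 0 \<omega>) (\<lambda>k. \<xi> k \<omega>))"
        by (rule ext) (rule x_eq_orbit[OF that])
      show ?thesis
        unfolding eq using measurable_space[OF J that] by (simp add: W_def J_def)
    qed
    then show ?thesis unfolding E_def by blast
  qed
  then show "E \<in> sets M" using measurable_sets[OF J W] by simp
  interpret P1: prob_space "distr M R (x 0)" by (rule prob_space_distr[OF x0R])
  interpret P2: prob_space "distr M PS (\<lambda>\<omega> k. \<xi> k \<omega>)" by (rule prob_space_distr[OF \<xi>PS])
  interpret P: pair_sigma_finite "distr M R (x 0)" "distr M PS (\<lambda>\<omega> k. \<xi> k \<omega>)" ..
  have W': "W \<in> sets (distr M R (x 0) \<Otimes>\<^sub>M distr M PS (\<lambda>\<omega> k. \<xi> k \<omega>))"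
    using W by (simp add: distr_pair)
  have "emeasure M E = emeasure (distr M (R \<Otimes>\<^sub>M PS) J) W"
    by (simp add: E emeasure_distr[OF J W])
  also have "\<dots> = emeasure (distr M R (x 0) \<Otimes>\<^sub>M distr M PS (\<lambda>\<omega> k. \<xi> k \<omega>)) W"
    by (simp add: distr_pair J_def[abs_def])
  \<comment> \<open>The initial point is integrated first, with the samples fixed: for almost every
    outcome the section of \<open>W\<close> lies in a null set of attracted points.\<close>
  also have "\<dots> = (\<integral>\<^sup>+ s. emeasure (distr M R (x 0)) ((\<lambda>y. (y, s)) -` W) \<partial>distr M PS (\<lambda>\<omega> k. \<xi> k \<omega>))"
    by (rule P.emeasure_pair_measure_alt2[OF W'])
  also have "\<dots> = (\<integral>\<^sup>+ \<omega>. emeasure (distr M R (x 0)) ((\<lambda>y. (y, \<lambda>k. \<xi> k \<omega>)) -` W) \<partial>M)"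
    using P.measurable_emeasure_Pair2[OF W'] by (intro nn_integral_distr[OF \<xi>PS]) simp
  also have "\<dots> = (\<integral>\<^sup>+ \<omega>. 0 \<partial>M)"
  proof (rule nn_integral_cong_AE)
    show "AE \<omega> in M. emeasure (distr M R (x 0)) ((\<lambda>y. (y, \<lambda>k. \<xi> k \<omega>)) -` W) = 0"
      using AE_space AE_negligible_attracted
    proof eventually_elim
      case (elim \<omega>)
      have V: "(\<lambda>y. (y, \<lambda>k. \<xi> k \<omega>)) -` W \<in> sets R" using sets_Pair2[OF W] .
      have "(\<lambda>y. (y, \<lambda>k. \<xi> k \<omega>)) -` W \<subseteq> attracted (\<lambda>k. \<xi> k \<omega>)"
        unfolding W_def attracted_def by (auto simp: space_pair_measure space_restrict_space)
      then show ?case using prob_x0_negligible[OF V] elim(2) negligible_subset by blast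
    qed
  qed
  finally show "prob E = 0" by (simp add: measure_def)
qed

end

theorem corollary4p8:
  fixes M :: "'w measure" and S :: "'s measure" and \<xi> :: "nat \<Rightarrow> 'w \<Rightarrow> 's"
    and h :: "real ^ 'n \<Rightarrow> ereal" and f :: "real ^ 'n \<Rightarrow> 's \<Rightarrow> real"
    and L q :: real and \<alpha> :: "nat \<Rightarrow> real" and x :: "nat \<Rightarrow> 'w \<Rightarrow> real ^ 'n"
  assumes "prob_space M"
    and "mirror_kernel h"
    and "L > 0" and "relatively_smooth S h f L"
    and "q > 2" and "sample_loss M S \<xi> (mirror_domain h) f q"
    and "\<And>k. 0 < \<alpha> k \<and> \<alpha> k < 1 / L"
    and "filterlim (\<lambda>n. \<Sum>k<n. \<alpha> k) at_top sequentially"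
    and "summable (\<lambda>i. (\<alpha> i)\<^sup>2)" and "summable (\<lambda>k. (\<Sum>i. (\<alpha> (k + 1 + i))\<^sup>2) powr (q / 2))"
    and "x 0 \<in> borel_measurable M" and "\<And>\<omega>. \<omega> \<in> space M \<Longrightarrow> x 0 \<omega> \<in> mirror_domain h"
    and "init_indep M S \<xi> (x 0)"
    and "\<exists>\<rho>. distributed M lborel (\<lambda>\<omega>. kernel_grad h (x 0 \<omega>)) \<rho>"
    and "\<And>k \<omega>. \<omega> \<in> space M \<Longrightarrow>
           smd_step h (\<alpha> k) (loss_grad f (x k \<omega>) (\<xi> k \<omega>)) (x k \<omega>) (x (Suc k) \<omega>)"
  shows "let E = {\<omega> \<in> space M. \<exists>l \<in> strict_saddles (mirror_domain h) (expected_loss S f).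
                 (\<lambda>k. x k \<omega>) \<longlonglongrightarrow> l}
         in E \<in> sets M \<and> measure M E = 0"
proof -
  interpret prob_space M by fact
  obtain \<omega> where "\<omega> \<in> space M" using not_empty by blast
  \<comment> \<open>A probability space has at least one outcome, and there the initial point lies
    in the mirror domain.\<close>
  then have ne: "mirror_domain h \<noteq> {}" using assms(12) by blast
  have "\<And>s. s \<in> space S \<Longrightarrow> C2_on (\<lambda>x. f x s) (mirror_domain h)"
    and "\<And>Q. compact Q \<Longrightarrow> Q \<subseteq> mirror_domain h \<Longrightarrow>
      \<exists>LQ. \<forall>x\<in>Q. \<forall>y\<in>Q. \<forall>s\<in>space S. opnorm (loss_hess f x s - loss_hess f y s) \<le> LQ * norm (x - y)"
    using assms(6) by (simp_all add: sample_loss_def)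
  then interpret stochastic_mirror_descent h S f L \<alpha> M \<xi> q x
    using assms ne by unfold_locales
  show ?thesis using strict_saddles_avoided unfolding Let_def by blast
qed

end
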